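(* Let $N\ge1$, $\frac{(N-2)_+}{N}<m<1$, $q>1$, and $u_0\in L^1(\mathbb{R}^N)\cap L^\infty(\mathbb{R}^N)$, $u_0\ge0$, $u_0\not\equiv0$, and let $u$ be the solution to $\partial_t u-\Delta u^m+u^q=0$ in $(0,\infty)\times\mathbb{R}^N$, $u(0)=u_0$. Then for all $(t,x)\in(0,\infty)\times\mathbb{R}^N$, $$\big|\nabla u^{(m-1)/2}(t,x)\big|\le\sqrt{(3-m-2q)_+B_0}\,\|u_0\|_\infty^{(q-1)/2}+\sqrt{\frac{B_0}{t}},\qquad B_0:=\frac{1-m}{2m(mN-N+2)},$$ and $$0<u(t,x)\le\big(\|u_0\|_\infty^{1-q}+(q-1)t\big)^{-1/(q-1)}.$$
   Context: The solution of the Cauchy problem is the unique nonnegative solution $u\in BC((0,\infty)\times\mathbb{R}^N)\cap C([0,\infty);L^1(\mathbb{R}^N))$; it is positive and $C^\infty$ in $(0,\infty)\times\mathbb{R}^N$. $(a)_+=\max\{a,0\}$. *)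

theory Defs
  imports "HOL-Analysis.Analysis" "HOL-Probability.Essential_Supremum"
begin

fun Ck_on :: "nat \<Rightarrow> ('a::euclidean_space \<Rightarrow> real) \<Rightarrow> 'a set \<Rightarrow> bool" where
  "Ck_on 0 f S = continuous_on S f"
| "Ck_on (Suc k) f S = ((\<forall>x\<in>S. f differentiable (at x)) \<and>
      (\<forall>v. Ck_on k (\<lambda>x. frechet_derivative f (at x) v) S))"

definition smooth_on :: "('a::euclidean_space \<Rightarrow> real) \<Rightarrow> 'a set \<Rightarrow> bool" where
  "smooth_on f S = (\<forall>k. Ck_on k f S)"

definition pdiff :: "'n::finite \<Rightarrow> (real^'n \<Rightarrow> real) \<Rightarrow> real^'n \<Rightarrow> real" where
  "pdiff i f x = frechet_derivative f (at x) (axis i 1)"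

definition grad :: "(real^'n::finite \<Rightarrow> real) \<Rightarrow> real^'n \<Rightarrow> real^'n" where
  "grad f x = (\<chi> i. pdiff i f x)"

definition laplacian :: "(real^'n::finite \<Rightarrow> real) \<Rightarrow> real^'n \<Rightarrow> real" where
  "laplacian f x = (\<Sum>i\<in>UNIV. pdiff i (pdiff i f) x)"

definition Linf_norm :: "(real^'n::finite \<Rightarrow> real) \<Rightarrow> real" where
  "Linf_norm f = real_of_ereal (esssup lborel (\<lambda>x. ereal \<bar>f x\<bar>))"

definition is_solution :: "real \<Rightarrow> real \<Rightarrow> (real^'n::finite \<Rightarrow> real) \<Rightarrow> (real \<Rightarrow> real^'n \<Rightarrow> real) \<Rightarrow> bool" where
  "is_solution m q u0 u \<longleftrightarrow>
     (\<forall>x. u 0 x = u0 x) \<and>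
     (\<forall>t>0. \<forall>x. u t x \<ge> 0) \<and>
     (\<exists>C. \<forall>t>0. \<forall>x. \<bar>u t x\<bar> \<le> C) \<and>
     smooth_on (\<lambda>p. u (fst p) (snd p)) {p. fst p > 0} \<and>
     smooth_on (\<lambda>p. u (fst p) (snd p) powr m) {p. fst p > 0} \<and>
     (\<forall>t\<ge>0. integrable lborel (u t)) \<and>
     (\<forall>t\<ge>0. ((\<lambda>s. LINT x|lborel. \<bar>u s x - u t x\<bar>) \<longlongrightarrow> 0) (at t within {0..})) \<and>
     (\<forall>t>0. \<forall>x. frechet_derivative (\<lambda>s. u s x) (at t) 1
                 - laplacian (\<lambda>y. u t y powr m) x + u t x powr q = 0)"

end

theory Submission
  imports Defs
begin

text \<open>
  All estimates are obtained by comparing \<open>u\<^sup>m\<close>, or \<open>|\<nabla>v|\<^sup>2\<close> with \<open>v = u\<^bsup>(m-1)/2\<^esup>\<close>, with a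
  radial barrier at a point of contact; only the initial trace needs integrals. If \<open>u(t\<^sub>1)\<close> does not
  vanish identically, then a barrier in an exterior domain gives \<open>u(t\<^sub>1,x) \<ge> c (1 + |x|\<^sup>2)\<^bsup>-1/(1-m)\<^esup>\<close>,
  and a Barenblatt-like barrier, a subsolution precisely because \<open>m > (N-2)/N\<close>, propagates this
  tail to all later times. Thus \<open>u > 0\<close> and \<open>v\<close> grows at most linearly. The norms of \<open>u(t)\<close> in
  \<open>L\<^sup>r\<close> do not increase; letting \<open>r \<rightarrow> \<infinity>\<close> yields \<open>u \<le> \<parallel>u\<^sub>0\<parallel>\<^sub>\<infinity>\<close>, and comparison with the solution
  of \<open>W' = -W\<^sup>q\<close> the decay estimate. Finally \<open>z = |\<nabla>v|\<^sup>2\<close> satisfies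
  \<open>\<partial>\<^sub>t z \<le> m v\<^sup>2 \<Delta>z + b \<cdot> \<nabla>z - z\<^sup>2/B\<^sub>0 + (3-m-2q) u\<^bsup>q-1\<^esup> z\<close>, of which \<open>A B\<^sub>0 + B\<^sub>0/t\<close> is a supersolution;
  the linear growth of \<open>v\<close> makes the localization errors negligible.
\<close>

section \<open>Calculus of smooth functions\<close>

text \<open>The constant \<open>B0\<close> is dictated by an explicit solution: without absorption,
  the function \<open>u\<close> with \<open>u powr (m - 1) = B0 |x|^2 / t\<close> solves the
  equation for x other than 0, and it has \<open>|grad v|^2 = B0 / t\<close> exactly. Its tail is
  also the one for which \<open>v\<close> grows linearly, so a lower bound on the tail of
  \<open>u\<close> and an upper bound on the growth of \<open>v\<close> are the same statement. Two
  obstacles shape the proof. \<open>is_solution\<close> grants no positivity and no decay at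
  infinity, so an extremum over the whole space need not be attained; each barrier therefore
  contains a device that forces the contact into a compact set (an outer radius, a constant shift, a
  quadratic term, a blow-up at finite radius), and its parameter is sent to its limit afterwards.
  And the initial datum is attained only in \<open>L^1\<close>, so pointwise comparison must start
  at a positive time; the final estimates depend on this time only in an explicit way, and it tends
  to 0 at the end. For the same reason the bound by the supremum of \<open>u0\<close> cannot come
  from comparison at time 0 but goes through integral norms.\<close>

lemma frechet_derivative_cong_open:
  fixes f g :: "'a::real_normed_vector \<Rightarrow> 'b::real_normed_vector"
  assumes "open S" "x \<in> S" "\<And>y. y \<in> S \<Longrightarrow> f y = g y"
  shows "frechet_derivative f (at x) = frechet_derivative g (at x)"
proof -
  have "(f has_derivative D) (at x) \<longleftrightarrow> (g has_derivative D) (at x)" for D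
    using assms by (metis has_derivative_transform_within_open)
  then show ?thesis by (simp add: frechet_derivative_def)
qed

lemma differentiable_cong_open:
  fixes f g :: "'a::real_normed_vector \<Rightarrow> 'b::real_normed_vector"
  assumes "open S" "x \<in> S" "\<And>y. y \<in> S \<Longrightarrow> f y = g y" "f differentiable (at x)"
  shows "g differentiable (at x)"
  using assms unfolding differentiable_def by (metis has_derivative_transform_within_open)

lemma Ck_on_cong:
  assumes "open S" "\<And>x. x \<in> S \<Longrightarrow> f x = g x" "Ck_on k f S"
  shows "Ck_on k g S"
  using assms(2,3)
proof (induction k arbitrary: f g)
  case 0
  then show ?case using continuous_on_cong by fastforce
next
  case (Suc k)
  have "g differentiable (at x)" if "x \<in> S" for x
    using differentiable_cong_open[OF assms(1) that Suc.prems(1)] Suc.prems(2) that by auto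
  moreover have "Ck_on k (\<lambda>x. frechet_derivative g (at x) v) S" for v
  proof (rule Suc.IH[where f = "\<lambda>x. frechet_derivative f (at x) v"])
    show "frechet_derivative f (at x) v = frechet_derivative g (at x) v" if "x \<in> S" for x
      using frechet_derivative_cong_open[OF assms(1) that Suc.prems(1)] by simp
  qed (use Suc.prems in auto)
  ultimately show ?case by auto
qed

lemma Ck_on_SucD: "Ck_on (Suc k) f S \<Longrightarrow> Ck_on k f S"
proof (induction k arbitrary: f)
  case 0
  then show ?case
    by (auto intro!: continuous_at_imp_continuous_on differentiable_imp_continuous_within)
next
  case (Suc k)
  show ?case using Suc.prems Suc.IH by (metis Ck_on.simps(2))
qed

lemma Ck_on_const: "Ck_on k (\<lambda>x. c) S"
proof (induction k arbitrary: c)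
  case (Suc k)
  then show ?case by (simp add: frechet_derivative_const)
qed auto

lemma has_derivative_frechet_derivative:
  "f differentiable (at x) \<Longrightarrow> (f has_derivative frechet_derivative f (at x)) (at x)"
  by (simp add: frechet_derivative_works)

lemma frechet_derivative_add:
  fixes f g :: "'a::euclidean_space \<Rightarrow> real"
  assumes "f differentiable (at x)" "g differentiable (at x)"
  shows "frechet_derivative (\<lambda>x. f x + g x) (at x) v
     = frechet_derivative f (at x) v + frechet_derivative g (at x) v"
  using frechet_derivative_at[symmetric, OF has_derivative_add[OF assms[THEN has_derivative_frechet_derivative]]] by simp

lemma frechet_derivative_mult:
  fixes f g :: "'a::euclidean_space \<Rightarrow> real"
  assumes "f differentiable (at x)" "g differentiable (at x)"
  shows "frechet_derivative (\<lambda>x. f x * g x) (at x) v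
     = frechet_derivative f (at x) v * g x + f x * frechet_derivative g (at x) v"
  using frechet_derivative_at[symmetric, OF has_derivative_mult[OF assms[THEN has_derivative_frechet_derivative]]] by simp

lemma has_derivative_powr_const:
  fixes f :: "'a::euclidean_space \<Rightarrow> real"
  assumes "(f has_derivative D) (at x)" "f x > 0"
  shows "((\<lambda>x. f x powr a) has_derivative (\<lambda>v. a * f x powr (a - 1) * D v)) (at x)"
proof -
  have "((\<lambda>y. y powr a) has_derivative (\<lambda>h. (a * f x powr (a - 1)) * h)) (at (f x))"
    using has_real_derivative_powr[OF assms(2), of a] by (simp add: has_field_derivative_def)
  from has_derivative_compose[OF assms(1) this] show ?thesis by simp
qed

lemma frechet_derivative_powr:
  fixes f :: "'a::euclidean_space \<Rightarrow> real"
  assumes "f differentiable (at x)" "f x > 0"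
  shows "frechet_derivative (\<lambda>x. f x powr a) (at x) v
     = a * f x powr (a - 1) * frechet_derivative f (at x) v"
  using frechet_derivative_at[symmetric, OF has_derivative_powr_const[OF has_derivative_frechet_derivative[OF assms(1)] assms(2)]]
  by simp

lemma Ck_on_add:
  assumes "open S" "Ck_on k f S" "Ck_on k g S"
  shows "Ck_on k (\<lambda>x. f x + g x) S"
  using assms(2,3)
proof (induction k arbitrary: f g)
  case 0
  then show ?case by (auto intro: continuous_intros)
next
  case (Suc k)
  have "Ck_on k (\<lambda>x. frechet_derivative (\<lambda>x. f x + g x) (at x) v) S" for v
  proof (rule Ck_on_cong[OF assms(1)])
    show "Ck_on k (\<lambda>x. frechet_derivative f (at x) v + frechet_derivative g (at x) v) S"
      using Suc.prems by (intro Suc.IH) auto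
  qed (use Suc.prems in \<open>simp add: frechet_derivative_add\<close>)
  then show ?case using Suc.prems by auto
qed

lemma Ck_on_mult:
  assumes "open S" "Ck_on k f S" "Ck_on k g S"
  shows "Ck_on k (\<lambda>x. f x * g x) S"
  using assms(2,3)
proof (induction k arbitrary: f g)
  case 0
  then show ?case by (auto intro: continuous_intros)
next
  case (Suc k)
  have "Ck_on k (\<lambda>x. frechet_derivative (\<lambda>x. f x * g x) (at x) v) S" for v
  proof (rule Ck_on_cong[OF assms(1)])
    show "Ck_on k (\<lambda>x. frechet_derivative f (at x) v * g x + f x * frechet_derivative g (at x) v) S"
      using Suc.prems Ck_on_SucD[OF Suc.prems(1)] Ck_on_SucD[OF Suc.prems(2)]
      by (intro Ck_on_add[OF assms(1)] Suc.IH) auto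
  qed (use Suc.prems in \<open>simp add: frechet_derivative_mult\<close>)
  then show ?case using Suc.prems by auto
qed

lemma Ck_on_powr:
  assumes "open S" "Ck_on k f S" "\<And>x. x \<in> S \<Longrightarrow> f x > 0"
  shows "Ck_on k (\<lambda>x. f x powr a) S"
  using assms(2)
\<comment> \<open>The exponent varies because each derivative lowers it by one.\<close>
proof (induction k arbitrary: a)
  case 0
  then show ?case using assms(3) by (force intro!: continuous_intros)
next
  case (Suc k)
  have diff: "f differentiable (at x)" if "x \<in> S" for x using Suc.prems that by auto
  have "Ck_on k (\<lambda>x. frechet_derivative (\<lambda>x. f x powr a) (at x) v) S" for v
  proof (rule Ck_on_cong[OF assms(1)])
    show "Ck_on k (\<lambda>x. a * f x powr (a - 1) * frechet_derivative f (at x) v) S"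
      using Suc.prems Ck_on_SucD[OF Suc.prems]
      by (intro Ck_on_mult[OF assms(1)] Ck_on_const Suc.IH) auto
  qed (use diff assms(3) in \<open>simp add: frechet_derivative_powr\<close>)
  moreover have "(\<lambda>x. f x powr a) differentiable (at x)" if "x \<in> S" for x
    using has_derivative_powr_const[OF has_derivative_frechet_derivative[OF diff[OF that]] assms(3)[OF that]]
    by (auto simp: differentiable_def)
  ultimately show ?case by auto
qed

lemma smooth_on_const: "smooth_on (\<lambda>x. c) S"
  by (simp add: smooth_on_def Ck_on_const)

lemma smooth_on_add:
  "open S \<Longrightarrow> smooth_on f S \<Longrightarrow> smooth_on g S \<Longrightarrow> smooth_on (\<lambda>x. f x + g x) S"
  by (simp add: smooth_on_def Ck_on_add)

lemma smooth_on_mult: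
  "open S \<Longrightarrow> smooth_on f S \<Longrightarrow> smooth_on g S \<Longrightarrow> smooth_on (\<lambda>x. f x * g x) S"
  by (simp add: smooth_on_def Ck_on_mult)

lemma smooth_on_powr:
  "open S \<Longrightarrow> smooth_on f S \<Longrightarrow> (\<And>x. x \<in> S \<Longrightarrow> f x > 0) \<Longrightarrow> smooth_on (\<lambda>x. f x powr a) S"
  by (simp add: smooth_on_def Ck_on_powr)

lemma smooth_on_sum:
  assumes "open S" "finite I" "\<And>i. i \<in> I \<Longrightarrow> smooth_on (f i) S"
  shows "smooth_on (\<lambda>x. \<Sum>i\<in>I. f i x) S"
  using assms(2,3)
proof (induction rule: finite_induct)
  case (insert i I)
  then show ?case using assms(1) smooth_on_add[of S "f i" "\<lambda>x. \<Sum>i\<in>I. f i x"] by simp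
qed (auto simp: smooth_on_const)

lemma smooth_on_differentiable: "smooth_on f S \<Longrightarrow> x \<in> S \<Longrightarrow> f differentiable (at x)"
  unfolding smooth_on_def by (metis Ck_on.simps(2))

lemma smooth_on_frechet: "smooth_on f S \<Longrightarrow> smooth_on (\<lambda>x. frechet_derivative f (at x) v) S"
  unfolding smooth_on_def by (metis Ck_on.simps(2))

lemma smooth_on_continuous: "smooth_on f S \<Longrightarrow> continuous_on S f"
  unfolding smooth_on_def by (metis Ck_on.simps(1))

lemma frechet_derivative_sum:
  fixes f :: "'i \<Rightarrow> 'a::euclidean_space \<Rightarrow> real"
  assumes "\<And>i. i \<in> I \<Longrightarrow> f i differentiable (at x)"
  shows "frechet_derivative (\<lambda>x. \<Sum>i\<in>I. f i x) (at x) v = (\<Sum>i\<in>I. frechet_derivative (f i) (at x) v)"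
proof -
  have "((\<lambda>x. \<Sum>i\<in>I. f i x) has_derivative (\<lambda>v. \<Sum>i\<in>I. frechet_derivative (f i) (at x) v)) (at x)"
    using assms by (intro has_derivative_sum has_derivative_frechet_derivative)
  from frechet_derivative_at[symmetric, OF this] show ?thesis by simp
qed

section \<open>Symmetry of second derivatives\<close>

lemma line_has_derivative:
  fixes f :: "'a::euclidean_space \<Rightarrow> real"
  assumes "f differentiable (at (p + s *\<^sub>R b))"
  shows "((\<lambda>s. f (p + s *\<^sub>R b)) has_real_derivative frechet_derivative f (at (p + s *\<^sub>R b)) b) (at s)"
proof -
  have 1: "((\<lambda>s. p + s *\<^sub>R b) has_derivative (\<lambda>h. h *\<^sub>R b)) (at s)"
    by (auto intro!: derivative_eq_intros)
  from has_derivative_compose[OF 1 has_derivative_frechet_derivative[OF assms]]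
  have "((\<lambda>s. f (p + s *\<^sub>R b)) has_derivative (\<lambda>h. frechet_derivative f (at (p + s *\<^sub>R b)) (h *\<^sub>R b))) (at s)" .
  moreover have "frechet_derivative f (at (p + s *\<^sub>R b)) (h *\<^sub>R b) = frechet_derivative f (at (p + s *\<^sub>R b)) b * h" for h
    using linear_frechet_derivative[OF assms] by (simp add: linear_scale)
  ultimately show ?thesis by (simp add: has_field_derivative_def)
qed

text \<open>The mean value theorem is applied in direction \<open>b\<close> to the difference of
  \<open>f\<close> in direction \<open>c\<close>, and then in direction \<open>c\<close>. The left
  side is symmetric in \<open>b\<close> and \<open>c\<close>, which is what makes the mixed
  derivatives agree.\<close>

lemma second_difference:
  fixes f :: "'a::euclidean_space \<Rightarrow> real"
  assumes f: "smooth_on f S" and h: "h > 0"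
    and box: "\<And>s r. 0 \<le> s \<Longrightarrow> s \<le> h \<Longrightarrow> 0 \<le> r \<Longrightarrow> r \<le> h \<Longrightarrow> p + s *\<^sub>R b + r *\<^sub>R c \<in> S"
  shows "\<exists>s r. 0 < s \<and> s < h \<and> 0 < r \<and> r < h \<and>
     f (p + h *\<^sub>R b + h *\<^sub>R c) - f (p + h *\<^sub>R b) - f (p + h *\<^sub>R c) + f p
     = h\<^sup>2 * frechet_derivative (\<lambda>x. frechet_derivative f (at x) b) (at (p + s *\<^sub>R b + r *\<^sub>R c)) c"
proof -
  let ?g = "\<lambda>s. f ((p + h *\<^sub>R c) + s *\<^sub>R b) - f (p + s *\<^sub>R b)"
  let ?fb = "\<lambda>x. frechet_derivative f (at x) b"
  have "\<exists>s. 0 < s \<and> s < h \<and> ?g h - ?g 0 = (h - 0) * (?fb ((p + h *\<^sub>R c) + s *\<^sub>R b) - ?fb (p + s *\<^sub>R b))"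
  proof (rule MVT2[OF h])
    fix s assume s: "0 \<le> s" "s \<le> h"
    have "(p + h *\<^sub>R c) + s *\<^sub>R b \<in> S" "p + s *\<^sub>R b \<in> S"
      using box[OF s, of h] box[OF s, of 0] h by (auto simp: algebra_simps)
    then show "(?g has_real_derivative (?fb ((p + h *\<^sub>R c) + s *\<^sub>R b) - ?fb (p + s *\<^sub>R b))) (at s)"
      using smooth_on_differentiable[OF f] by (intro DERIV_diff line_has_derivative) auto
  qed
  then obtain s where s: "0 < s" "s < h"
    and 1: "?g h - ?g 0 = h * (?fb ((p + h *\<^sub>R c) + s *\<^sub>R b) - ?fb (p + s *\<^sub>R b))" by auto
  have "\<exists>r. 0 < r \<and> r < h \<and> ?fb ((p + s *\<^sub>R b) + h *\<^sub>R c) - ?fb ((p + s *\<^sub>R b) + 0 *\<^sub>R c)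
      = (h - 0) * frechet_derivative ?fb (at ((p + s *\<^sub>R b) + r *\<^sub>R c)) c"
  proof (rule MVT2[OF h])
    fix r assume r: "0 \<le> r" "r \<le> h"
    show "((\<lambda>r. ?fb ((p + s *\<^sub>R b) + r *\<^sub>R c)) has_real_derivative
        frechet_derivative ?fb (at ((p + s *\<^sub>R b) + r *\<^sub>R c)) c) (at r)"
      using smooth_on_differentiable[OF smooth_on_frechet[OF f]] box r s
      by (intro line_has_derivative) auto
  qed
  then obtain r where r: "0 < r" "r < h"
    and 2: "?fb ((p + s *\<^sub>R b) + h *\<^sub>R c) - ?fb (p + s *\<^sub>R b)
      = h * frechet_derivative ?fb (at ((p + s *\<^sub>R b) + r *\<^sub>R c)) c" by auto
  have "(p + h *\<^sub>R c) + s *\<^sub>R b = (p + s *\<^sub>R b) + h *\<^sub>R c" by simp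
  with 1 2 have "?g h - ?g 0 = h\<^sup>2 * frechet_derivative ?fb (at (p + s *\<^sub>R b + r *\<^sub>R c)) c"
    by (simp add: power2_eq_square)
  moreover have "(p + h *\<^sub>R c) + h *\<^sub>R b = p + h *\<^sub>R b + h *\<^sub>R c" by simp
  ultimately have "f (p + h *\<^sub>R b + h *\<^sub>R c) - f (p + h *\<^sub>R b) - f (p + h *\<^sub>R c) + f p
     = h\<^sup>2 * frechet_derivative ?fb (at (p + s *\<^sub>R b + r *\<^sub>R c)) c" by simp
  then show ?thesis using s r by blast
qed

text \<open>Schwarz's theorem: the same mixed difference over a small parallelogram is
  \<open>h\<^sup>2\<close> times either mixed derivative at some nearby point, and both are
  continuous at \<open>p\<close>.\<close>

lemma frechet_derivative_commute:
  fixes f :: "'a::euclidean_space \<Rightarrow> real"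
  assumes f: "smooth_on f S" and S: "open S" and p: "p \<in> S"
  shows "frechet_derivative (\<lambda>x. frechet_derivative f (at x) b) (at p) c
       = frechet_derivative (\<lambda>x. frechet_derivative f (at x) c) (at p) b"
proof -
  let ?F = "\<lambda>x. frechet_derivative (\<lambda>x. frechet_derivative f (at x) b) (at x) c"
  let ?G = "\<lambda>x. frechet_derivative (\<lambda>x. frechet_derivative f (at x) c) (at x) b"
  obtain d where d: "d > 0" "ball p d \<subseteq> S" using S p by (meson openE)
  \<comment> \<open>Steps of length at most \<open>\<epsilon> / M\<close> in both directions stay
    within distance \<open>\<epsilon>\<close>; the 1 makes the inequality strict and keeps
    \<open>M\<close> positive when \<open>b\<close> and \<open>c\<close> vanish.\<close>
  define M where "M = norm b + norm c + 1"
  have M: "M > 0" unfolding M_def by (smt (verit) norm_ge_zero)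
  have near: "norm (s *\<^sub>R b + r *\<^sub>R c) < \<epsilon>"
    if "0 \<le> s" "s \<le> \<epsilon> / M" "0 \<le> r" "r \<le> \<epsilon> / M" "\<epsilon> > 0" for s r \<epsilon> :: real
  proof -
    have "norm (s *\<^sub>R b + r *\<^sub>R c) \<le> s * norm b + r * norm c"
      using that by (metis abs_of_nonneg norm_scaleR norm_triangle_ineq)
    also have "\<dots> \<le> \<epsilon> / M * norm b + \<epsilon> / M * norm c"
      using that by (intro add_mono mult_right_mono) auto
    also have "\<dots> = \<epsilon> / M * (M - 1)" by (simp add: M_def ring_distribs flip: add_divide_distrib)
    also have "\<dots> < \<epsilon>" using M that by (simp add: field_simps)
    finally show ?thesis .
  qed
  have cont: "continuous (at p) ?F" "continuous (at p) ?G"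
    using smooth_on_continuous[OF smooth_on_frechet[OF smooth_on_frechet[OF f]]] S p
    by (auto simp: continuous_on_eq_continuous_at)
  show ?thesis
  proof (rule ccontr)
    assume neq: "\<not> ?thesis"
    define e where "e = \<bar>?F p - ?G p\<bar> / 2"
    have e: "e > 0" using neq by (simp add: e_def)
    obtain d1 where d1: "d1 > 0" "\<And>y. dist y p < d1 \<Longrightarrow> dist (?F y) (?F p) < e"
      using cont(1) e unfolding continuous_at_eps_delta by blast
    obtain d2 where d2: "d2 > 0" "\<And>y. dist y p < d2 \<Longrightarrow> dist (?G y) (?G p) < e"
      using cont(2) e unfolding continuous_at_eps_delta by blast
    define \<epsilon> where "\<epsilon> = min d (min d1 d2)"
    define h where "h = \<epsilon> / M"
    have pos: "\<epsilon> > 0" "h > 0" using d d1 d2 M by (auto simp: \<epsilon>_def h_def)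
    have nb: "dist (p + s *\<^sub>R b + r *\<^sub>R c) p < \<epsilon>" if "0 \<le> s" "s \<le> h" "0 \<le> r" "r \<le> h" for s r
      using near[of s \<epsilon> r] that pos by (simp add: h_def dist_norm algebra_simps)
    have bx: "p + s *\<^sub>R b + r *\<^sub>R c \<in> S" if "0 \<le> s" "s \<le> h" "0 \<le> r" "r \<le> h" for s r
      using nb[OF that] d(2) by (auto simp: \<epsilon>_def dist_commute)
    have bx': "p + s *\<^sub>R c + r *\<^sub>R b \<in> S" if "0 \<le> s" "s \<le> h" "0 \<le> r" "r \<le> h" for s r
      using bx[of r s] that by (simp add: algebra_simps)
    obtain s r where sr: "0 < s" "s < h" "0 < r" "r < h"
      and 1: "f (p + h *\<^sub>R b + h *\<^sub>R c) - f (p + h *\<^sub>R b) - f (p + h *\<^sub>R c) + f p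
         = h\<^sup>2 * ?F (p + s *\<^sub>R b + r *\<^sub>R c)"
      using second_difference[OF f pos(2) bx] by blast
    obtain s' r' where sr': "0 < s'" "s' < h" "0 < r'" "r' < h"
      and 2: "f (p + h *\<^sub>R c + h *\<^sub>R b) - f (p + h *\<^sub>R c) - f (p + h *\<^sub>R b) + f p
         = h\<^sup>2 * ?G (p + s' *\<^sub>R c + r' *\<^sub>R b)"
      using second_difference[OF f pos(2) bx'] by blast
    have sw: "p + h *\<^sub>R c + h *\<^sub>R b = p + h *\<^sub>R b + h *\<^sub>R c"
       "p + s' *\<^sub>R c + r' *\<^sub>R b = p + r' *\<^sub>R b + s' *\<^sub>R c" by simp_all
    have "h\<^sup>2 * ?F (p + s *\<^sub>R b + r *\<^sub>R c) = h\<^sup>2 * ?G (p + r' *\<^sub>R b + s' *\<^sub>R c)"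
      using 1 2[unfolded sw] by linarith
    then have eq: "?F (p + s *\<^sub>R b + r *\<^sub>R c) = ?G (p + r' *\<^sub>R b + s' *\<^sub>R c)"
      using pos by simp
    have "dist (?F (p + s *\<^sub>R b + r *\<^sub>R c)) (?F p) < e"
      using nb[of s r] sr by (intro d1(2)) (auto simp: \<epsilon>_def)
    moreover have "dist (?G (p + r' *\<^sub>R b + s' *\<^sub>R c)) (?G p) < e"
      using nb[of r' s'] sr' by (intro d2(2)) (auto simp: \<epsilon>_def)
    moreover have "\<bar>?F p - ?G p\<bar> = 2 * e" by (simp add: e_def)
    moreover have False
      if "\<bar>A - a\<bar> < e" "\<bar>B - b\<bar> < e" "A = B" "\<bar>a - b\<bar> = 2 * e" for A B a b :: real
      using that by linarith
    ultimately show False using eq unfolding dist_real_def by blast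
  qed
qed

section \<open>Space-time derivatives and contact with radial barriers\<close>

definition half_space :: "(real \<times> 'a::euclidean_space) set" where
  "half_space = {p. fst p > 0}"

text \<open>Time and space derivatives are directional derivatives of one function on space-time, so
  that a single symmetry theorem covers both \<open>dt\<close> with \<open>dx\<close> and
  \<open>dx\<close> with \<open>dx\<close>.\<close>

definition dt :: "(real \<times> 'a::euclidean_space \<Rightarrow> real) \<Rightarrow> real \<times> 'a \<Rightarrow> real" where
  "dt F p = frechet_derivative F (at p) (1, 0)"

definition dx :: "'n::finite \<Rightarrow> (real \<times> (real^'n) \<Rightarrow> real) \<Rightarrow> real \<times> (real^'n) \<Rightarrow> real" where
  "dx i F p = frechet_derivative F (at p) (0, axis i 1)"

lemma open_half_space: "open half_space"
proof -
  have "open {p::real \<times> 'a. 0 < fst p}"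
    by (intro open_Collect_less continuous_intros)
  then show ?thesis unfolding half_space_def .
qed

lemma half_space_iff [simp]: "(t, x) \<in> half_space \<longleftrightarrow> t > 0"
  by (simp add: half_space_def)

abbreviation smooth :: "(real \<times> 'a::euclidean_space \<Rightarrow> real) \<Rightarrow> bool" where
  "smooth F \<equiv> smooth_on F half_space"

lemma smooth_const: "smooth (\<lambda>p. c)"
  by (rule smooth_on_const)

lemmas smooth_add = smooth_on_add[OF open_half_space]
lemmas smooth_mult = smooth_on_mult[OF open_half_space]
lemmas smooth_powr = smooth_on_powr[OF open_half_space]
lemmas smooth_sum = smooth_on_sum[OF open_half_space]

lemma smooth_power2: "smooth F \<Longrightarrow> smooth (\<lambda>p. (F p)\<^sup>2)"
  using smooth_mult[of F F] by (simp add: power2_eq_square)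

lemma smooth_diff:
  assumes "smooth F" "smooth G"
  shows "smooth (\<lambda>p. F p - G p)"
  using smooth_add[OF assms(1) smooth_mult[OF smooth_const[of "-1"] assms(2)]] by simp

lemma smooth_uminus:
  assumes "smooth F"
  shows "smooth (\<lambda>p. - F p)"
  using smooth_mult[OF smooth_const[of "-1"] assms] by simp

lemma smooth_dt: "smooth F \<Longrightarrow> smooth (dt F)"
  unfolding dt_def by (rule smooth_on_frechet)

lemma smooth_dx: "smooth F \<Longrightarrow> smooth (dx i F)"
  unfolding dx_def by (rule smooth_on_frechet)

lemmas smooth_intros = smooth_const smooth_add smooth_mult smooth_powr smooth_sum smooth_power2
  smooth_diff smooth_uminus smooth_dt smooth_dx

lemma smooth_differentiable: "smooth F \<Longrightarrow> p \<in> half_space \<Longrightarrow> F differentiable (at p)"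
  by (rule smooth_on_differentiable)

lemma dx_cong: "(\<And>p. p \<in> half_space \<Longrightarrow> F p = G p) \<Longrightarrow> p \<in> half_space \<Longrightarrow> dx i F p = dx i G p"
  unfolding dx_def using frechet_derivative_cong_open[OF open_half_space] by metis

lemma dt_cong: "(\<And>p. p \<in> half_space \<Longrightarrow> F p = G p) \<Longrightarrow> p \<in> half_space \<Longrightarrow> dt F p = dt G p"
  unfolding dt_def using frechet_derivative_cong_open[OF open_half_space] by metis

lemma dx_const [simp]: "dx i (\<lambda>p. c) p = 0"
  by (simp add: dx_def)

lemma dx_add:
  "smooth F \<Longrightarrow> smooth G \<Longrightarrow> p \<in> half_space \<Longrightarrow> dx i (\<lambda>p. F p + G p) p = dx i F p + dx i G p"
  unfolding dx_def by (intro frechet_derivative_add smooth_differentiable)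

lemma dx_mult:
  "smooth F \<Longrightarrow> smooth G \<Longrightarrow> p \<in> half_space \<Longrightarrow>
    dx i (\<lambda>p. F p * G p) p = dx i F p * G p + F p * dx i G p"
  unfolding dx_def by (intro frechet_derivative_mult smooth_differentiable)

lemma dx_powr:
  "smooth F \<Longrightarrow> p \<in> half_space \<Longrightarrow> F p > 0 \<Longrightarrow> dx i (\<lambda>p. F p powr a) p = a * F p powr (a - 1) * dx i F p"
  unfolding dx_def by (intro frechet_derivative_powr smooth_differentiable)

lemma dt_powr:
  "smooth F \<Longrightarrow> p \<in> half_space \<Longrightarrow> F p > 0 \<Longrightarrow> dt (\<lambda>p. F p powr a) p = a * F p powr (a - 1) * dt F p"
  unfolding dt_def by (intro frechet_derivative_powr smooth_differentiable)

lemma dx_sum: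
  "(\<And>j. j \<in> J \<Longrightarrow> smooth (F j)) \<Longrightarrow> p \<in> half_space \<Longrightarrow>
    dx i (\<lambda>p. \<Sum>j\<in>J. F j p) p = (\<Sum>j\<in>J. dx i (F j) p)"
  unfolding dx_def by (intro frechet_derivative_sum smooth_differentiable)

lemma dt_sum:
  "(\<And>j. j \<in> J \<Longrightarrow> smooth (F j)) \<Longrightarrow> p \<in> half_space \<Longrightarrow>
    dt (\<lambda>p. \<Sum>j\<in>J. F j p) p = (\<Sum>j\<in>J. dt (F j) p)"
  unfolding dt_def by (intro frechet_derivative_sum smooth_differentiable)

lemma dx_power2:
  "smooth F \<Longrightarrow> p \<in> half_space \<Longrightarrow> dx i (\<lambda>p. (F p)\<^sup>2) p = 2 * F p * dx i F p"
  using dx_mult[of F F p i] by (simp add: power2_eq_square)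

lemma dt_power2:
  "smooth F \<Longrightarrow> p \<in> half_space \<Longrightarrow> dt (\<lambda>p. (F p)\<^sup>2) p = 2 * F p * dt F p"
  unfolding dt_def power2_eq_square
  using frechet_derivative_mult[OF smooth_differentiable smooth_differentiable, of F p F] by simp

lemma dx_cmult: "smooth F \<Longrightarrow> p \<in> half_space \<Longrightarrow> dx i (\<lambda>p. c * F p) p = c * dx i F p"
  using dx_mult[of "\<lambda>p. c" F p i] by (simp add: smooth_const)

lemma dt_cmult: "smooth F \<Longrightarrow> p \<in> half_space \<Longrightarrow> dt (\<lambda>p. c * F p) p = c * dt F p"
  unfolding dt_def
  using frechet_derivative_mult[OF smooth_differentiable[OF smooth_const] smooth_differentiable, of p F c]
  by simp

lemma dx_uminus: "smooth F \<Longrightarrow> p \<in> half_space \<Longrightarrow> dx i (\<lambda>p. - F p) p = - dx i F p"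
  using dx_cmult[of F p i "-1"] by simp

lemma dt_uminus: "smooth F \<Longrightarrow> p \<in> half_space \<Longrightarrow> dt (\<lambda>p. - F p) p = - dt F p"
  using dt_cmult[of F p "-1"] by simp

lemma dx_diff:
  "smooth F \<Longrightarrow> smooth G \<Longrightarrow> p \<in> half_space \<Longrightarrow> dx i (\<lambda>p. F p - G p) p = dx i F p - dx i G p"
  using dx_add[of F "\<lambda>p. - G p" p i] dx_uminus[of G p i] by (simp add: smooth_uminus)

lemma dx_dx_commute: "smooth F \<Longrightarrow> p \<in> half_space \<Longrightarrow> dx i (dx j F) p = dx j (dx i F) p"
  unfolding dx_def[abs_def] by (rule frechet_derivative_commute[OF _ open_half_space])

lemma dt_dx_commute: "smooth F \<Longrightarrow> p \<in> half_space \<Longrightarrow> dt (dx j F) p = dx j (dt F) p"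
  unfolding dx_def[abs_def] dt_def[abs_def] by (rule frechet_derivative_commute[OF _ open_half_space])

definition lap :: "(real \<times> (real^'n::finite) \<Rightarrow> real) \<Rightarrow> real \<times> (real^'n) \<Rightarrow> real" where
  "lap F p = (\<Sum>i\<in>UNIV. dx i (dx i F) p)"

lemma smooth_lap: "smooth F \<Longrightarrow> smooth (lap F)"
  unfolding lap_def[abs_def] by (rule smooth_sum) (auto intro: smooth_dx)

lemma lap_cong:
  assumes "\<And>p. p \<in> half_space \<Longrightarrow> F p = G p" "p \<in> half_space"
  shows "lap F p = lap G p"
  unfolding lap_def using assms by (intro sum.cong refl dx_cong) auto

lemma lap_cmult: "smooth F \<Longrightarrow> p \<in> half_space \<Longrightarrow> lap (\<lambda>p. c * F p) p = c * lap F p"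
proof -
  assume F: "smooth F" and p: "p \<in> half_space"
  have "dx i (dx i (\<lambda>p. c * F p)) p = c * dx i (dx i F) p" for i
    using dx_cong[of "dx i (\<lambda>p. c * F p)" "\<lambda>p. c * dx i F p" p i] dx_cmult[OF F] p
      dx_cmult[OF smooth_dx[OF F] p] by simp
  then show ?thesis by (simp add: lap_def sum_distrib_left)
qed

lemma lap_uminus: "smooth F \<Longrightarrow> p \<in> half_space \<Longrightarrow> lap (\<lambda>p. - F p) p = - lap F p"
  using lap_cmult[of F p "-1"] by simp

lemma dx_line:
  assumes "smooth F" "t > 0"
  shows "((\<lambda>s. F (t, x + s *\<^sub>R axis i 1)) has_real_derivative dx i F (t, x + s *\<^sub>R axis i 1)) (at s)"
  using line_has_derivative[of F "(t, x)" s "(0, axis i 1)"] smooth_differentiable[OF assms(1)] assms(2)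
  by (simp add: dx_def)

lemma dt_line:
  assumes "smooth F" "t > 0"
  shows "((\<lambda>t. F (t, x)) has_real_derivative dt F (t, x)) (at t)"
  using line_has_derivative[of F "(0, x)" t "(1, 0)"] smooth_differentiable[OF assms(1)] assms(2)
  by (simp add: dt_def)

text \<open>The theorem speaks of derivatives of time slices, the proof of derivatives on
  space-time; this lemma and the next two translate.\<close>

lemma pdiff_slice:
  assumes "smooth F" "t > 0"
  shows "pdiff i (\<lambda>y. F (t, y)) x = dx i F (t, x)"
proof -
  have "((\<lambda>y. (t, y)) has_derivative (\<lambda>h. (0, h))) (at x)"
    by (auto intro!: derivative_eq_intros)
  from has_derivative_compose[OF this has_derivative_frechet_derivative[OF smooth_differentiable[OF assms(1)]]]
  have "((\<lambda>y. F (t, y)) has_derivative (\<lambda>h. frechet_derivative F (at (t, x)) (0, h))) (at x)"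
    using assms(2) by simp
  from frechet_derivative_at[symmetric, OF this] show ?thesis by (simp add: pdiff_def dx_def)
qed

lemma laplacian_slice:
  assumes "smooth F" "t > 0"
  shows "laplacian (\<lambda>y. F (t, y)) x = lap F (t, x)"
proof -
  have "pdiff i (pdiff i (\<lambda>y. F (t, y))) x = dx i (dx i F) (t, x)" for i
  proof -
    have "pdiff i (\<lambda>y. F (t, y)) = (\<lambda>y. dx i F (t, y))"
      by (rule ext) (rule pdiff_slice[OF assms])
    then show ?thesis using pdiff_slice[OF smooth_dx[OF assms(1)] assms(2)] by simp
  qed
  then show ?thesis by (simp add: laplacian_def lap_def)
qed

lemma frechet_time:
  assumes "smooth F" "t > 0"
  shows "frechet_derivative (\<lambda>s. F (s, x)) (at t) 1 = dt F (t, x)"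
  using frechet_derivative_at[symmetric, OF dt_line[OF assms, of x, unfolded has_field_derivative_def]]
  by simp

section \<open>Necessary conditions at a contact point\<close>

text \<open>If \<open>f2\<close> were negative, \<open>f'\<close> would be negative just to the
  right of 0, and the mean value theorem would make \<open>f\<close> drop below \<open>f 0\<close>.
  Differentiability of \<open>f'\<close> at 0 alone is enough for this.\<close>

lemma min_second_derivative:
  fixes f f' :: "real \<Rightarrow> real"
  assumes d: "\<forall>\<^sub>F s in nhds 0. (f has_real_derivative f' s) (at s)"
    and d2: "(f' has_real_derivative f2) (at 0)"
    and min: "\<forall>\<^sub>F s in nhds 0. f 0 \<le> f s"
  shows "f' 0 = 0" "f2 \<ge> 0"
proof -
  obtain e where e: "e > 0" "\<And>s. \<bar>s\<bar> < e \<Longrightarrow> (f has_real_derivative f' s) (at s) \<and> f 0 \<le> f s"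
    using eventually_conj[OF d min] unfolding eventually_nhds_metric by (auto simp: dist_real_def)
  show 0: "f' 0 = 0"
    using e(2)[of 0] e by (intro DERIV_local_min[of f "f' 0" 0 e]) auto
  show "f2 \<ge> 0"
  proof (rule ccontr)
    assume "\<not> f2 \<ge> 0"
    then obtain d where d: "d > 0" "\<And>h. 0 < h \<Longrightarrow> h < d \<Longrightarrow> f' (0 + h) < f' 0"
      using has_real_derivative_neg_dec_right[OF d2] by auto
    define h where "h = min d e / 2"
    have h: "0 < h" "h < d" "h < e" using d(1) e(1) by (auto simp: h_def)
    obtain s where s: "0 < s" "s < h" "f h - f 0 = (h - 0) * f' s"
      using MVT2[of 0 h f f'] e(2) h by auto
    have "f' s < 0" using d(2)[of s] s h 0 by simp
    then have "h * f' s < 0" using h by (simp add: mult_pos_neg)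
    then have "f h < f 0" using s by simp
    then show False using e(2)[of h] h by simp
  qed
qed

text \<open>One-sided in time, because a contact may occur at the last instant of the interval
  considered, where later times are not compared.\<close>

lemma min_left_derivative:
  fixes f :: "real \<Rightarrow> real"
  assumes d: "(f has_real_derivative d) (at t)"
    and min: "\<forall>\<^sub>F s in nhds t. s \<le> t \<longrightarrow> f t \<le> f s"
  shows "d \<le> 0"
proof (rule ccontr)
  assume "\<not> d \<le> 0"
  then obtain e where e: "e > 0" "\<And>h. 0 < h \<Longrightarrow> h < e \<Longrightarrow> f (t - h) < f t"
    using has_real_derivative_pos_inc_left[OF d] by auto
  obtain r where r: "r > 0" "\<And>s. \<bar>s - t\<bar> < r \<Longrightarrow> s \<le> t \<Longrightarrow> f t \<le> f s"
    using min unfolding eventually_nhds_metric by (auto simp: dist_real_def)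
  define h where "h = min e r / 2"
  have "0 < h" "h < e" "h < r" using e(1) r(1) by (auto simp: h_def)
  then show False using e(2)[of h] r(2)[of "t - h"] by simp
qed

lemma norm_line_sq:
  fixes x y :: "real^'n::finite"
  shows "(norm (x + s *\<^sub>R axis i 1 - y))\<^sup>2 = (norm (x - y))\<^sup>2 + 2 * s * (x - y) $ i + s\<^sup>2"
proof -
  define d where "d = x - y"
  have e: "x + s *\<^sub>R axis i 1 - y = d + s *\<^sub>R axis i 1" by (simp add: d_def)
  have "(norm (d + s *\<^sub>R axis i 1))\<^sup>2 = (norm d)\<^sup>2 + 2 * s * d $ i + s\<^sup>2"
    unfolding power2_norm_eq_inner
    by (simp add: inner_add_left inner_add_right inner_axis inner_axis' power2_eq_square distrib_left)
  then show ?thesis unfolding e d_def .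
qed

lemma norm_sq_sum: "(norm (x::real^'n::finite))\<^sup>2 = (\<Sum>i\<in>UNIV. (x $ i)\<^sup>2)"
  unfolding power2_norm_eq_inner by (simp add: inner_vec_def power2_eq_square)

lemma radial_line_derivative:
  fixes x y :: "real^'n::finite" and G :: "real \<Rightarrow> real"
  assumes "(G has_real_derivative D) (at ((norm (x + s *\<^sub>R axis i 1 - y))\<^sup>2))"
  shows "((\<lambda>s. G ((norm (x + s *\<^sub>R axis i 1 - y))\<^sup>2)) has_real_derivative D * (2 * ((x - y) $ i + s))) (at s)"
proof -
  have "((\<lambda>s. (norm (x + s *\<^sub>R axis i 1 - y))\<^sup>2) has_real_derivative (2 * ((x - y) $ i + s))) (at s)"
    unfolding norm_line_sq by (auto intro!: derivative_eq_intros)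
  from DERIV_chain2[OF assms this] show ?thesis .
qed

text \<open>Barriers are functions of time and of the squared distance \<open>r\<close>, so they are
  smooth at the centre \<open>y\<close> as well, and their Laplacian is
  \<open>2 N \<beta>1 + 4 r \<beta>2\<close> everywhere. Each comparison below contradicts the
  equation through these relations; bounds from above use \<open>- F\<close> and a negative
  barrier.\<close>

lemma touching_below:
  fixes F :: "real \<times> (real^'n::finite) \<Rightarrow> real" and \<beta> :: "real \<Rightarrow> real \<Rightarrow> real" and x0 y :: "real^'n"
  defines "r0 \<equiv> (norm (x0 - y))\<^sup>2"
  assumes F: "smooth F" and t0: "t0 > 0"
    and b1: "\<forall>\<^sub>F r in nhds r0. (\<beta> t0 has_real_derivative \<beta>1 r) (at r)"
    and b2: "(\<beta>1 has_real_derivative \<beta>2) (at r0)"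
    and bt: "((\<lambda>t. \<beta> t r0) has_real_derivative \<beta>t) (at t0)"
    and min: "\<forall>\<^sub>F p in nhds (t0, x0). fst p \<le> t0 \<longrightarrow>
        F (t0, x0) - \<beta> t0 r0 \<le> F p - \<beta> (fst p) ((norm (snd p - y))\<^sup>2)"
  shows "dt F (t0, x0) \<le> \<beta>t"
    and "dx i F (t0, x0) = 2 * (x0 - y) $ i * \<beta>1 r0"
    and "lap F (t0, x0) \<ge> 2 * real CARD('n) * \<beta>1 r0 + 4 * r0 * \<beta>2"
proof -
  have ct: "((\<lambda>t. (t, x0)) \<longlongrightarrow> (t0, x0)) (nhds t0)"
    by (intro tendsto_Pair tendsto_const filterlim_ident)
  have "\<forall>\<^sub>F t in nhds t0. t \<le> t0 \<longrightarrow> F (t0, x0) - \<beta> t0 r0 \<le> F (t, x0) - \<beta> t r0"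
    using eventually_compose_filterlim[OF min ct] by (simp add: r0_def)
  from min_left_derivative[OF DERIV_diff[OF dt_line[OF F t0] bt] this]
  show "dt F (t0, x0) \<le> \<beta>t" by simp
  have line: "dx i F (t0, x0) = 2 * (x0 - y) $ i * \<beta>1 r0
     \<and> dx i (dx i F) (t0, x0) \<ge> 2 * \<beta>1 r0 + 4 * ((x0 - y) $ i)\<^sup>2 * \<beta>2" for i
  proof -
    let ?e = "axis i 1 :: real^'n"
    let ?r = "\<lambda>s. (norm (x0 + s *\<^sub>R ?e - y))\<^sup>2"
    have ids: "((\<lambda>s. s) \<longlongrightarrow> (0::real)) (nhds 0)" by (rule filterlim_ident)
    have cs: "((\<lambda>s. (t0, x0 + s *\<^sub>R ?e)) \<longlongrightarrow> (t0, x0)) (nhds 0)"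
      using tendsto_Pair[OF tendsto_const tendsto_add[OF tendsto_const tendsto_scaleR[OF ids tendsto_const]],
          of t0 x0 ?e] by simp
    have cr: "(?r \<longlongrightarrow> r0) (nhds 0)"
      using tendsto_power[OF tendsto_norm[OF tendsto_diff[OF tendsto_add[OF tendsto_const tendsto_scaleR[OF ids tendsto_const]] tendsto_const]],
          of x0 ?e y 2] by (simp add: r0_def)
    let ?f = "\<lambda>s. F (t0, x0 + s *\<^sub>R ?e) - \<beta> t0 (?r s)"
    let ?f' = "\<lambda>s. dx i F (t0, x0 + s *\<^sub>R ?e) - \<beta>1 (?r s) * (2 * ((x0 - y) $ i + s))"
    let ?f2 = "dx i (dx i F) (t0, x0) - (2 * \<beta>1 r0 + 4 * ((x0 - y) $ i)\<^sup>2 * \<beta>2)"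
    have 1: "\<forall>\<^sub>F s in nhds 0. (?f has_real_derivative ?f' s) (at s)"
      using eventually_compose_filterlim[OF b1 cr]
    proof eventually_elim
      case (elim s)
      show ?case by (intro DERIV_diff dx_line[OF F t0] radial_line_derivative elim)
    qed
    have "((\<lambda>s. \<beta>1 (?r s)) has_real_derivative \<beta>2 * (2 * ((x0 - y) $ i + 0))) (at 0)"
      by (rule radial_line_derivative) (use b2 in \<open>simp add: r0_def\<close>)
    moreover have "((\<lambda>s. 2 * ((x0 - y) $ i + s)) has_real_derivative 2) (at 0)"
      by (auto intro!: derivative_eq_intros)
    moreover have "((\<lambda>s. dx i F (t0, x0 + s *\<^sub>R ?e)) has_real_derivative dx i (dx i F) (t0, x0)) (at 0)"
      using dx_line[OF smooth_dx[OF F] t0, of i x0 i 0] by simp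
    ultimately have 2: "(?f' has_real_derivative ?f2) (at 0)"
      by (auto intro!: derivative_eq_intros simp: r0_def power2_eq_square algebra_simps)
    have 3: "\<forall>\<^sub>F s in nhds 0. ?f 0 \<le> ?f s"
      using eventually_compose_filterlim[OF min cs] by (simp add: r0_def)
    from min_second_derivative[OF 1 2 3] show ?thesis by (simp add: r0_def algebra_simps)
  qed
  then show "dx i F (t0, x0) = 2 * (x0 - y) $ i * \<beta>1 r0" by blast
  have "lap F (t0, x0) \<ge> (\<Sum>i\<in>UNIV. 2 * \<beta>1 r0 + 4 * ((x0 - y) $ i)\<^sup>2 * \<beta>2)"
    unfolding lap_def using line by (intro sum_mono) auto
  also have "(\<Sum>i\<in>UNIV. 2 * \<beta>1 r0 + 4 * ((x0 - y) $ i)\<^sup>2 * \<beta>2)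
      = 2 * real CARD('n) * \<beta>1 r0 + 4 * r0 * \<beta>2"
    by (simp add: r0_def norm_sq_sum sum.distrib sum_distrib_left sum_distrib_right)
  finally show "lap F (t0, x0) \<ge> 2 * real CARD('n) * \<beta>1 r0 + 4 * r0 * \<beta>2" .
qed

section \<open>Bochner's inequality\<close>

lemma dx_dx_powr:
  assumes F: "smooth F" and pos: "\<And>p. p \<in> half_space \<Longrightarrow> F p > 0" and p: "p \<in> half_space"
  shows "dx i (dx i (\<lambda>p. F p powr a)) p
     = a * F p powr (a - 1) * dx i (dx i F) p + a * (a - 1) * F p powr (a - 2) * (dx i F p)\<^sup>2"
proof -
  have "dx i (dx i (\<lambda>p. F p powr a)) p = dx i (\<lambda>p. (a * F p powr (a - 1)) * dx i F p) p"
    by (rule dx_cong[OF _ p]) (simp add: dx_powr F pos)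
  also have "\<dots> = dx i (\<lambda>p. a * F p powr (a - 1)) p * dx i F p
      + (a * F p powr (a - 1)) * dx i (dx i F) p"
    by (rule dx_mult[OF smooth_mult[OF smooth_const smooth_powr[OF F pos]] smooth_dx[OF F] p])
  also have "dx i (\<lambda>p. a * F p powr (a - 1)) p = a * ((a - 1) * F p powr (a - 1 - 1) * dx i F p)"
    using dx_cmult[OF smooth_powr[OF F pos] p] dx_powr[OF F p pos[OF p]] by simp
  finally show ?thesis by (simp add: power2_eq_square algebra_simps)
qed

lemma lap_powr:
  assumes F: "smooth F" and pos: "\<And>p. p \<in> half_space \<Longrightarrow> F p > 0" and p: "p \<in> half_space"
  shows "lap (\<lambda>p. F p powr a) p
     = a * F p powr (a - 1) * lap F p + a * (a - 1) * F p powr (a - 2) * (\<Sum>i\<in>UNIV. (dx i F p)\<^sup>2)"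
  unfolding lap_def by (simp add: dx_dx_powr[OF assms] sum.distrib sum_distrib_left)

text \<open>Cauchy-Schwarz for matrices, whose entries are indexed by pairs. The matrix
  \<open>z I - g g^T\<close> is \<open>z\<close> times the projection onto the orthogonal complement
  of \<open>g\<close>, a space of dimension \<open>N - 1\<close> unless \<open>g = 0\<close>; hence
  the factor.\<close>

lemma trace_minus_quadratic_form_le:
  fixes h :: "'n::finite \<Rightarrow> 'n \<Rightarrow> real" and g :: "'n \<Rightarrow> real"
  defines "z \<equiv> \<Sum>i\<in>UNIV. (g i)\<^sup>2"
  shows "(z * (\<Sum>i\<in>UNIV. h i i) - (\<Sum>i\<in>UNIV. \<Sum>j\<in>UNIV. g i * g j * h i j))\<^sup>2
    \<le> (real CARD('n) - 1) * z\<^sup>2 * (\<Sum>i\<in>UNIV. \<Sum>j\<in>UNIV. (h i j)\<^sup>2)"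
proof -
  let ?d = "\<lambda>i j. if j = i then z else (0::real)"
  have "(\<Sum>x\<in>UNIV\<times>UNIV. (case x of (i, j) \<Rightarrow> h i j) * (case x of (i, j) \<Rightarrow> ?d i j - g i * g j))\<^sup>2
     \<le> (\<Sum>x\<in>UNIV\<times>UNIV. (case x of (i, j) \<Rightarrow> h i j)\<^sup>2) * (\<Sum>x\<in>UNIV\<times>UNIV. (case x of (i, j) \<Rightarrow> ?d i j - g i * g j)\<^sup>2)"
    by (rule Cauchy_Schwarz_ineq_sum)
  moreover have "(\<Sum>x\<in>UNIV\<times>UNIV. (case x of (i, j) \<Rightarrow> h i j) * (case x of (i, j) \<Rightarrow> ?d i j - g i * g j))
     = z * (\<Sum>i\<in>UNIV. h i i) - (\<Sum>i\<in>UNIV. \<Sum>j\<in>UNIV. g i * g j * h i j)"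
  proof -
    have "(\<Sum>x\<in>UNIV\<times>UNIV. (case x of (i, j) \<Rightarrow> h i j) * (case x of (i, j) \<Rightarrow> ?d i j - g i * g j))
       = (\<Sum>i\<in>UNIV. \<Sum>j\<in>UNIV. h i j * (?d i j - g i * g j))"
      by (subst sum.cartesian_product) (rule sum.cong, auto)
    also have "\<dots> = (\<Sum>i\<in>UNIV. \<Sum>j\<in>UNIV. (if j = i then h i j * z else 0) - g i * g j * h i j)"
      by (intro sum.cong refl) (auto simp: algebra_simps)
    also have "\<dots> = (\<Sum>i\<in>UNIV. h i i * z) - (\<Sum>i\<in>UNIV. \<Sum>j\<in>UNIV. g i * g j * h i j)"
      by (simp add: sum_subtractf)
    finally show ?thesis by (simp add: sum_distrib_left mult.commute)
  qed
  moreover have "(\<Sum>x\<in>UNIV\<times>UNIV. (case x of (i, j) \<Rightarrow> h i j)\<^sup>2) = (\<Sum>i\<in>UNIV. \<Sum>j\<in>UNIV. (h i j)\<^sup>2)"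
    by (subst sum.cartesian_product) (rule sum.cong, auto)
  moreover have "(\<Sum>x\<in>UNIV\<times>UNIV. (case x of (i, j) \<Rightarrow> ?d i j - g i * g j)\<^sup>2) = (real CARD('n) - 1) * z\<^sup>2"
  proof -
    have "(\<Sum>x\<in>UNIV\<times>UNIV. (case x of (i, j) \<Rightarrow> ?d i j - g i * g j)\<^sup>2)
       = (\<Sum>i\<in>UNIV. \<Sum>j\<in>UNIV. (?d i j - g i * g j)\<^sup>2)"
      by (subst sum.cartesian_product) (rule sum.cong, auto)
    also have "\<dots> = (\<Sum>i\<in>UNIV. \<Sum>j\<in>UNIV. (if j = i then z\<^sup>2 - 2 * z * (g i)\<^sup>2 else 0) + (g i)\<^sup>2 * (g j)\<^sup>2)"
      by (intro sum.cong refl) (auto simp: power2_eq_square algebra_simps)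
    also have "\<dots> = (\<Sum>i\<in>UNIV. z\<^sup>2 - 2 * z * (g i)\<^sup>2) + (\<Sum>i\<in>UNIV. (g i)\<^sup>2 * z)"
      by (simp add: sum.distrib z_def sum_distrib_left)
    also have "\<dots> = real CARD('n) * z\<^sup>2 - 2 * z * z + z * z"
      by (simp add: sum_subtractf z_def flip: sum_distrib_left sum_distrib_right)
    finally show ?thesis by (simp add: power2_eq_square algebra_simps)
  qed
  ultimately show ?thesis by (simp add: mult.commute)
qed

text \<open>
  The term \<open>4 m v z \<Delta>v - 2 m v\<^sup>2 |D\<^sup>2v|\<^sup>2\<close> of Bochner's formula is estimated by pairing the Hessian
  with \<open>z I - \<nabla>v \<otimes> \<nabla>v\<close>, of squared norm \<open>(N - 1) z\<^sup>2\<close>; this produces \<open>N - 1\<close> in place of \<open>N\<close> at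
  the price of the transport term \<open>v \<nabla>v \<cdot> \<nabla>z\<close>, which is harmless at a maximum.
\<close>
lemma gradient_square_inequality:
  fixes v :: "real \<times> (real^'n::finite) \<Rightarrow> real"
  defines "z \<equiv> \<lambda>p. \<Sum>j\<in>UNIV. (dx j v p)\<^sup>2"
  assumes v: "smooth v" and pos: "\<And>p. p \<in> half_space \<Longrightarrow> v p > 0" and m: "m > 0"
    and eqn: "\<And>p. p \<in> half_space \<Longrightarrow>
        dt v p = m * (v p)\<^sup>2 * lap v p - a * v p * z p + c * v p powr e"
    and p: "p \<in> half_space"
  shows "dt z p \<le> m * (v p)\<^sup>2 * lap z p + 2 * (m - a) * v p * (\<Sum>j\<in>UNIV. dx j v p * dx j z p)
      + (2 * m * (real CARD('n) - 1) - 2 * a) * (z p)\<^sup>2 + 2 * c * e * v p powr (e - 1) * z p"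
proof -
  have sz: "smooth z" unfolding z_def by (intro smooth_sum smooth_power2 smooth_dx v) simp
  have sdx: "smooth (dx j v)" for j by (intro smooth_dx v)
  have svp: "smooth (\<lambda>p. v p powr b)" for b by (intro smooth_powr v pos)
  have slap: "smooth (lap v)" by (rule smooth_lap[OF v])
  define g where "g j = dx j v p" for j
  define h where "h i j = dx i (dx j v) p" for i j
  define T where "T j = lap (dx j v) p" for j
  define S where "S = (\<Sum>i\<in>UNIV. \<Sum>j\<in>UNIV. (h i j)\<^sup>2)"
  define Q where "Q = (\<Sum>i\<in>UNIV. \<Sum>j\<in>UNIV. g i * g j * h i j)"
  have zp: "z p = (\<Sum>j\<in>UNIV. (g j)\<^sup>2)" by (simp add: z_def g_def)
  have lapv: "lap v p = (\<Sum>i\<in>UNIV. h i i)" by (simp add: lap_def h_def)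
  \<comment> \<open>Commuting \<open>dx j\<close> past both derivatives of the Laplacian lets the
    third-order terms of \<open>dt z\<close> be absorbed into \<open>lap z\<close>.\<close>
  have dxlap: "dx j (lap v) p = T j" for j
  proof -
    have "dx j (lap v) p = (\<Sum>i\<in>UNIV. dx j (dx i (dx i v)) p)"
      unfolding lap_def[abs_def] by (rule dx_sum[OF _ p]) (intro smooth_dx v)
    also have "\<dots> = (\<Sum>i\<in>UNIV. dx i (dx i (dx j v)) p)"
    proof (rule sum.cong[OF refl])
      fix i
      have "dx j (dx i (dx i v)) p = dx i (dx j (dx i v)) p" by (rule dx_dx_commute[OF sdx p])
      also have "\<dots> = dx i (dx i (dx j v)) p" by (rule dx_cong[OF dx_dx_commute[OF v] p])
      finally show "dx j (dx i (dx i v)) p = dx i (dx i (dx j v)) p" .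
    qed
    finally show ?thesis by (simp add: T_def lap_def)
  qed
  have dxz: "dx i z p' = (\<Sum>j\<in>UNIV. 2 * dx j v p' * dx i (dx j v) p')" if "p' \<in> half_space" for i p'
    unfolding z_def using that sdx by (subst dx_sum) (auto simp: dx_power2 smooth_power2)
  have lapz: "lap z p = 2 * S + 2 * (\<Sum>j\<in>UNIV. g j * T j)"
  proof -
    have "dx i (dx i z) p = (\<Sum>j\<in>UNIV. 2 * (h i j)\<^sup>2 + 2 * g j * dx i (dx i (dx j v)) p)" for i
    proof -
      have "dx i (dx i z) p = dx i (\<lambda>p'. \<Sum>j\<in>UNIV. 2 * dx j v p' * dx i (dx j v) p') p"
        by (rule dx_cong[OF dxz p])
      also have "\<dots> = (\<Sum>j\<in>UNIV. dx i (\<lambda>p'. 2 * dx j v p' * dx i (dx j v) p') p)"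
        by (rule dx_sum[OF _ p]) (intro smooth_mult smooth_const smooth_dx v)
      also have "\<dots> = (\<Sum>j\<in>UNIV. 2 * (h i j)\<^sup>2 + 2 * g j * dx i (dx i (dx j v)) p)"
      proof (rule sum.cong[OF refl])
        fix j
        have "dx i (\<lambda>p'. (2 * dx j v p') * dx i (dx j v) p') p
           = dx i (\<lambda>p'. 2 * dx j v p') p * dx i (dx j v) p + (2 * dx j v p) * dx i (dx i (dx j v)) p"
          by (rule dx_mult[OF _ _ p]) (intro smooth_mult smooth_const smooth_dx v)+
        also have "dx i (\<lambda>p'. 2 * dx j v p') p = 2 * dx i (dx j v) p" by (rule dx_cmult[OF sdx p])
        finally show "dx i (\<lambda>p'. 2 * dx j v p' * dx i (dx j v) p') p
           = 2 * (h i j)\<^sup>2 + 2 * g j * dx i (dx i (dx j v)) p"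
          by (simp add: h_def g_def power2_eq_square)
      qed
      finally show ?thesis .
    qed
    then have "lap z p = (\<Sum>i\<in>UNIV. \<Sum>j\<in>UNIV. 2 * (h i j)\<^sup>2 + 2 * g j * dx i (dx i (dx j v)) p)"
      by (simp add: lap_def)
    also have "\<dots> = 2 * S + (\<Sum>i\<in>UNIV. \<Sum>j\<in>UNIV. 2 * g j * dx i (dx i (dx j v)) p)"
      by (simp add: sum.distrib S_def sum_distrib_left)
    also have "(\<Sum>i\<in>UNIV. \<Sum>j\<in>UNIV. 2 * g j * dx i (dx i (dx j v)) p)
        = (\<Sum>j\<in>UNIV. \<Sum>i\<in>UNIV. 2 * g j * dx i (dx i (dx j v)) p)"
      by (rule sum.swap)
    also have "\<dots> = 2 * (\<Sum>j\<in>UNIV. g j * T j)"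
      by (simp add: T_def lap_def sum_distrib_left mult.assoc)
    finally show ?thesis .
  qed
  have gz: "(\<Sum>j\<in>UNIV. dx j v p * dx j z p) = 2 * Q"
    using dxz[OF p] by (simp add: Q_def g_def h_def sum_distrib_left mult_ac)
  have dtz: "dt z p = (\<Sum>j\<in>UNIV. 2 * g j * dx j (dt v) p)"
  proof -
    have "dt z p = (\<Sum>j\<in>UNIV. dt (\<lambda>p. (dx j v p)\<^sup>2) p)"
      unfolding z_def by (rule dt_sum[OF _ p]) (intro smooth_power2 sdx)
    then show ?thesis by (simp add: dt_power2[OF sdx p] dt_dx_commute[OF v p] g_def)
  qed
  have dxdt: "dx j (dt v) p = 2 * m * v p * lap v p * g j + m * (v p)\<^sup>2 * T j
      - a * z p * g j - a * v p * dx j z p + c * e * v p powr (e - 1) * g j" for j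
  proof -
    have "dx j (dt v) p = dx j (\<lambda>p. ((m * (v p)\<^sup>2) * lap v p - (a * v p) * z p) + c * v p powr e) p"
      by (rule dx_cong[OF _ p]) (simp add: eqn)
    also have "\<dots> = dx j (\<lambda>p. (m * (v p)\<^sup>2) * lap v p) p - dx j (\<lambda>p. (a * v p) * z p) p
        + dx j (\<lambda>p. c * v p powr e) p"
      using p by (subst dx_add dx_diff; (intro smooth_intros v svp slap sz)?; simp)+
    also have "dx j (\<lambda>p. (m * (v p)\<^sup>2) * lap v p) p = m * (2 * v p * g j) * lap v p + m * (v p)\<^sup>2 * T j"
      using p by (subst dx_mult) (auto intro!: smooth_mult smooth_const smooth_power2 v slap
          simp: dx_cmult smooth_power2[OF v] dx_power2[OF v] dxlap g_def)
    also have "dx j (\<lambda>p. (a * v p) * z p) p = a * g j * z p + a * v p * dx j z p"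
      using p by (subst dx_mult) (auto intro!: smooth_mult smooth_const v sz simp: dx_cmult[OF v] g_def)
    also have "dx j (\<lambda>p. c * v p powr e) p = c * (e * v p powr (e - 1) * g j)"
      using p pos by (simp add: dx_cmult[OF svp] dx_powr[OF v] g_def)
    finally show ?thesis by (simp add: algebra_simps)
  qed
  have sg: "(\<Sum>j\<in>UNIV. g j * g j) = z p" by (simp add: zp power2_eq_square)
  have "dt z p = (\<Sum>j\<in>UNIV. (4 * m * v p * lap v p - 2 * a * z p + 2 * c * e * v p powr (e - 1)) * (g j * g j)
      + 2 * m * (v p)\<^sup>2 * (g j * T j) - 2 * a * v p * (g j * dx j z p))"
    unfolding dtz dxdt by (rule sum.cong[OF refl]) (simp add: algebra_simps)
  also have "\<dots> = (4 * m * v p * lap v p - 2 * a * z p + 2 * c * e * v p powr (e - 1)) * z p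
      + 2 * m * (v p)\<^sup>2 * (\<Sum>j\<in>UNIV. g j * T j) - 2 * a * v p * (\<Sum>j\<in>UNIV. g j * dx j z p)"
    by (simp add: sum.distrib sum_subtractf sg flip: sum_distrib_left)
  finally have main: "dt z p = 4 * m * v p * lap v p * z p - 2 * a * (z p)\<^sup>2 + 2 * c * e * v p powr (e - 1) * z p
      + m * (v p)\<^sup>2 * (lap z p - 2 * S) - 2 * a * v p * (2 * Q)"
    using gz by (simp add: lapz g_def power2_eq_square algebra_simps)
  have S0: "S \<ge> 0" unfolding S_def by (intro sum_nonneg) simp
  have N1: "real CARD('n) - 1 \<ge> 0" using one_le_card_finite[where 'a='n] by linarith
  \<comment> \<open>Young's inequality follows, with the weights for which the Hessian term
    \<open>2 m v\<^sup>2 S\<close> is used up exactly. The remaining \<open>4 m v Q\<close> joins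
    \<open>- 4 a v Q\<close>, and \<open>2 Q\<close> is the inner product of the gradients of
    \<open>v\<close> and \<open>z\<close>.\<close>
  define X where "X = z p * lap v p - Q"
  have "X\<^sup>2 \<le> (real CARD('n) - 1) * (z p)\<^sup>2 * S"
    using trace_minus_quadratic_form_le[of g h] by (simp add: X_def zp lapv Q_def S_def)
  then have "(v p * X)\<^sup>2 \<le> ((v p)\<^sup>2 * S) * ((real CARD('n) - 1) * (z p)\<^sup>2)"
    using mult_left_mono[of "X\<^sup>2" "(real CARD('n) - 1) * (z p)\<^sup>2 * S" "(v p)\<^sup>2"]
    by (simp add: power_mult_distrib mult_ac)
  also have "\<dots> \<le> (((v p)\<^sup>2 * S + (real CARD('n) - 1) * (z p)\<^sup>2) / 2)\<^sup>2"
    using zero_le_power2[of "(v p)\<^sup>2 * S - (real CARD('n) - 1) * (z p)\<^sup>2"]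
    by (simp add: power2_eq_square field_simps)
  finally have "v p * X \<le> ((v p)\<^sup>2 * S + (real CARD('n) - 1) * (z p)\<^sup>2) / 2"
    by (rule power2_le_imp_le) (use S0 N1 in simp)
  then have "4 * m * (v p * X) \<le> 4 * m * (((v p)\<^sup>2 * S + (real CARD('n) - 1) * (z p)\<^sup>2) / 2)"
    using m by (intro mult_left_mono) auto
  then have "4 * m * v p * lap v p * z p - 2 * m * (v p)\<^sup>2 * S
      \<le> 2 * m * (real CARD('n) - 1) * (z p)\<^sup>2 + 4 * m * v p * Q"
    by (simp add: X_def algebra_simps)
  then show ?thesis unfolding main gz by (simp add: algebra_simps)
qed

section \<open>Lower barriers and positivity\<close>

lemma compact_sublevel:
  fixes f :: "'a::metric_space \<Rightarrow> real"
  assumes "compact K" "continuous_on K f"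
  shows "compact {p \<in> K. f p \<le> c}"
proof -
  have "closed {p \<in> K. f p \<le> c}"
    using assms by (intro continuous_on_closed_Collect_le continuous_intros compact_imp_closed)
  then have "compact (K \<inter> {p \<in> K. f p \<le> c})" by (rule compact_Int_closed[OF assms(1)])
  moreover have "K \<inter> {p \<in> K. f p \<le> c} = {p \<in> K. f p \<le> c}" by auto
  ultimately show ?thesis by simp
qed

text \<open>\<open>mc\<close> is the condition \<open>m > (N - 2) / N\<close>. Positivity is derived
  only later; since \<open>powr m\<close> is not differentiable at 0, smoothness of
  \<open>U powr m\<close> is assumed along with that of \<open>U\<close>.\<close>

locale fast_diffusion_absorption =
  fixes m q C :: real and U :: "real \<times> (real^'n::finite) \<Rightarrow> real"
  assumes m0: "0 < m" and m1: "m < 1" and mc: "real CARD('n) * (1 - m) < 2" and q1: "q > 1"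
    and C0: "C > 0"
    and nonneg: "t > 0 \<Longrightarrow> U (t, x) \<ge> 0" and bound: "t > 0 \<Longrightarrow> U (t, x) \<le> C"
    and sU: "smooth U" and sW: "smooth (\<lambda>p. U p powr m)"
    and eqn: "p \<in> half_space \<Longrightarrow> dt U p = lap (\<lambda>p. U p powr m) p - U p powr q"
begin

definition w where "w p = U p powr m"

text \<open>The tail exponent: for Barenblatt solutions \<open>U powr m\<close> is of order
  \<open>|x| powr (- 2 k)\<close>.\<close>

definition k where "k = m / (1 - m)"

text \<open>Linearizes the absorption: \<open>U powr q \<le> L * U\<close>.\<close>

definition L where "L = C powr (q - 1)"

text \<open>The Laplacian of \<open>|x|^(-2k)\<close> is \<open>2 k \<gamma> |x|^(-2k-2)\<close>.
  Positivity of \<gamma> is the condition \<open>m > (N - 2) / N\<close>, and \<gamma> equals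
  \<open>1 / (2 m B0)\<close>.\<close>

definition \<gamma> where "\<gamma> = 2 * (k + 1) - real CARD('n)"

lemma sw: "smooth w" using sW by (simp add: w_def[abs_def])

lemma k_facts: "k > 0" "k / m = k + 1" "1 / m - 1 = 1 / k" "k + 1 = 1 / (1 - m)"
  "(1 - m) / m = 1 / k" "1 / m = 1 + 1 / k"
  using m0 m1 by (auto simp: k_def field_simps)

lemma gamma_pos: "\<gamma> > 0"
proof -
  have "real CARD('n) < 2 / (1 - m)" using mc m1 by (simp add: field_simps)
  then show ?thesis by (simp add: \<gamma>_def k_facts(4))
qed

lemma L_pos: "L > 0" using C0 by (simp add: L_def)

lemma w_nonneg: "w p \<ge> 0" by (simp add: w_def)

lemma U_eq: "t > 0 \<Longrightarrow> U (t, x) = w (t, x) powr (1 / m)"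
  using m0 nonneg[of t x] by (simp add: w_def powr_powr)

lemma powr_q_le: "t > 0 \<Longrightarrow> U (t, x) powr q \<le> L * U (t, x)"
proof -
  assume t: "t > 0"
  have "U (t, x) powr q = U (t, x) powr (q - 1) * U (t, x)"
    using nonneg[OF t, of x] q1 by (cases "U (t, x) = 0") (auto simp flip: powr_add simp: powr_diff)
  also have "\<dots> \<le> L * U (t, x)"
    unfolding L_def using t q1 nonneg bound by (intro mult_right_mono powr_mono2) auto
  finally show ?thesis .
qed

lemma dt_U:
  assumes t: "t > 0"
  shows "dt U (t, x) = (1 / m) * U (t, x) powr (1 - m) * dt w (t, x)"
proof (cases "U (t, x) = 0")
  case True
  have "dt U (t, x) = 0"
    by (rule DERIV_local_min[OF dt_line[OF sU t] t]) (use nonneg True in auto)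
  then show ?thesis using True by simp
next
  case False
  then have pos: "U (t, x) > 0" using nonneg[OF t, of x] by simp
  have "dt w (t, x) = m * U (t, x) powr (m - 1) * dt U (t, x)"
    unfolding w_def[abs_def] using t by (intro dt_powr sU pos) simp
  moreover have "U (t, x) powr (1 - m) * U (t, x) powr (m - 1) = 1"
    using pos by (simp flip: powr_add)
  ultimately show ?thesis using m0 by simp
qed

lemma lap_w: "t > 0 \<Longrightarrow> lap w (t, x) = dt U (t, x) + U (t, x) powr q"
  using eqn[of "(t, x)"] by (simp add: w_def[abs_def])

lemma continuous_w: "K \<subseteq> half_space \<Longrightarrow> continuous_on K w"
  using smooth_on_continuous[OF sw] continuous_on_subset by blast

text \<open>The barrier \<open>\<epsilon> (t - (t1 - d))^k (|x - x1|^(-2k) - R^(-2k))\<close>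
  vanishes at the initial time and on the outer sphere and stays below \<open>c\<close> on the inner
  one, so a negative minimum of the difference lies off the parabolic boundary. There diffusion, of
  order \<open>\<epsilon>\<close>, beats the time derivative and the absorption, which are of order
  \<open>\<epsilon> powr (1 / m)\<close>; this is what \<open>eps1\<close> quantifies.\<close>

lemma exterior_barrier_annulus:
  fixes x1 :: "real^'n"
  assumes d: "0 < d" "d \<le> 1" "d < t1" and r0: "r0 > 0" "r0 < R" and eps: "\<epsilon> > 0"
    and eps1: "\<epsilon> powr (1 / m) * (k / m + L) < \<epsilon> * (2 * k * \<gamma>)"
    and eps2: "\<epsilon> * (r0\<^sup>2) powr (- k) \<le> c"
    and c: "\<And>t x. t1 - d \<le> t \<Longrightarrow> t \<le> t1 \<Longrightarrow> norm (x - x1) = r0 \<Longrightarrow> c \<le> w (t, x)"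
    and x: "r0 \<le> norm (x - x1)" "norm (x - x1) \<le> R"
  shows "\<epsilon> * d powr k * (((norm (x - x1))\<^sup>2) powr (- k) - (R\<^sup>2) powr (- k)) \<le> w (t1, x)"
proof (rule ccontr)
  assume neg: "\<not> ?thesis"
  define h where "h \<rho> = \<rho> powr (- k) - (R\<^sup>2) powr (- k)" for \<rho>
  define \<beta> where "\<beta> t \<rho> = \<epsilon> * (t - (t1 - d)) powr k * h \<rho>" for t \<rho>
  define K where "K = {t1 - d..t1} \<times> (cball x1 R - ball x1 r0)"
  define f where "f p = w p - \<beta> (fst p) ((norm (snd p - x1))\<^sup>2)" for p
  have KH: "K \<subseteq> half_space" using d by (auto simp: K_def)
  have inK: "(t, y) \<in> K \<longleftrightarrow> t1 - d \<le> t \<and> t \<le> t1 \<and> r0 \<le> norm (y - x1) \<and> norm (y - x1) \<le> R" for t y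
    by (auto simp: K_def dist_norm norm_minus_commute)
  have "compact K" unfolding K_def by (intro compact_Times compact_diff) auto
  moreover have "continuous_on K f"
    unfolding f_def \<beta>_def h_def
    using k_facts(1) r0 d by (intro continuous_intros continuous_w KH continuous_on_powr')
      (auto simp: K_def dist_norm norm_minus_commute)
  moreover have "(t1, x) \<in> K" using x d by (simp add: inK)
  ultimately obtain p0 where p0: "p0 \<in> K" "\<And>p. p \<in> K \<Longrightarrow> f p0 \<le> f p"
    using continuous_attains_inf[of K f] by blast
  obtain t0 x0 where p0_eq: "p0 = (t0, x0)" by (cases p0)
  define \<rho> where "\<rho> = (norm (x0 - x1))\<^sup>2"
  define s where "s = t0 - (t1 - d)"
  have K0: "t1 - d \<le> t0" "t0 \<le> t1" "r0 \<le> norm (x0 - x1)" "norm (x0 - x1) \<le> R"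
    using p0(1) inK p0_eq by auto
  have t0: "t0 > 0" using K0 d by simp
  have "norm (x0 - x1) > 0" using K0 r0 by linarith
  then have \<rho>: "\<rho> > 0" unfolding \<rho>_def by (rule zero_less_power)
  have s1: "0 \<le> s" "s \<le> 1" using K0 d by (auto simp: s_def)
  have "f (t1, x) < 0" using neg by (simp add: f_def \<beta>_def h_def)
  with p0(2)[OF \<open>(t1, x) \<in> K\<close>] have lt: "w (t0, x0) < \<epsilon> * s powr k * h \<rho>"
    by (simp add: f_def \<beta>_def s_def \<rho>_def p0_eq)
  have s0: "s > 0"
  proof (rule ccontr)
    assume "\<not> s > 0"
    then have "s = 0" using s1 by simp
    then show False using lt w_nonneg[of "(t0, x0)"] by simp
  qed
  have h0: "h \<rho> > 0"
  proof (rule ccontr)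
    assume "\<not> h \<rho> > 0"
    then have "\<epsilon> * s powr k * h \<rho> \<le> 0" using eps by (simp add: mult_nonneg_nonpos)
    then show False using lt w_nonneg[of "(t0, x0)"] by simp
  qed
  have h1: "h \<rho> \<le> \<rho> powr (- k)" by (simp add: h_def)
  have xR: "norm (x0 - x1) < R"
  proof (rule ccontr)
    assume "\<not> norm (x0 - x1) < R"
    then have "norm (x0 - x1) = R" using K0 by simp
    then show False using h0 by (simp add: h_def \<rho>_def)
  qed
  have xr: "r0 < norm (x0 - x1)"
  proof (rule ccontr)
    assume "\<not> r0 < norm (x0 - x1)"
    then have eq: "norm (x0 - x1) = r0" using K0 by simp
    have "s powr k \<le> 1" using s1 k_facts(1) by (simp add: powr_le1)
    then have "\<epsilon> * s powr k * h \<rho> \<le> \<epsilon> * 1 * \<rho> powr (- k)"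
      using eps h0 h1 by (intro mult_mono) auto
    also have "\<dots> \<le> c" using eps2 eq by (simp add: \<rho>_def)
    also have "\<dots> \<le> w (t0, x0)" by (rule c) (use K0 eq in auto)
    finally show False using lt by simp
  qed
  let ?z = "\<epsilon> * s powr k * h \<rho>"
  define A where "A = \<epsilon> * s powr k"
  have A0: "A > 0" using eps s0 by (simp add: A_def)
  have b1: "\<forall>\<^sub>F r in nhds \<rho>. (\<beta> t0 has_real_derivative A * (- k * r powr (- k - 1))) (at r)"
  proof -
    have "\<forall>\<^sub>F r in nhds \<rho>. r \<in> {0<..}" using \<rho> by (intro eventually_nhds_in_open) auto
    then show ?thesis
    proof eventually_elim
      case (elim r)
      then show ?case unfolding \<beta>_def h_def A_def s_def
        by (auto intro!: derivative_eq_intros)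
    qed
  qed
  have b2: "((\<lambda>r. A * (- k * r powr (- k - 1))) has_real_derivative A * (k * (k + 1) * \<rho> powr (- k - 2))) (at \<rho>)"
    using \<rho> by (auto intro!: derivative_eq_intros simp: algebra_simps)
  have bt: "((\<lambda>t. \<beta> t \<rho>) has_real_derivative \<epsilon> * (k * s powr (k - 1)) * h \<rho>) (at t0)"
    unfolding \<beta>_def using s0 by (auto intro!: derivative_eq_intros simp: s_def)
  have "open ({t1 - d<..} \<times> {y. r0 < norm (y - x1) \<and> norm (y - x1) < R})"
    by (intro open_Times open_Collect_conj open_Collect_less continuous_intros)
  moreover have "(t0, x0) \<in> {t1 - d<..} \<times> {y. r0 < norm (y - x1) \<and> norm (y - x1) < R}"
    using s0 xr xR by (simp add: s_def)
  ultimately have "\<forall>\<^sub>F p in nhds (t0, x0). p \<in> {t1 - d<..} \<times> {y. r0 < norm (y - x1) \<and> norm (y - x1) < R}"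
    by (rule eventually_nhds_in_open)
  then have min: "\<forall>\<^sub>F p in nhds (t0, x0). fst p \<le> t0 \<longrightarrow>
      w (t0, x0) - \<beta> t0 \<rho> \<le> w p - \<beta> (fst p) ((norm (snd p - x1))\<^sup>2)"
  proof eventually_elim
    case (elim p)
    show ?case
    proof
      assume "fst p \<le> t0"
      with elim K0 have "p \<in> K" by (cases p) (auto simp: inK)
      from p0(2)[OF this] show "w (t0, x0) - \<beta> t0 \<rho> \<le> w p - \<beta> (fst p) ((norm (snd p - x1))\<^sup>2)"
        by (simp add: f_def p0_eq \<rho>_def)
    qed
  qed
  note touch = touching_below[OF sw t0, of \<beta> _ x0 x1, folded \<rho>_def, OF b1 b2 bt min]
  have Uz: "U (t0, x0) \<le> ?z powr (1 / m)"
    unfolding U_eq[OF t0] using lt w_nonneg m0 by (intro powr_mono2) auto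
  have z1: "?z powr (1 / m) = \<epsilon> powr (1 / m) * s powr (k + 1) * h \<rho> powr (1 / m)"
    using eps s0 h0 k_facts(2) by (simp add: powr_mult powr_powr)
  have hm: "h \<rho> powr (1 / m) \<le> \<rho> powr (- k - 1)"
  proof -
    have "h \<rho> powr (1 / m) \<le> (\<rho> powr (- k)) powr (1 / m)" using h0 h1 m0 by (intro powr_mono2) auto
    also have "\<dots> = \<rho> powr (- k - 1)" using k_facts(2) by (simp add: powr_powr)
    finally show ?thesis .
  qed
  \<comment> \<open>The power \<open>k\<close> in time is chosen for this:
    \<open>U powr (1 - m)\<close> contributes a factor \<open>s\<close>, which turns
    \<open>s powr (k - 1)\<close> into \<open>s powr k\<close>, the power in the Laplacian of the
    barrier.\<close>
  have "dt U (t0, x0) \<le> (1 / m) * U (t0, x0) powr (1 - m) * (\<epsilon> * (k * s powr (k - 1)) * h \<rho>)"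
    unfolding dt_U[OF t0] using touch(1) m0 by (intro mult_left_mono) auto
  also have "\<dots> \<le> (1 / m) * (?z powr (1 / m)) powr (1 - m) * (\<epsilon> * (k * s powr (k - 1)) * h \<rho>)"
    using Uz m0 m1 nonneg[OF t0, of x0] eps h0 k_facts(1)
    by (intro mult_right_mono mult_left_mono powr_mono2) auto
  also have "(?z powr (1 / m)) powr (1 - m) = \<epsilon> powr (1 / k) * s * h \<rho> powr (1 / k)"
  proof -
    have "1 / m * (1 - m) = 1 / k" using k_facts(5) by simp
    then have "(?z powr (1 / m)) powr (1 - m) = ?z powr (1 / k)" by (simp only: powr_powr)
    also have "\<dots> = \<epsilon> powr (1 / k) * (s powr k) powr (1 / k) * h \<rho> powr (1 / k)"
      using eps h0 by (simp add: powr_mult)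
    finally show ?thesis using s0 k_facts(1) by (simp add: powr_powr)
  qed
  also have "(1 / m) * (\<epsilon> powr (1 / k) * s * h \<rho> powr (1 / k)) * (\<epsilon> * (k * s powr (k - 1)) * h \<rho>)
     = (k / m) * ((\<epsilon> * \<epsilon> powr (1 / k)) * (s * s powr (k - 1)) * (h \<rho> * h \<rho> powr (1 / k)))"
    by (simp add: field_simps)
  also have "\<dots> = (k / m) * (\<epsilon> powr (1 / m) * s powr k * h \<rho> powr (1 / m))"
    using eps s0 h0 by (simp add: powr_mult_base k_facts(6))
  finally have 1: "dt U (t0, x0) \<le> (k / m) * (\<epsilon> powr (1 / m) * s powr k * h \<rho> powr (1 / m))" .
  have "U (t0, x0) powr q \<le> L * U (t0, x0)" by (rule powr_q_le[OF t0])
  also have "\<dots> \<le> L * (?z powr (1 / m))" using Uz L_pos by (intro mult_left_mono) auto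
  also have "\<dots> \<le> L * (\<epsilon> powr (1 / m) * s powr k * h \<rho> powr (1 / m))"
  proof -
    have "s powr (k + 1) \<le> s powr k" using s0 s1 by (intro powr_mono') auto
    then show ?thesis unfolding z1 using L_pos by (intro mult_left_mono mult_right_mono) auto
  qed
  finally have 2: "U (t0, x0) powr q \<le> L * (\<epsilon> powr (1 / m) * s powr k * h \<rho> powr (1 / m))" .
  have "lap w (t0, x0) \<le> (k / m + L) * (\<epsilon> powr (1 / m) * s powr k * h \<rho> powr (1 / m))"
    unfolding lap_w[OF t0] using 1 2 by (simp add: algebra_simps)
  also have "\<dots> \<le> (k / m + L) * (\<epsilon> powr (1 / m) * s powr k * \<rho> powr (- k - 1))"
    using hm k_facts(1) m0 L_pos by (intro mult_left_mono) auto
  also have "\<dots> = (\<epsilon> powr (1 / m) * (k / m + L)) * (s powr k * \<rho> powr (- k - 1))" by simp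
  also have "\<dots> < (\<epsilon> * (2 * k * \<gamma>)) * (s powr k * \<rho> powr (- k - 1))"
    using eps1 s0 \<rho> by (intro mult_strict_right_mono) auto
  also have "\<dots> = 2 * real CARD('n) * (A * (- k * \<rho> powr (- k - 1))) + 4 * \<rho> * (A * (k * (k + 1) * \<rho> powr (- k - 2)))"
  proof -
    have "1 + (- k - 2) = - k - 1" by simp
    then have "\<rho> * \<rho> powr (- k - 2) = \<rho> powr (- k - 1)"
      using \<rho> powr_mult_base[of \<rho> "- k - 2"] by (simp only: less_imp_le)
    then have "4 * \<rho> * (A * (k * (k + 1) * \<rho> powr (- k - 2))) = 4 * A * k * (k + 1) * \<rho> powr (- k - 1)"
      by (metis (no_types, opaque_lifting) mult.assoc mult.left_commute)
    then show ?thesis by (simp add: A_def \<gamma>_def algebra_simps)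
  qed
  finally show False using touch(3) by simp
qed

lemma exterior_barrier:
  fixes x1 :: "real^'n"
  assumes d: "0 < d" "d \<le> 1" "d < t1" and r0: "r0 > 0" and eps: "\<epsilon> > 0"
    and eps1: "\<epsilon> powr (1 / m) * (k / m + L) < \<epsilon> * (2 * k * \<gamma>)"
    and eps2: "\<epsilon> * (r0\<^sup>2) powr (- k) \<le> c"
    and c: "\<And>t x. t1 - d \<le> t \<Longrightarrow> t \<le> t1 \<Longrightarrow> norm (x - x1) = r0 \<Longrightarrow> c \<le> w (t, x)"
    and x: "r0 \<le> norm (x - x1)"
  shows "\<epsilon> * d powr k * ((norm (x - x1))\<^sup>2) powr (- k) \<le> w (t1, x)"
proof -
  have "((\<lambda>R. \<epsilon> * d powr k * (((norm (x - x1))\<^sup>2) powr (- k) - (R\<^sup>2) powr (- k)))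
      \<longlongrightarrow> \<epsilon> * d powr k * (((norm (x - x1))\<^sup>2) powr (- k) - 0)) at_top"
    using k_facts(1) by (intro tendsto_intros tendsto_neg_powr filterlim_pow_at_top filterlim_ident) auto
  moreover have "\<forall>\<^sub>F R in at_top. \<epsilon> * d powr k * (((norm (x - x1))\<^sup>2) powr (- k) - (R\<^sup>2) powr (- k)) \<le> w (t1, x)"
    using eventually_gt_at_top[of "max r0 (norm (x - x1))"]
  proof eventually_elim
    case (elim R)
    show ?case by (rule exterior_barrier_annulus[OF d r0 _ eps eps1 eps2 c x]) (use elim in auto)
  qed
  ultimately show ?thesis using tendsto_upperbound by fastforce
qed

text \<open>Positivity at one point gives the full tail at the same instant: by continuity
  \<open>w\<close> is bounded below near \<open>x1\<close> already on \<open>[t1 - d, t1]\<close>,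
  and this is the inner boundary value that the exterior barrier needs.\<close>

lemma slice_lower_bound:
  assumes t1: "t1 > 0" and pos: "U (t1, x1) > 0"
  obtains c where "c > 0" "\<And>x. c * (1 + (norm (x - x1))\<^sup>2) powr (- k) \<le> w (t1, x)"
proof -
  define c0 where "c0 = w (t1, x1) / 2"
  have c0: "c0 > 0" using pos by (simp add: c0_def w_def)
  have "continuous (at (t1, x1)) w"
    using continuous_on_eq_continuous_at[OF open_half_space] continuous_w[of half_space] t1
    by (metis half_space_iff order_refl)
  then obtain e where e: "e > 0" "\<And>p. dist p (t1, x1) < e \<Longrightarrow> dist (w p) (w (t1, x1)) < c0"
    using c0 unfolding continuous_at_eps_delta by blast
  have near: "c0 \<le> w (t, x)" if "\<bar>t - t1\<bar> \<le> e / 3" "norm (x - x1) \<le> e / 3" for t x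
  proof -
    have "dist (t, x) (t1, x1) \<le> dist t t1 + dist x x1"
      by (simp add: dist_Pair_Pair sqrt_sum_squares_le_sum)
    also have "\<dots> \<le> e / 3 + e / 3" using that by (intro add_mono) (auto simp: dist_norm)
    also have "\<dots> < e" using e(1) by simp
    finally have "\<bar>w (t, x) - w (t1, x1)\<bar> < c0" using e(2) by (simp add: dist_real_def)
    moreover have "w (t1, x1) = 2 * c0" by (simp add: c0_def)
    ultimately show ?thesis by linarith
  qed
  define r0 where "r0 = e / 3"
  define d where "d = min (min (e / 3) (t1 / 2)) 1"
  have d: "0 < d" "d \<le> 1" "d < t1" "d \<le> e / 3" using e(1) t1 by (auto simp: d_def)
  have r0: "r0 > 0" using e(1) by (simp add: r0_def)
  \<comment> \<open>As \<open>1 / m = 1 + 1 / k\<close>, the bound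
    \<open>\<epsilon> powr (1 / k) \<le> D\<close> yields \<open>eps1\<close> with half of the
    admissible right side.\<close>
  define D where "D = k * \<gamma> / (k / m + L)"
  have kL: "k / m + L > 0" using k_facts(1) m0 L_pos by (simp add: add_pos_pos)
  have D: "D > 0" using k_facts(1) gamma_pos kL by (simp add: D_def)
  define \<epsilon> where "\<epsilon> = min (c0 * (r0\<^sup>2) powr k) (D powr k)"
  have eps: "\<epsilon> > 0" using c0 r0 D by (simp add: \<epsilon>_def)
  have eps2: "\<epsilon> * (r0\<^sup>2) powr (- k) \<le> c0"
  proof -
    have "\<epsilon> * (r0\<^sup>2) powr (- k) \<le> (c0 * (r0\<^sup>2) powr k) * (r0\<^sup>2) powr (- k)"
      by (intro mult_right_mono) (auto simp: \<epsilon>_def)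
    then show ?thesis using r0 by (simp add: mult.assoc flip: powr_add)
  qed
  have eps1: "\<epsilon> powr (1 / m) * (k / m + L) < \<epsilon> * (2 * k * \<gamma>)"
  proof -
    have "\<epsilon> powr (1 / k) \<le> (D powr k) powr (1 / k)"
      using eps k_facts(1) by (intro powr_mono2) (auto simp: \<epsilon>_def)
    also have "\<dots> = D" using D k_facts(1) by (simp add: powr_powr)
    finally have "\<epsilon> powr (1 / k) \<le> D" .
    then have "\<epsilon> powr (1 / m) * (k / m + L) \<le> \<epsilon> * D * (k / m + L)"
      using eps kL by (simp add: k_facts(6) powr_add mult_left_mono)
    also have "\<dots> = \<epsilon> * (k * \<gamma>)" using kL by (simp add: D_def)
    also have "\<dots> < \<epsilon> * (2 * k * \<gamma>)" using eps k_facts(1) gamma_pos by simp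
    finally show ?thesis .
  qed
  define c where "c = min c0 (\<epsilon> * d powr k)"
  show ?thesis
  proof
    show "c > 0" using c0 eps d by (simp add: c_def)
    fix x
    show "c * (1 + (norm (x - x1))\<^sup>2) powr (- k) \<le> w (t1, x)"
    proof (cases "norm (x - x1) \<le> r0")
      case True
      have "(1 + (norm (x - x1))\<^sup>2) powr (- k) \<le> (1 + (norm (x - x1))\<^sup>2) powr 0"
        using k_facts(1) by (intro powr_mono) auto
      then have "(1 + (norm (x - x1))\<^sup>2) powr (- k) \<le> 1"
        by (smt (verit) powr_zero_eq_one zero_le_power2)
      then have "c * (1 + (norm (x - x1))\<^sup>2) powr (- k) \<le> c0 * 1"
        using c0 by (intro mult_mono) (auto simp: c_def)
      also have "\<dots> \<le> w (t1, x)" using near[of t1 x] True e(1) by (simp add: r0_def)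
      finally show ?thesis .
    next
      case False
      have "(1 + (norm (x - x1))\<^sup>2) powr (- k) \<le> ((norm (x - x1))\<^sup>2) powr (- k)"
        using False r0 k_facts(1) by (intro powr_mono2') auto
      then have "c * (1 + (norm (x - x1))\<^sup>2) powr (- k) \<le> (\<epsilon> * d powr k) * ((norm (x - x1))\<^sup>2) powr (- k)"
        using eps by (intro mult_mono) (auto simp: c_def)
      also have "\<dots> \<le> w (t1, x)"
        by (rule exterior_barrier[OF d(1-3) r0 eps eps1 eps2]) (use False near d(4) in \<open>auto simp: r0_def\<close>)
      finally show ?thesis .
    qed
  qed
qed


text \<open>
  A subsolution that decays in time can only be compared through a first contact, where the
  solution equals \<open>\<beta> - \<eta>\<close>; the shift \<open>\<eta>\<close> makes the contact set compact. Where \<open>\<eta>\<close> is not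
  negligible against \<open>\<beta>\<close>, the barrier is so far out that its Laplacian already dominates
  the absorption.
\<close>
lemma global_barrier:
  fixes x1 :: "real^'n" and a0 b rate t1 :: real
  defines "a \<equiv> \<lambda>t. a0 * exp (rate * (t - t1))"
  assumes t1: "0 < t1" and a0: "a0 > 0" and b0: "b > 0"
    and b1: "2 * k * b * \<gamma> \<ge> L + 1"
    and lam: "rate * k / (2 * m) > L + 2 * k * b * real CARD('n)"
    and init: "\<And>x. (a0 + b * (norm (x - x1))\<^sup>2) powr (- k) \<le> w (t1, x)"
    and tT: "t1 \<le> t" "t \<le> T"
  shows "(a t + b * (norm (x - x1))\<^sup>2) powr (- k) \<le> w (t, x)"
proof -
  define N where "N = real CARD('n)"
  define \<beta> where "\<beta> t \<rho> = (a t + b * \<rho>) powr (- k)" for t \<rho>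
  \<comment> \<open>\<open>Pm\<close> will bound the base \<open>P = a t0 + b \<rho>\<close> of the
    barrier at a contact that is not far out. The next constant is such that for
    \<open>P < Pm\<close> a shift \<open>\<eta> \<le> \<eta>0\<close> leaves more than the fraction
    \<open>2 powr (- k)\<close> of the barrier.\<close>
  define Pm where "Pm = a T + a T * (L + 2 * k * b * N) + 1"
  define \<eta>0 where "\<eta>0 = (1 - 2 powr (- k)) * Pm powr (- k)"
  have N: "N \<ge> 0" by (simp add: N_def)
  have lamp: "rate > 0"
  proof (rule ccontr)
    assume "\<not> rate > 0"
    then have "rate * k / (2 * m) \<le> 0"
      using k_facts(1) m0 by (simp add: divide_nonpos_pos mult_nonpos_nonneg)
    then show False using lam L_pos k_facts(1) b0 N
      by (smt (verit) N_def mult_nonneg_nonneg)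
  qed
  have ap: "a s > 0" for s using a0 by (simp add: a_def)
  have amono: "a s \<le> a T" if "s \<le> T" for s
    using that a0 lamp by (simp add: a_def mult_left_mono)
  have Lb: "L + 2 * k * b * N > 0" using L_pos k_facts(1) b0 N by (simp add: add_pos_nonneg)
  have Pm: "Pm > 0" using ap[of T] Lb by (simp add: Pm_def add_pos_pos)
  have two: "2 powr (- k) < 1" using k_facts(1) by (simp add: powr_less_one)
  have eta0: "\<eta>0 > 0" using Pm two by (simp add: \<eta>0_def)
  have pp: "a s + b * (norm (x - x1))\<^sup>2 > 0" for s x
    using ap[of s] b0 by (simp add: add_pos_nonneg)
  have ca: "continuous_on S a" for S unfolding a_def by (intro continuous_intros)
  have claim: "w (t, x) \<ge> \<beta> t ((norm (x - x1))\<^sup>2) - \<eta>"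
    if \<eta>: "0 < \<eta>" "\<eta> \<le> \<eta>0" and tx: "t1 \<le> t" "t \<le> T" for t x \<eta>
  proof (rule ccontr)
    assume neg: "\<not> ?thesis"
    define f where "f p = w p - \<beta> (fst p) ((norm (snd p - x1))\<^sup>2)" for p
    define R where "R = sqrt (\<eta> powr (- 1 / k) / b)"
    define K where "K = {t1..T} \<times> cball x1 R"
    define E where "E = {p \<in> K. f p \<le> - \<eta>}"
    have KH: "K \<subseteq> half_space" using t1 by (auto simp: K_def)
    have cf: "continuous_on S f" if "S \<subseteq> half_space" for S
      unfolding f_def \<beta>_def
      by (intro continuous_intros continuous_w that continuous_on_compose2[OF ca[of UNIV]])
        (use pp in \<open>auto simp: less_imp_neq[symmetric]\<close>)
    \<comment> \<open>As \<open>w \<ge> 0\<close>, the barrier can exceed \<open>w\<close> by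
      \<open>\<eta>\<close> only where it is itself at least \<open>\<eta>\<close>, that is within
      radius \<open>R\<close>.\<close>
    have inE: "(s, y) \<in> E" if "t1 \<le> s" "s \<le> T" "f (s, y) \<le> - \<eta>" for s y
    proof -
      have "\<eta> \<le> \<beta> s ((norm (y - x1))\<^sup>2)" using that(3) w_nonneg[of "(s, y)"] by (simp add: f_def)
      then have "\<beta> s ((norm (y - x1))\<^sup>2) powr (- 1 / k) \<le> \<eta> powr (- 1 / k)"
        using \<eta>(1) k_facts(1) by (intro powr_mono2') auto
      also have "\<beta> s ((norm (y - x1))\<^sup>2) powr (- 1 / k) = a s + b * (norm (y - x1))\<^sup>2"
        using pp[of s y] k_facts(1) by (simp add: \<beta>_def powr_powr)
      finally have "b * (norm (y - x1))\<^sup>2 \<le> \<eta> powr (- 1 / k)" using ap[of s] by linarith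
      then have "(norm (y - x1))\<^sup>2 \<le> \<eta> powr (- 1 / k) / b" using b0 by (simp add: field_simps)
      then have "norm (y - x1) \<le> R" unfolding R_def by (rule real_le_rsqrt)
      then show ?thesis using that by (simp add: E_def K_def dist_norm norm_minus_commute)
    qed
    have "compact K" unfolding K_def by (intro compact_Times) auto
    then have "compact E" unfolding E_def by (intro compact_sublevel cf KH)
    moreover have "(t, x) \<in> E" using neg tx by (intro inE) (auto simp: f_def)
    moreover have "continuous_on E fst" by (intro continuous_intros)
    ultimately obtain p0 where p0: "p0 \<in> E" "\<And>p. p \<in> E \<Longrightarrow> fst p0 \<le> fst p"
      using continuous_attains_inf[of E fst] by blast
    obtain t0 x0 where p0_eq: "p0 = (t0, x0)" by (cases p0)
    have K0: "t1 \<le> t0" "t0 \<le> T" and f0: "f (t0, x0) \<le> - \<eta>"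
      using p0(1) by (auto simp: E_def K_def p0_eq)
    have t0: "t0 > 0" using K0 t1 by simp
    have t10: "t1 < t0"
    proof (rule ccontr)
      assume "\<not> t1 < t0"
      then have "t0 = t1" using K0 by simp
      then show False using f0 \<eta> init[of x0] by (simp add: f_def \<beta>_def a_def)
    qed
    have before: "f (s, y) > - \<eta>" if "t1 \<le> s" "s < t0" for s y
      using inE[of s y] p0(2)[of "(s, y)"] that K0 by (force simp: p0_eq)
    \<comment> \<open>\<open>t0\<close> is the first time at which \<open>E\<close> is reached, so
      by continuity from the left the value \<open>- \<eta>\<close> is a minimum of \<open>f\<close>
      over all points with times in \<open>[t1, t0]\<close>.\<close>
    have at: "f (t0, y) \<ge> - \<eta>" for y
    proof (rule tendsto_lowerbound)
      have "continuous_on {0<..} (\<lambda>s. f (s, y))"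
        by (rule continuous_on_compose2[OF cf[OF order_refl]]) (auto intro!: continuous_intros)
      then have "isCont (\<lambda>s. f (s, y)) t0" using t0 by (simp add: continuous_on_eq_continuous_at)
      then show "((\<lambda>s. f (s, y)) \<longlongrightarrow> f (t0, y)) (at_left t0)"
        unfolding isCont_def by (rule tendsto_mono[OF at_le[OF subset_UNIV]])
      show "\<forall>\<^sub>F s in at_left t0. - \<eta> \<le> f (s, y)"
        using eventually_at_left_real[OF t10]
        by eventually_elim (use before in \<open>auto intro: less_imp_le\<close>)
    qed auto
    have f0': "f (t0, x0) = - \<eta>" using f0 at[of x0] by simp
    define \<rho> where "\<rho> = (norm (x0 - x1))\<^sup>2"
    define P where "P = a t0 + b * \<rho>"
    have \<rho>0: "\<rho> \<ge> 0" by (simp add: \<rho>_def)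
    have P: "P > 0" using pp by (simp add: P_def \<rho>_def)
    have pw: "((\<lambda>r. (a t0 + b * r) powr e) has_real_derivative e * (a t0 + b * r) powr (e - 1) * b) (at r)"
      if "0 < a t0 + b * r" for e r
      using that by (auto intro!: derivative_eq_intros)
    have b1': "\<forall>\<^sub>F r in nhds \<rho>. (\<beta> t0 has_real_derivative - k * b * (a t0 + b * r) powr (- k - 1)) (at r)"
    proof -
      have "open {r. 0 < a t0 + b * r}" by (intro open_Collect_less continuous_intros)
      then have "\<forall>\<^sub>F r in nhds \<rho>. r \<in> {r. 0 < a t0 + b * r}"
        using P by (intro eventually_nhds_in_open) (auto simp: P_def)
      then show ?thesis
      proof eventually_elim
        case (elim r)
        then have "((\<lambda>r. (a t0 + b * r) powr (- k)) has_real_derivative - k * (a t0 + b * r) powr (- k - 1) * b) (at r)"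
          by (intro pw) simp
        moreover have "- k * (a t0 + b * r) powr (- k - 1) * b = - k * b * (a t0 + b * r) powr (- k - 1)" by simp
        ultimately show ?case unfolding \<beta>_def by (simp only:)
      qed
    qed
    have b2': "((\<lambda>r. - k * b * (a t0 + b * r) powr (- k - 1)) has_real_derivative
        k * (k + 1) * b\<^sup>2 * P powr (- k - 2)) (at \<rho>)"
    proof -
      have "((\<lambda>r. - k * b * (a t0 + b * r) powr (- k - 1)) has_real_derivative
          - k * b * ((- k - 1) * (a t0 + b * \<rho>) powr (- k - 1 - 1) * b)) (at \<rho>)"
        by (intro DERIV_cmult pw) (use P in \<open>simp add: P_def\<close>)
      moreover have "- k - 1 - 1 = - k - 2" by simp
      moreover have "- k * b * ((- k - 1) * Q * b) = k * (k + 1) * b\<^sup>2 * Q" for Q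
        by (simp add: power2_eq_square algebra_simps)
      ultimately show ?thesis by (simp only: P_def)
    qed
    have bt': "((\<lambda>t. \<beta> t \<rho>) has_real_derivative - k * (rate * a t0) * P powr (- k - 1)) (at t0)"
    proof -
      have "(a has_real_derivative rate * a t0) (at t0)"
        unfolding a_def by (auto intro!: derivative_eq_intros)
      then have "((\<lambda>t. a t + b * \<rho>) has_real_derivative rate * a t0) (at t0)"
        by (auto intro!: derivative_eq_intros)
      from DERIV_powr[OF this _ DERIV_const, of "- k"] P
      show ?thesis unfolding \<beta>_def P_def by (simp add: powr_diff mult_ac)
    qed
    have "\<forall>\<^sub>F p in nhds (t0, x0). p \<in> {t1<..} \<times> UNIV"
      using t10 by (intro eventually_nhds_in_open open_Times) auto
    then have min: "\<forall>\<^sub>F p in nhds (t0, x0). fst p \<le> t0 \<longrightarrow>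
      w (t0, x0) - \<beta> t0 \<rho> \<le> w p - \<beta> (fst p) ((norm (snd p - x1))\<^sup>2)"
    proof eventually_elim
      case (elim p)
      have "- \<eta> \<le> f p" if "fst p \<le> t0"
        using that elim before[of "fst p" "snd p"] at[of "snd p"] by (cases "fst p = t0"; cases p) auto
      then show ?case using f0' by (simp add: f_def \<rho>_def)
    qed
    note touch = touching_below[OF sw t0, of \<beta> _ x0 x1, folded \<rho>_def, OF b1' b2' bt' min]
    define y where "y = w (t0, x0)"
    have y: "y = P powr (- k) - \<eta>" "y \<ge> 0" using f0' w_nonneg by (auto simp: y_def f_def \<beta>_def P_def \<rho>_def)
    \<comment> \<open>\<open>X powr k\<close> is the ratio of the solution to the unshifted barrier
      at the contact. The time derivative of the barrier enters the inequality multiplied by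
      \<open>X\<close>, so it helps only if \<open>X\<close> is not small.\<close>
    define X where "X = P * y powr (1 / k)"
    have X0: "X \<ge> 0" using P by (simp add: X_def)
    have Uy: "U (t0, x0) = y powr (1 / m)" unfolding y_def by (rule U_eq[OF t0])
    have "U (t0, x0) \<le> (P powr (- k)) powr (1 / m)"
      unfolding Uy using y \<eta> m0 by (intro powr_mono2) auto
    also have "\<dots> = P powr (- k - 1)" using k_facts(2) by (simp add: powr_powr)
    finally have "L * U (t0, x0) \<le> L * P powr (- k - 1)" using L_pos by (intro mult_left_mono) auto
    then have 1: "U (t0, x0) powr q \<le> L * P powr (- k - 1)" using powr_q_le[OF t0, of x0] by linarith
    have "1 / m * (1 - m) = 1 / k" using k_facts(5) by simp
    then have U1m: "U (t0, x0) powr (1 - m) = y powr (1 / k)" unfolding Uy by (simp only: powr_powr)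
    have 2: "dt U (t0, x0) \<le> (1 / m) * y powr (1 / k) * (- k * (rate * a t0) * P powr (- k - 1))"
      unfolding dt_U[OF t0] U1m using touch(1) m0 by (intro mult_left_mono) auto
    have PP: "P * P powr (- k - 2) = P powr (- k - 1)"
    proof -
      have "1 + (- k - 2) = - k - 1" by simp
      then show ?thesis using P powr_mult_base[of P "- k - 2"] by (simp only: less_imp_le)
    qed
    have "2 * N * (- k * b * P powr (- k - 1)) + 4 * \<rho> * (k * (k + 1) * b\<^sup>2 * P powr (- k - 2))
      \<le> (1 / m) * y powr (1 / k) * (- k * (rate * a t0) * P powr (- k - 1)) + L * P powr (- k - 1)"
      using touch(3) 1 2 lap_w[OF t0, of x0] by (simp add: N_def P_def)
    then have "P powr (- k - 2) * (2 * N * (- k * b * P) + 4 * \<rho> * (k * (k + 1) * b\<^sup>2))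
      \<le> P powr (- k - 2) * ((1 / m) * (- k * (rate * a t0)) * X + L * P)"
      unfolding PP[symmetric] X_def by (simp add: algebra_simps)
    then have main: "2 * N * (- k * b * P) + 4 * \<rho> * (k * (k + 1) * b\<^sup>2) \<le> (1 / m) * (- k * (rate * a t0)) * X + L * P"
      using P by simp
    have lhs: "2 * N * (- k * b * P) + 4 * \<rho> * (k * (k + 1) * b\<^sup>2) = 2 * k * b * (\<gamma> * (b * \<rho>) - N * a t0)"
      by (simp add: P_def \<gamma>_def N_def power2_eq_square algebra_simps)
    have main': "(rate * k / m) * a t0 * X + (2 * k * b * \<gamma> - L) * (b * \<rho>) \<le> a t0 * (L + 2 * k * b * N)"
      using main unfolding lhs by (simp add: P_def algebra_simps)
    have b\<rho>: "b * \<rho> \<ge> 0" using b0 \<rho>0 by simp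
    have far: "b * \<rho> \<le> (2 * k * b * \<gamma> - L) * (b * \<rho>)"
      using mult_right_mono[of 1 "2 * k * b * \<gamma> - L" "b * \<rho>"] b1 b\<rho> by simp
    have lkm: "rate * k / m > 0" using lamp k_facts(1) m0 by simp
    \<comment> \<open>For \<open>X \<ge> 1 / 2\<close> the choice of \<open>rate\<close> contradicts
      \<open>main'\<close>. Otherwise \<open>main'\<close> bounds \<open>b * \<rho>\<close>, hence
      \<open>P < Pm\<close>, and the choice of \<open>\<eta>0\<close> contradicts
      \<open>X < 1 / 2\<close>.\<close>
    show False
    proof (cases "X \<ge> 1 / 2")
      case True
      have "a t0 * (L + 2 * k * b * N) < a t0 * (rate * k / (2 * m))"
        using mult_strict_left_mono[OF lam ap[of t0]] by (simp only: N_def)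
      also have "\<dots> = (rate * k / m) * a t0 * (1 / 2)" by (simp add: mult_ac)
      also have "\<dots> \<le> (rate * k / m) * a t0 * X"
        using True less_imp_le[OF mult_pos_pos[OF lkm ap[of t0]]] by (rule mult_left_mono)
      finally show False using main' far b\<rho> by linarith
    next
      case False
      have "b * \<rho> \<le> a t0 * (L + 2 * k * b * N)"
        using main' far X0 lkm ap[of t0] by (smt (verit) mult_nonneg_nonneg)
      also have "\<dots> \<le> a T * (L + 2 * k * b * N)"
        using amono[OF K0(2)] Lb by (intro mult_right_mono) auto
      finally have "P < Pm" using amono[OF K0(2)] by (simp add: P_def Pm_def)
      then have "Pm powr (- k) < P powr (- k)" using P k_facts(1) by (simp add: powr_less_mono2_neg)
      have "y powr (1 / k) \<le> 1 / (2 * P)" using False P by (simp add: X_def field_simps)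
      then have "(y powr (1 / k)) powr k \<le> (1 / (2 * P)) powr k"
        using k_facts(1) by (intro powr_mono2) auto
      moreover have "(y powr (1 / k)) powr k = y" using y(2) k_facts(1) by (simp add: powr_powr)
      moreover have "(1 / (2 * P)) powr k = 2 powr (- k) * P powr (- k)"
        using P by (simp add: powr_divide powr_mult powr_minus_divide)
      ultimately have "y \<le> 2 powr (- k) * P powr (- k)" by simp
      then have "(1 - 2 powr (- k)) * P powr (- k) \<le> \<eta>" using y(1) by (simp add: algebra_simps)
      also have "\<dots> \<le> (1 - 2 powr (- k)) * Pm powr (- k)" using \<eta>(2) by (simp add: \<eta>0_def)
      finally have "P powr (- k) \<le> Pm powr (- k)" using two by simp
      then show False using \<open>Pm powr (- k) < P powr (- k)\<close> by simp
    qed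
  qed
  have "\<beta> t ((norm (x - x1))\<^sup>2) \<le> w (t, x)"
  proof (rule field_le_epsilon)
    fix e :: real assume "e > 0"
    then have "\<beta> t ((norm (x - x1))\<^sup>2) - min e \<eta>0 \<le> w (t, x)"
      using eta0 tT by (intro claim) auto
    then show "\<beta> t ((norm (x - x1))\<^sup>2) \<le> w (t, x) + e" by linarith
  qed
  then show ?thesis by (simp add: \<beta>_def)
qed

text \<open>Since \<open>k = m / (1 - m)\<close>, the bound says that \<open>U powr (m - 1)\<close>
  is at most \<open>b (1 + |x - x1|^2)\<close>, which is the linear growth of \<open>v\<close>.
  \<open>T\<close> is fixed beforehand because \<open>b\<close> absorbs the exponential factor in
  the barrier.\<close>

lemma growth_bound:
  assumes t1: "t1 > 0" and pos: "U (t1, x1) > 0"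
  obtains b where "b > 0"
    "\<And>t x. t1 \<le> t \<Longrightarrow> t \<le> T \<Longrightarrow> (b * (1 + (norm (x - x1))\<^sup>2)) powr (- k) \<le> w (t, x)"
proof -
  obtain c where c: "c > 0" "\<And>x. c * (1 + (norm (x - x1))\<^sup>2) powr (- k) \<le> w (t1, x)"
    using slice_lower_bound[OF t1 pos] by blast
  \<comment> \<open>The first entry puts the barrier below the slice bound at time
    \<open>t1\<close>, the second makes its Laplacian beat the absorption far out.\<close>
  define b where "b = max (c powr (- 1 / k)) ((L + 1) / (2 * k * \<gamma>))"
  define rate where "rate = (2 * m / k) * (L + 2 * k * b * real CARD('n) + 1)"
  have b0: "b > 0" using c(1) by (simp add: b_def less_max_iff_disj)
  have "(L + 1) / (2 * k * \<gamma>) \<le> b" by (simp add: b_def)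
  then have b1: "2 * k * b * \<gamma> \<ge> L + 1" using k_facts(1) gamma_pos by (simp add: field_simps)
  have lam: "rate * k / (2 * m) > L + 2 * k * b * real CARD('n)"
    using k_facts(1) m0 by (simp add: rate_def)
  have "rate > 0" using L_pos k_facts(1) b0 m0 by (simp add: rate_def add_pos_pos add_nonneg_pos add_pos_nonneg)
  have init: "(b + b * (norm (x - x1))\<^sup>2) powr (- k) \<le> w (t1, x)" for x
  proof -
    have "(b + b * (norm (x - x1))\<^sup>2) powr (- k) = b powr (- k) * (1 + (norm (x - x1))\<^sup>2) powr (- k)"
    proof -
      have "b + b * (norm (x - x1))\<^sup>2 = b * (1 + (norm (x - x1))\<^sup>2)" by (simp add: distrib_left)
      then show ?thesis using b0 by (simp add: powr_mult)
    qed
    also have "b powr (- k) \<le> (c powr (- 1 / k)) powr (- k)"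
      using c(1) k_facts(1) by (intro powr_mono2') (auto simp: b_def)
    also have "\<dots> = c" using c(1) k_facts(1) by (simp add: powr_powr)
    finally show ?thesis using c(2)[of x] by (simp add: mult_right_mono)
  qed
  define b' where "b' = b * exp (rate * (T - t1))"
  show ?thesis
  proof
    show "b' > 0" using b0 by (simp add: b'_def)
    fix t x assume t: "t1 \<le> t" "t \<le> T"
    have le: "b * exp (rate * (t - t1)) \<le> b'" using t b0 \<open>rate > 0\<close> by (simp add: b'_def)
    have "1 \<le> exp (rate * (T - t1))" using t \<open>rate > 0\<close> by simp
    then have "b \<le> b'" using b0 by (simp add: b'_def)
    then have "b * (norm (x - x1))\<^sup>2 \<le> b' * (norm (x - x1))\<^sup>2" by (intro mult_right_mono) auto
    then have "(b' * (1 + (norm (x - x1))\<^sup>2)) powr (- k)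
        \<le> (b * exp (rate * (t - t1)) + b * (norm (x - x1))\<^sup>2) powr (- k)"
      using le b0 k_facts(1) by (intro powr_mono2') (auto simp: distrib_left add_pos_nonneg)
    also have "\<dots> \<le> w (t, x)" by (rule global_barrier[OF t1 b0 b0 b1 lam init t])
    finally show "(b' * (1 + (norm (x - x1))\<^sup>2)) powr (- k) \<le> w (t, x)" .
  qed
qed

lemma positive_after:
  assumes t1: "t1 > 0" and pos: "U (t1, x1) > 0" and t: "t1 \<le> t"
  shows "U (t, x) > 0"
proof -
  obtain b where b: "b > 0" "(b * (1 + (norm (x - x1))\<^sup>2)) powr (- k) \<le> w (t, x)"
    using growth_bound[OF t1 pos, of t] t by (metis order_refl)
  have "1 + (norm (x - x1))\<^sup>2 > 0" by (simp add: add_pos_nonneg)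
  then have "w (t, x) > 0" using b by (smt (verit) mult_pos_pos powr_gt_zero)
  then have "U (t, x) \<noteq> 0" by (auto simp: w_def)
  then show ?thesis using nonneg[of t x] t t1 by simp
qed

end

section \<open>Cutoff functions and Green's formula\<close>

lemma integrable_compact_support:
  fixes f :: "'a::euclidean_space \<Rightarrow> real"
  assumes "continuous_on UNIV f" "\<And>x. norm x > R \<Longrightarrow> f x = 0"
  shows "integrable lborel f"
proof -
  have "integrable lborel (\<lambda>x. indicator (cball 0 R) x *\<^sub>R f x)"
    using assms(1) by (intro borel_integrable_compact) (auto intro: continuous_on_subset)
  moreover have "(\<lambda>x. indicator (cball 0 R) x *\<^sub>R f x) = f"
  proof
    fix x show "indicator (cball 0 R) x *\<^sub>R f x = f x"
      using assms(2)[of x] by (cases "norm x > R") auto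
  qed
  ultimately show ?thesis by simp
qed

text \<open>Differentiation under the integral sign will be done on boxes, while the integrals of
  interest extend over the whole space.\<close>

lemma integral_cbox_compact_support:
  fixes f :: "'a::euclidean_space \<Rightarrow> real"
  assumes "continuous_on UNIV f" "\<And>x. norm x > R \<Longrightarrow> f x = 0" "cball 0 R \<subseteq> cbox a b"
  shows "integral (cbox a b) f = (LINT x|lborel. f x)"
proof -
  have "(if x \<in> cbox a b then f x else 0) = f x" for x
    using assms(2)[of x] subsetD[OF assms(3), of x] by (cases "norm x > R") auto
  then have "integral (cbox a b) f = integral UNIV f"
    using Henstock_Kurzweil_Integration.integral_restrict_UNIV[of "cbox a b" f] by simp
  then show ?thesis using integral_lborel[OF integrable_compact_support[OF assms(1,2)]] by simp
qed

text \<open>The difference quotients of \<open>\<psi>\<close> have integral zero because the measure is translation invariant.\<close>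
lemma integral_directional_derivative_eq_0:
  fixes \<psi> \<psi>' :: "'a::euclidean_space \<Rightarrow> real"
  assumes der: "\<And>x s. ((\<lambda>s. \<psi> (x + s *\<^sub>R e)) has_real_derivative \<psi>' (x + s *\<^sub>R e)) (at s)"
    and cont: "continuous_on UNIV \<psi>" "continuous_on UNIV \<psi>'"
    and supp: "\<And>x. norm x > R \<Longrightarrow> \<psi> x = 0" "\<And>x. norm x > R \<Longrightarrow> \<psi>' x = 0"
  shows "(LINT x|lborel. \<psi>' x) = 0"
proof -
  define h where "h n = inverse (real (Suc n))" for n
  have h: "h n > 0" "h n \<le> 1" for n by (auto simp: h_def inverse_le_1_iff)
  define D where "D n x = (\<psi> (h n *\<^sub>R e + x) - \<psi> x) / h n" for n x
  have "bounded (\<psi>' ` cball 0 R)"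
    by (intro compact_imp_bounded compact_continuous_image continuous_on_subset[OF cont(2)]) auto
  then obtain B where B: "\<And>x. x \<in> cball 0 R \<Longrightarrow> norm (\<psi>' x) \<le> B"
    unfolding bounded_iff by blast
  define B' where "B' = max B 0"
  have B': "\<bar>\<psi>' x\<bar> \<le> B'" for x
    using B[of x] supp(2)[of x] by (cases "norm x \<le> R") (auto simp: B'_def)
  \<comment> \<open>Because \<open>h n \<le> 1\<close>, all difference quotients are supported in
    one ball; this is the dominating function.\<close>
  have Dbound: "\<bar>D n x\<bar> \<le> B' * indicator (cball 0 (R + norm e)) x" for n x
  proof (cases "norm x \<le> R + norm e")
    case True
    obtain s where "\<psi> (x + h n *\<^sub>R e) - \<psi> (x + 0 *\<^sub>R e) = (h n - 0) * \<psi>' (x + s *\<^sub>R e)"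
      using MVT2[OF h(1)[of n], of "\<lambda>s. \<psi> (x + s *\<^sub>R e)" "\<lambda>s. \<psi>' (x + s *\<^sub>R e)"] der by blast
    then have "D n x = \<psi>' (x + s *\<^sub>R e)" using h(1)[of n] by (simp add: D_def add.commute)
    then show ?thesis using B' True by simp
  next
    case False
    have "norm x \<le> norm (x + h n *\<^sub>R e) + norm (h n *\<^sub>R e)" by (metis add_diff_cancel norm_triangle_ineq4)
    moreover have "norm (h n *\<^sub>R e) \<le> norm e" using h[of n] by (simp add: mult_left_le_one_le)
    ultimately have "norm (x + h n *\<^sub>R e) > R" using False by linarith
    moreover have "norm x > R" using False norm_ge_zero[of e] by linarith
    ultimately show ?thesis using supp(1) False by (simp add: D_def add.commute)
  qed
  have int\<psi>: "integrable lborel \<psi>" by (rule integrable_compact_support[OF cont(1) supp(1)])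
  have meas: "\<psi> \<in> borel_measurable borel" using cont(1) by (rule borel_measurable_continuous_onI)
  have shift: "(LINT x|lborel. \<psi> (c + x)) = (LINT x|lborel. \<psi> x)" for c
  proof -
    have "(LINT x|lborel. \<psi> x) = (LINT x|distr lborel borel ((+) c). \<psi> x)"
      by (simp only: lborel_distr_plus)
    also have "\<dots> = (LINT x|lborel. \<psi> (c + x))" by (rule integral_distr) (use meas in auto)
    finally show ?thesis by simp
  qed
  have intshift: "integrable lborel (\<lambda>x. \<psi> (c + x))" for c
  proof -
    have "integrable (distr lborel borel ((+) c)) \<psi>" using int\<psi> by (simp only: lborel_distr_plus)
    then show ?thesis by (subst (asm) integrable_distr_eq) (use meas in auto)
  qed
  have D0: "(LINT x|lborel. D n x) = 0" for n
    unfolding D_def using intshift int\<psi> shift by (simp add: Bochner_Integration.integral_diff)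
  have "(\<lambda>n. LINT x|lborel. D n x) \<longlonglongrightarrow> (LINT x|lborel. \<psi>' x)"
  proof (rule integral_dominated_convergence[where w = "\<lambda>x. B' * indicator (cball 0 (R + norm e)) x"])
    show "\<psi>' \<in> borel_measurable lborel" using cont(2) by (simp add: borel_measurable_continuous_onI)
    show "D n \<in> borel_measurable lborel" for n
      unfolding D_def by (intro borel_measurable_integrable integrable_divide Bochner_Integration.integrable_diff intshift int\<psi>)
    show "integrable lborel (\<lambda>x. B' * indicator (cball 0 (R + norm e)) x)"
      by (intro integrable_mult_right integrable_real_indicator) (use emeasure_lborel_cball_finite in auto)
    show "AE x in lborel. norm (D n x) \<le> B' * indicator (cball 0 (R + norm e)) x" for n
      using Dbound by simp
    have "(\<lambda>n. D n x) \<longlonglongrightarrow> \<psi>' x" for x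
    proof -
      have "((\<lambda>s. (\<psi> (x + (0 + s) *\<^sub>R e) - \<psi> (x + 0 *\<^sub>R e)) / s) \<longlongrightarrow> \<psi>' (x + 0 *\<^sub>R e)) (at 0)"
        using der[of x 0] by (simp add: DERIV_def)
      moreover have "filterlim h (at 0) sequentially"
        unfolding filterlim_at using h LIMSEQ_inverse_real_of_nat
        by (auto simp: h_def[abs_def])
      ultimately have "(\<lambda>n. (\<psi> (x + (0 + h n) *\<^sub>R e) - \<psi> (x + 0 *\<^sub>R e)) / h n) \<longlonglongrightarrow> \<psi>' (x + 0 *\<^sub>R e)"
        by (rule filterlim_compose)
      then show ?thesis by (simp add: D_def add.commute)
    qed
    then show "AE x in lborel. (\<lambda>n. D n x) \<longlonglongrightarrow> \<psi>' x" by simp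
  qed
  then show ?thesis using D0 by (simp add: LIMSEQ_const_iff)
qed

section \<open>Radial cutoff functions\<close>

lemma has_derivative_max0_power:
  "((\<lambda>y::real. (max 0 y) ^ Suc (Suc n)) has_real_derivative real (Suc (Suc n)) * (max 0 y) ^ Suc n) (at y)"
proof (cases "y = 0")
  case True
  have "((\<lambda>h::real. (max 0 h) ^ Suc (Suc n) / h) \<longlongrightarrow> 0) (at 0)"
  proof (rule tendsto_rabs_zero_cancel, rule tendsto_sandwich)
    show "\<forall>\<^sub>F h in at (0::real). 0 \<le> \<bar>(max 0 h) ^ Suc (Suc n) / h\<bar>" by simp
    have "\<bar>(max 0 h) ^ Suc (Suc n) / h\<bar> \<le> \<bar>h\<bar> ^ Suc n" for h :: real
    proof (cases "h > 0")
      case False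
      then have "(max 0 h) ^ Suc (Suc n) / h = 0" by simp
      then show ?thesis by (metis abs_ge_zero abs_zero zero_le_power)
    qed auto
    then show "\<forall>\<^sub>F h in at (0::real). \<bar>(max 0 h) ^ Suc (Suc n) / h\<bar> \<le> \<bar>h\<bar> ^ Suc n" by simp
    show "((\<lambda>h::real. \<bar>h\<bar> ^ Suc n) \<longlongrightarrow> 0) (at 0)"
      by (auto intro!: tendsto_eq_intros)
  qed auto
  then show ?thesis using True by (simp add: DERIV_def)
next
  case False
  show ?thesis
  proof (cases "y > 0")
    case True
    have d: "((\<lambda>y::real. y ^ Suc (Suc n)) has_real_derivative real (Suc (Suc n)) * y ^ Suc n) (at y)"
      using DERIV_pow[of "Suc (Suc n)" y] by simp
    have "((\<lambda>y::real. (max 0 y) ^ Suc (Suc n)) has_real_derivative real (Suc (Suc n)) * y ^ Suc n) (at y)"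
      by (rule has_field_derivative_transform_within_open[OF d, of "{0<..}"]) (use True in auto)
    then show ?thesis using True by simp
  next
    case False
    have d: "((\<lambda>y::real. 0::real) has_real_derivative 0) (at y)" by simp
    have "((\<lambda>y::real. (max 0 y) ^ Suc (Suc n)) has_real_derivative 0) (at y)"
      by (rule has_field_derivative_transform_within_open[OF d, of "{..<0}"]) (use False \<open>y \<noteq> 0\<close> in auto)
    then show ?thesis using False by simp
  qed
qed

text \<open>The argument is the squared radius, as for the barriers. The third power makes the
  function twice continuously differentiable across \<open>r = R\<^sup>2\<close>;
  \<open>cutoff1\<close> and \<open>cutoff2\<close> are its derivatives in \<open>r\<close>.\<close>

definition cutoff :: "real \<Rightarrow> real \<Rightarrow> real" where
  "cutoff R r = (max 0 (1 - r / R\<^sup>2)) ^ 3"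

definition cutoff1 :: "real \<Rightarrow> real \<Rightarrow> real" where
  "cutoff1 R r = - (3 / R\<^sup>2) * (max 0 (1 - r / R\<^sup>2)) ^ 2"

definition cutoff2 :: "real \<Rightarrow> real \<Rightarrow> real" where
  "cutoff2 R r = (6 / R ^ 4) * max 0 (1 - r / R\<^sup>2)"

lemma cutoff_derivative: "(cutoff R has_real_derivative cutoff1 R r) (at r)"
proof -
  have "((\<lambda>r. 1 - r / R\<^sup>2) has_real_derivative - (1 / R\<^sup>2)) (at r)"
    using DERIV_diff[OF DERIV_const DERIV_cdivide[OF DERIV_ident], of 1 "R\<^sup>2" r UNIV] by simp
  from DERIV_chain2[OF has_derivative_max0_power[of 1] this]
  show ?thesis by (simp add: cutoff_def[abs_def] cutoff1_def numeral_eq_Suc)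
qed

lemma cutoff1_derivative: "(cutoff1 R has_real_derivative cutoff2 R r) (at r)"
proof -
  have "((\<lambda>r. 1 - r / R\<^sup>2) has_real_derivative - (1 / R\<^sup>2)) (at r)"
    using DERIV_diff[OF DERIV_const DERIV_cdivide[OF DERIV_ident], of 1 "R\<^sup>2" r UNIV] by simp
  from DERIV_cmult[OF DERIV_chain2[OF has_derivative_max0_power[of 0] this], of "- (3 / R\<^sup>2)"]
  show ?thesis by (simp add: cutoff1_def[abs_def] cutoff2_def numeral_eq_Suc mult.assoc)
qed

lemma cutoff_outside:
  assumes "R > 0" "r \<ge> R\<^sup>2"
  shows "cutoff R r = 0" "cutoff1 R r = 0" "cutoff2 R r = 0"
  using assms by (auto simp: cutoff_def cutoff1_def cutoff2_def max_def field_simps)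

lemma cutoff_range:
  assumes "r \<ge> 0"
  shows "0 \<le> cutoff R r" "cutoff R r \<le> 1"
proof -
  have "max 0 (1 - r / R\<^sup>2) \<le> 1" using assms by simp
  then show "cutoff R r \<le> 1" unfolding cutoff_def by (intro power_le_one) auto
qed (simp add: cutoff_def)

lemma cutoff_continuous:
  assumes "continuous_on S f"
  shows "continuous_on S (\<lambda>x. cutoff R (f x))" "continuous_on S (\<lambda>x. cutoff1 R (f x))"
    "continuous_on S (\<lambda>x. cutoff2 R (f x))"
  unfolding cutoff_def cutoff1_def cutoff2_def divide_inverse
  by (intro continuous_intros assms)+

text \<open>The Laplacian of the cutoff as a function of \<open>x\<close>, kept as a sum over
  coordinates because Green's formula is proved one coordinate at a time.\<close>

definition cutoff_lap :: "real \<Rightarrow> real^'n::finite \<Rightarrow> real" where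
  "cutoff_lap R x = (\<Sum>i\<in>UNIV. 2 * cutoff1 R ((norm x)\<^sup>2) + 4 * (x $ i)\<^sup>2 * cutoff2 R ((norm x)\<^sup>2))"

text \<open>An upper bound suffices, as the Laplacian is integrated against a nonnegative function.
  The term with \<open>cutoff1\<close> is not positive and is dropped, so the constant
  \<open>4 * 6\<close> does not involve the dimension.\<close>

lemma cutoff_lap_le:
  fixes x :: "real^'n::finite"
  assumes R: "R > 0"
  shows "cutoff_lap R x \<le> 24 / R\<^sup>2" and "norm x > R \<Longrightarrow> cutoff_lap R x = 0"
proof -
  have eq: "cutoff_lap R x = 2 * real CARD('n) * cutoff1 R ((norm x)\<^sup>2) + 4 * (norm x)\<^sup>2 * cutoff2 R ((norm x)\<^sup>2)"
    by (simp add: cutoff_lap_def norm_sq_sum sum.distrib sum_distrib_left sum_distrib_right)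
  have out: "cutoff_lap R x = 0" if "norm x \<ge> R"
  proof -
    have "(norm x)\<^sup>2 \<ge> R\<^sup>2" using that R by (intro power_mono) auto
    then show ?thesis using cutoff_outside[OF R] by (simp add: eq)
  qed
  then show "norm x > R \<Longrightarrow> cutoff_lap R x = 0" by simp
  show "cutoff_lap R x \<le> 24 / R\<^sup>2"
  proof (cases "norm x \<ge> R")
    case True
    then show ?thesis using out by simp
  next
    case False
    have "(norm x)\<^sup>2 * cutoff2 R ((norm x)\<^sup>2) \<le> R\<^sup>2 * (6 / R ^ 4)"
    proof (intro mult_mono power_mono)
      show "cutoff2 R ((norm x)\<^sup>2) \<le> 6 / R ^ 4"
        unfolding cutoff2_def by (rule mult_left_le) auto
      show "0 \<le> cutoff2 R ((norm x)\<^sup>2)" unfolding cutoff2_def by (intro mult_nonneg_nonneg) auto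
    qed (use False in auto)
    also have "\<dots> = 6 / R\<^sup>2" using R by (simp add: power2_eq_square power4_eq_xxxx)
    finally have "4 * (norm x)\<^sup>2 * cutoff2 R ((norm x)\<^sup>2) \<le> 24 / R\<^sup>2" by simp
    moreover have "cutoff1 R ((norm x)\<^sup>2) \<le> 0" by (simp add: cutoff1_def mult_nonpos_nonneg)
    ultimately show ?thesis unfolding eq by (smt (verit) mult_nonneg_nonpos of_nat_0_le_iff)
  qed
qed

lemma slice_continuous:
  assumes "smooth F" "t > 0"
  shows "continuous_on S (\<lambda>x. F (t, x))"
  by (rule continuous_on_compose2[OF smooth_on_continuous[OF assms(1)]])
    (use assms(2) in \<open>auto intro!: continuous_intros\<close>)

lemma green_cutoff:
  fixes F :: "real \<times> (real^'n::finite) \<Rightarrow> real"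
  assumes F: "smooth F" and t: "t > 0" and R: "R > 0"
  shows "(LINT x|lborel. cutoff R ((norm x)\<^sup>2) * lap F (t, x)) = (LINT x|lborel. F (t, x) * cutoff_lap R x)"
proof -
  have out: "cutoff R ((norm x)\<^sup>2) = 0 \<and> cutoff1 R ((norm x)\<^sup>2) = 0 \<and> cutoff2 R ((norm x)\<^sup>2) = 0"
    if "norm x > R" for x :: "real^'n"
  proof -
    have "(norm x)\<^sup>2 \<ge> R\<^sup>2" using that R by (intro power_mono) auto
    then show ?thesis using cutoff_outside[OF R] by simp
  qed
  let ?a = "\<lambda>i x. cutoff R ((norm x)\<^sup>2) * dx i (dx i F) (t, x)"
  let ?b = "\<lambda>i x. F (t, x) * (2 * cutoff1 R ((norm x)\<^sup>2) + 4 * (x $ i)\<^sup>2 * cutoff2 R ((norm x)\<^sup>2))"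
  have ca: "continuous_on UNIV (?a i)" for i
    by (intro continuous_intros cutoff_continuous slice_continuous smooth_dx F t)
  have cb: "continuous_on UNIV (?b i)" for i
    by (intro continuous_intros cutoff_continuous slice_continuous F t)
  have ia: "integrable lborel (?a i)" for i
    by (rule integrable_compact_support[OF ca, of R]) (use out in auto)
  have ib: "integrable lborel (?b i)" for i
    by (rule integrable_compact_support[OF cb, of R]) (use out in auto)
  have part: "(LINT x|lborel. ?a i x) = (LINT x|lborel. ?b i x)" for i
  proof -
    \<comment> \<open>The flux whose derivative in direction \<open>i\<close> is the difference of
      the two integrands.\<close>
    let ?p = "\<lambda>x. cutoff R ((norm x)\<^sup>2) * dx i F (t, x) - F (t, x) * (cutoff1 R ((norm x)\<^sup>2) * (2 * x $ i))"
    have "(LINT x|lborel. ?a i x - ?b i x) = 0"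
    proof (rule integral_directional_derivative_eq_0[of ?p "axis i 1" _ R])
      fix x :: "real^'n" and s :: real
      let ?y = "x + s *\<^sub>R axis i 1"
      have y: "?y $ i = x $ i + s" by simp
      have 0: "((\<lambda>s. cutoff R ((norm (x + s *\<^sub>R axis i 1))\<^sup>2)) has_real_derivative
          cutoff1 R ((norm ?y)\<^sup>2) * (2 * ?y $ i)) (at s)"
        using radial_line_derivative[where y = 0 and x = x and s = s and i = i, OF cutoff_derivative[of R]] by (simp add: y)
      have 1: "((\<lambda>s. cutoff1 R ((norm (x + s *\<^sub>R axis i 1))\<^sup>2)) has_real_derivative
          cutoff2 R ((norm ?y)\<^sup>2) * (2 * ?y $ i)) (at s)"
        using radial_line_derivative[where y = 0 and x = x and s = s and i = i, OF cutoff1_derivative[of R]] by (simp add: y)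
      have 2: "((\<lambda>s. 2 * (x + s *\<^sub>R axis i 1) $ i) has_real_derivative 2) (at s)"
        by (auto intro!: derivative_eq_intros)
      have 3: "((\<lambda>s. ?p (x + s *\<^sub>R axis i 1)) has_real_derivative
         (cutoff1 R ((norm ?y)\<^sup>2) * (2 * ?y $ i) * dx i F (t, ?y) + dx i (dx i F) (t, ?y) * cutoff R ((norm ?y)\<^sup>2))
         - (dx i F (t, ?y) * (cutoff1 R ((norm ?y)\<^sup>2) * (2 * ?y $ i))
            + (cutoff2 R ((norm ?y)\<^sup>2) * (2 * ?y $ i) * (2 * ?y $ i) + 2 * cutoff1 R ((norm ?y)\<^sup>2)) * F (t, ?y))) (at s)"
        by (intro DERIV_diff DERIV_mult 0 1 2 dx_line F smooth_dx t)
      have eq: "(c1 * (2 * z) * d + dd * c0) - (d * (c1 * (2 * z)) + (c2 * (2 * z) * (2 * z) + 2 * c1) * f)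
         = c0 * dd - f * (2 * c1 + 4 * z\<^sup>2 * c2)" for c0 c1 c2 z d dd f :: real
        by (simp add: power2_eq_square algebra_simps)
      show "((\<lambda>s. ?p (x + s *\<^sub>R axis i 1)) has_real_derivative ?a i ?y - ?b i ?y) (at s)"
        using 3 unfolding eq .
    next
      show "continuous_on UNIV ?p"
        by (intro continuous_intros cutoff_continuous slice_continuous F smooth_dx t)
      show "continuous_on UNIV (\<lambda>x. ?a i x - ?b i x)" by (intro continuous_on_diff ca cb)
    qed (use out in auto)
    then show ?thesis using ia ib by (simp add: Bochner_Integration.integral_diff)
  qed
  have "(LINT x|lborel. cutoff R ((norm x)\<^sup>2) * lap F (t, x)) = (LINT x|lborel. (\<Sum>i\<in>UNIV. ?a i x))"
    by (simp add: lap_def sum_distrib_left)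
  also have "\<dots> = (\<Sum>i\<in>UNIV. LINT x|lborel. ?a i x)" by (rule Bochner_Integration.integral_sum) (rule ia)
  also have "\<dots> = (\<Sum>i\<in>UNIV. LINT x|lborel. ?b i x)" by (simp add: part)
  also have "\<dots> = (LINT x|lborel. (\<Sum>i\<in>UNIV. ?b i x))"
    by (rule Bochner_Integration.integral_sum[symmetric]) (rule ib)
  finally show ?thesis by (simp add: cutoff_lap_def sum_distrib_left)
qed

section \<open>Upper bounds\<close>

locale positive_fast_diffusion = fast_diffusion_absorption m q C U
  for m q C :: real and U :: "real \<times> (real^'n::finite) \<Rightarrow> real" +
  assumes pos: "t > 0 \<Longrightarrow> U (t, x) > 0"
begin

section \<open>Decay of the \<open>L^r\<close> norms and the bound by the supremum of the initial
  datum\<close>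

lemma pos': "p \<in> half_space \<Longrightarrow> U p > 0"
  using pos by (cases p) auto

lemma smooth_U_powr: "smooth (\<lambda>p. U p powr r)"
  by (rule smooth_powr[OF sU pos'])

text \<open>The absorption is dropped, and \<open>U powr (r - 1)\<close> times the Laplacian of
  \<open>U powr m\<close> is replaced by a single Laplacian, which only enlarges the coefficient of
  the squared gradient, from \<open>m - 1\<close> to \<open>r + m - 2\<close>. In this form both
  derivatives can be thrown onto a cutoff.\<close>

lemma dt_U_powr_le:
  assumes r: "r \<ge> 2" and p: "p \<in> half_space"
  shows "dt (\<lambda>p. U p powr r) p \<le> r * m / (r + m - 1) * lap (\<lambda>p. U p powr (r + m - 1)) p"
proof -
  define G where "G = (\<Sum>i\<in>UNIV. (dx i U p)\<^sup>2)"
  have G: "G \<ge> 0" unfolding G_def by (intro sum_nonneg) simp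
  have Up: "U p > 0" by (rule pos'[OF p])
  have lp: "lap (\<lambda>p. U p powr s) p = s * U p powr (s - 1) * lap U p + s * (s - 1) * U p powr (s - 2) * G" for s
    unfolding G_def by (rule lap_powr[OF sU pos' p])
  have "dt (\<lambda>p. U p powr r) p = r * U p powr (r - 1) * (lap (\<lambda>p. U p powr m) p - U p powr q)"
    using dt_powr[OF sU p Up, of r] eqn[OF p] by simp
  also have "\<dots> \<le> r * U p powr (r - 1) * lap (\<lambda>p. U p powr m) p"
    using r by (intro mult_left_mono) auto
  also have "\<dots> = r * m * (U p powr (r - 1) * U p powr (m - 1)) * lap U p
      + r * m * (m - 1) * (U p powr (r - 1) * U p powr (m - 2)) * G"
    unfolding lp by (simp add: algebra_simps)
  also have "\<dots> = r * m * U p powr (r + m - 2) * lap U p + r * m * (m - 1) * U p powr (r + m - 3) * G"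
    by (simp add: powr_add[symmetric] algebra_simps)
  also have "\<dots> \<le> r * m * U p powr (r + m - 2) * lap U p + r * m * (r + m - 2) * U p powr (r + m - 3) * G"
    using r m0 G by (intro add_left_mono mult_right_mono mult_left_mono) auto
  also have "\<dots> = r * m / (r + m - 1) * lap (\<lambda>p. U p powr (r + m - 1)) p"
  proof -
    define s where "s = r + m - 1"
    have s: "s > 0" using r m0 by (simp add: s_def)
    have e: "r + m - 2 = s - 1" "r + m - 3 = s - 2" by (auto simp: s_def)
    show ?thesis unfolding lp s_def[symmetric] e using s by (simp add: field_simps)
  qed
  finally show ?thesis .
qed

text \<open>After Green's formula the error is at most a multiple of \<open>24 / R\<^sup>2\<close>
  times the integral of \<open>U powr (r + m - 1)\<close>, and boundedness of \<open>U\<close>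
  reduces that integral to the mass.\<close>

lemma cutoff_energy_le:
  assumes r: "r \<ge> 2" and R: "R > 0" and \<tau>: "0 < \<tau>" "\<tau> < t"
    and int: "\<And>s. \<tau> \<le> s \<Longrightarrow> s \<le> t \<Longrightarrow> integrable lborel (\<lambda>x. U (s, x))"
    and mass: "\<And>s. \<tau> \<le> s \<Longrightarrow> s \<le> t \<Longrightarrow> (LINT x|lborel. U (s, x)) \<le> M"
  shows "(LINT x|lborel. cutoff R ((norm x)\<^sup>2) * U (t, x) powr r)
    \<le> (LINT x|lborel. cutoff R ((norm x)\<^sup>2) * U (\<tau>, x) powr r)
      + (t - \<tau>) * (r * m / (r + m - 1) * (24 / R\<^sup>2 * C powr (r + m - 2) * M))"
proof -
  let ?c = "r * m / (r + m - 1)"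
  let ?B = "?c * (24 / R\<^sup>2 * C powr (r + m - 2) * M)"
  have c0: "?c \<ge> 0" using r m0 by simp
  have out: "cutoff R ((norm x)\<^sup>2) = 0" if "norm x > R" for x :: "real^'n"
  proof -
    have "(norm x)\<^sup>2 \<ge> R\<^sup>2" using that R by (intro power_mono) auto
    then show ?thesis by (rule cutoff_outside[OF R])
  qed
  obtain b where "cball (0::real^'n) R \<subseteq> cbox (- b) b"
    using bounded_subset_cbox_symmetric[OF bounded_cball] by blast
  note box = this
  define g where "g s x = cutoff R ((norm x)\<^sup>2) * U (s, x) powr r" for s x
  define g' where "g' s x = cutoff R ((norm x)\<^sup>2) * dt (\<lambda>p. U p powr r) (s, x)" for s x
  have cg: "continuous_on UNIV (g s)" if "s > 0" for s
    unfolding g_def[abs_def]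
    by (intro continuous_intros cutoff_continuous slice_continuous[OF smooth_U_powr that])
  have cg': "continuous_on UNIV (g' s)" if "s > 0" for s
    unfolding g'_def[abs_def]
    by (intro continuous_intros cutoff_continuous slice_continuous[OF smooth_dt[OF smooth_U_powr] that])
  have der: "((\<lambda>s. LINT x|lborel. g s x) has_real_derivative (LINT x|lborel. g' s x)) (at s)" if s: "s > 0" for s
  proof -
    have "((\<lambda>s. integral (cbox (- b) b) (g s)) has_real_derivative integral (cbox (- b) b) (g' s)) (at s within {0<..})"
    proof (rule leibniz_rule_field_derivative)
      show "((\<lambda>s. g s x) has_real_derivative g' s x) (at s within {0<..})" if "s \<in> {0<..}" for s x
        unfolding g_def g'_def using that
        by (intro DERIV_cmult has_field_derivative_at_within[OF dt_line[OF smooth_U_powr]]) auto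
      show "g s integrable_on cbox (- b) b" if "s \<in> {0<..}" for s
        using that by (intro integrable_continuous continuous_on_subset[OF cg]) auto
      have "continuous_on ({0<..} \<times> cbox (- b) b) (dt (\<lambda>p. U p powr r))"
        by (rule continuous_on_subset[OF smooth_on_continuous[OF smooth_dt[OF smooth_U_powr]]]) auto
      then have "continuous_on ({0<..} \<times> cbox (- b) b)
          (\<lambda>p. cutoff R ((norm (snd p))\<^sup>2) * dt (\<lambda>p. U p powr r) p)"
        by (intro continuous_intros cutoff_continuous)
      then show "continuous_on ({0<..} \<times> cbox (- b) b) (\<lambda>(s, x). g' s x)"
        by (simp add: g'_def case_prod_beta')
    qed (use s in auto)
    then have D: "((\<lambda>s. integral (cbox (- b) b) (g s)) has_real_derivative integral (cbox (- b) b) (g' s)) (at s)"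
      unfolding at_within_open[OF greaterThan_iff[THEN iffD2, OF s] open_greaterThan] .
    have E: "integral (cbox (- b) b) (g s) = (LINT x|lborel. g s x)" if "s \<in> {0<..}" for s
      by (rule integral_cbox_compact_support[OF cg _ box]) (use that in \<open>auto simp: g_def out\<close>)
    have E': "integral (cbox (- b) b) (g' s) = (LINT x|lborel. g' s x)"
      by (rule integral_cbox_compact_support[OF cg'[OF s] _ box]) (simp add: g'_def out)
    have "s \<in> {0<..}" using s by simp
    from has_field_derivative_transform_within_open[OF D open_greaterThan this E]
    show ?thesis unfolding E' .
  qed
  have le: "(LINT x|lborel. g' s x) \<le> ?B" if s: "\<tau> \<le> s" "s \<le> t" for s
  proof -
    have s0: "s > 0" using s \<tau> by simp
    let ?P = "\<lambda>p. U p powr (r + m - 1)"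
    have "(LINT x|lborel. g' s x) \<le> (LINT x|lborel. ?c * (cutoff R ((norm x)\<^sup>2) * lap ?P (s, x)))"
    proof (rule integral_mono)
      show "integrable lborel (g' s)"
        by (rule integrable_compact_support[OF cg'[OF s0], of R]) (simp add: g'_def out)
      have "continuous_on UNIV (\<lambda>x. cutoff R ((norm x)\<^sup>2) * lap ?P (s, x))"
        by (intro continuous_intros cutoff_continuous slice_continuous smooth_lap smooth_U_powr s0)
      then show "integrable lborel (\<lambda>x. ?c * (cutoff R ((norm x)\<^sup>2) * lap ?P (s, x)))"
        by (intro integrable_mult_right integrable_compact_support[of _ R]) (simp_all add: out)
      fix x :: "real^'n"
      have "g' s x \<le> cutoff R ((norm x)\<^sup>2) * (?c * lap ?P (s, x))"
        unfolding g'_def using dt_U_powr_le[OF r, of "(s, x)"] s0 cutoff_range[of "(norm x)\<^sup>2" R]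
        by (intro mult_left_mono) auto
      then show "g' s x \<le> ?c * (cutoff R ((norm x)\<^sup>2) * lap ?P (s, x))" by (simp add: mult_ac)
    qed
    also have "\<dots> = ?c * (LINT x|lborel. ?P (s, x) * cutoff_lap R x)"
      by (subst green_cutoff[OF smooth_U_powr s0 R, symmetric]) simp
    also have "\<dots> \<le> ?c * (LINT x|lborel. 24 / R\<^sup>2 * C powr (r + m - 2) * U (s, x))"
    proof (intro mult_left_mono c0 integral_mono)
      have "continuous_on UNIV (\<lambda>x. ?P (s, x) * cutoff_lap R x)"
        unfolding cutoff_lap_def
        by (intro continuous_intros cutoff_continuous slice_continuous[OF smooth_U_powr s0])
      then show "integrable lborel (\<lambda>x. ?P (s, x) * cutoff_lap R x)"
        by (rule integrable_compact_support[of _ R]) (simp add: cutoff_lap_le(2)[OF R])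
      show "integrable lborel (\<lambda>x. 24 / R\<^sup>2 * C powr (r + m - 2) * U (s, x))"
        by (intro integrable_mult_right int s)
      fix x :: "real^'n"
      have "?P (s, x) = U (s, x) powr (r + m - 2) * U (s, x) powr 1"
        by (simp only: powr_add[symmetric]) simp
      also have "\<dots> \<le> C powr (r + m - 2) * U (s, x)"
        using pos[OF s0, of x] bound[OF s0, of x] r m0 by (simp add: powr_mono2)
      finally have "?P (s, x) * (24 / R\<^sup>2) \<le> C powr (r + m - 2) * U (s, x) * (24 / R\<^sup>2)"
        by (rule mult_right_mono) simp
      moreover have "?P (s, x) * cutoff_lap R x \<le> ?P (s, x) * (24 / R\<^sup>2)"
        by (rule mult_left_mono[OF cutoff_lap_le(1)[OF R]]) simp
      ultimately show "?P (s, x) * cutoff_lap R x \<le> 24 / R\<^sup>2 * C powr (r + m - 2) * U (s, x)"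
        by (simp add: mult_ac)
    qed
    also have "\<dots> = ?c * (24 / R\<^sup>2 * C powr (r + m - 2) * (LINT x|lborel. U (s, x)))" by simp
    also have "\<dots> \<le> ?B" using mass[OF s] c0 by (intro mult_left_mono) auto
    finally show ?thesis .
  qed
  obtain s where s: "\<tau> < s" "s < t"
    and "(LINT x|lborel. g t x) - (LINT x|lborel. g \<tau> x) = (t - \<tau>) * (LINT x|lborel. g' s x)"
    using MVT2[OF \<tau>(2), of "\<lambda>s. LINT x|lborel. g s x" "\<lambda>s. LINT x|lborel. g' s x"] der \<tau>(1) by auto
  moreover have "(t - \<tau>) * (LINT x|lborel. g' s x) \<le> (t - \<tau>) * ?B"
    using le[of s] s \<tau> by (intro mult_left_mono) auto
  ultimately show ?thesis by (simp add: g_def)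
qed

text \<open>Letting \<open>R\<close> tend to infinity removes the error. On the left only a ball
  with \<open>U (t, x) \<ge> \<kappa>\<close> is retained; for large \<open>R\<close> it lies in
  \<open>|x| \<le> R / 2\<close>, where the cutoff is at least \<open>(1 / 2) ^ 3\<close>, whence
  the 8. This factor becomes harmless once \<open>r\<close> tends to infinity.\<close>

lemma power_norm_decay:
  assumes r: "r \<ge> 2" and \<tau>: "0 < \<tau>" "\<tau> < t"
    and int: "\<And>s. \<tau> \<le> s \<Longrightarrow> s \<le> t \<Longrightarrow> integrable lborel (\<lambda>x. U (s, x))"
    and mass: "\<And>s. \<tau> \<le> s \<Longrightarrow> s \<le> t \<Longrightarrow> (LINT x|lborel. U (s, x)) \<le> M"
    and ball: "\<rho> > 0" "\<kappa> \<ge> 0" "\<And>x. x \<in> ball x0 \<rho> \<Longrightarrow> \<kappa> \<le> U (t, x)"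
  shows "\<kappa> powr r * measure lborel (ball x0 \<rho>) / 8 \<le> (LINT x|lborel. U (\<tau>, x) powr r)"
proof -
  let ?K = "r * m / (r + m - 1) * (24 * C powr (r + m - 2) * M)"
  have iUr: "integrable lborel (\<lambda>x. U (s, x) powr r)" if s: "\<tau> \<le> s" "s \<le> t" for s
  proof (rule Bochner_Integration.integrable_bound)
    show "integrable lborel (\<lambda>x. C powr (r - 1) * U (s, x))" by (intro integrable_mult_right int s)
    have s0: "s > 0" using s \<tau> by simp
    show "(\<lambda>x. U (s, x) powr r) \<in> borel_measurable lborel"
      using slice_continuous[OF smooth_U_powr s0, of UNIV r] by (simp add: borel_measurable_continuous_onI)
    have "U (s, x) powr r \<le> C powr (r - 1) * U (s, x)" for x
    proof -
      have "U (s, x) powr r = U (s, x) powr (r - 1) * U (s, x) powr 1"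
        by (simp only: powr_add[symmetric]) simp
      then show ?thesis using pos[OF s0, of x] bound[OF s0, of x] r by (simp add: powr_mono2)
    qed
    then show "AE x in lborel. norm (U (s, x) powr r) \<le> norm (C powr (r - 1) * U (s, x))"
      using pos[OF s0] C0 by (intro AE_I2) (simp add: abs_mult less_imp_le)
  qed
  have step: "\<kappa> powr r * measure lborel (ball x0 \<rho>) / 8
      \<le> (LINT x|lborel. U (\<tau>, x) powr r) + (t - \<tau>) * ?K * inverse (R\<^sup>2)"
    if R: "R \<ge> 2 * (norm x0 + \<rho>)" for R
  proof -
    have "norm x0 + \<rho> > 0" using ball(1) by (simp add: add_nonneg_pos)
    then have R0: "R > 0" using R by simp
    have t0: "t > 0" using \<tau> by simp
    have "\<kappa> powr r * measure lborel (ball x0 \<rho>) / 8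
        = (LINT x|lborel. (\<kappa> powr r / 8) * indicator (ball x0 \<rho>) x)" by simp
    also have "\<dots> \<le> (LINT x|lborel. cutoff R ((norm x)\<^sup>2) * U (t, x) powr r)"
    proof (rule integral_mono)
      show "integrable lborel (\<lambda>x. (\<kappa> powr r / 8) * indicator (ball x0 \<rho>) x :: real)"
        by (intro integrable_mult_right integrable_real_indicator) (use emeasure_lborel_ball_finite in auto)
      show "integrable lborel (\<lambda>x. cutoff R ((norm x)\<^sup>2) * U (t, x) powr r)"
      proof (rule Bochner_Integration.integrable_bound[OF iUr[of t]])
        show "(\<lambda>x. cutoff R ((norm x)\<^sup>2) * U (t, x) powr r) \<in> borel_measurable lborel"
        proof -
          have "continuous_on UNIV (\<lambda>x. cutoff R ((norm x)\<^sup>2) * U (t, x) powr r)"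
            by (intro continuous_intros cutoff_continuous slice_continuous[OF smooth_U_powr t0])
          then show ?thesis by (simp add: borel_measurable_continuous_onI)
        qed
        show "AE x in lborel. norm (cutoff R ((norm x)\<^sup>2) * U (t, x) powr r) \<le> norm (U (t, x) powr r)"
          using cutoff_range by (simp add: abs_mult mult_left_le_one_le)
      qed (use \<tau> in auto)
      fix x :: "real^'n"
      show "(\<kappa> powr r / 8) * indicator (ball x0 \<rho>) x \<le> cutoff R ((norm x)\<^sup>2) * U (t, x) powr r"
      proof (cases "x \<in> ball x0 \<rho>")
        case True
        have "norm x \<le> norm x0 + \<rho>"
          using True norm_triangle_sub[of x x0] by (simp add: dist_norm norm_minus_commute)
        then have "norm x \<le> R / 2" using R by simp
        then have "(norm x)\<^sup>2 \<le> (R / 2)\<^sup>2" by (intro power_mono) auto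
        then have "4 * (norm x)\<^sup>2 \<le> R\<^sup>2" by (simp add: power_divide)
        then have "2 * (norm x)\<^sup>2 \<le> R\<^sup>2" using zero_le_power2[of "norm x"] by linarith
        then have "1 / 2 \<le> 1 - (norm x)\<^sup>2 / R\<^sup>2" using R0 by (simp add: field_simps)
        then have "1 / 2 \<le> max 0 (1 - (norm x)\<^sup>2 / R\<^sup>2)" by (rule max.coboundedI2)
        then have "(1 / 2) ^ 3 \<le> cutoff R ((norm x)\<^sup>2)" unfolding cutoff_def by (rule power_mono) simp
        then have c8: "1 / 8 \<le> cutoff R ((norm x)\<^sup>2)" by (simp add: power3_eq_cube)
        have "r \<ge> 0" using r by simp
        from powr_mono2[OF this ball(2) ball(3)[OF True]]
        have "(1 / 8) * \<kappa> powr r \<le> cutoff R ((norm x)\<^sup>2) * U (t, x) powr r"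
          by (rule mult_mono[OF c8]) (use cutoff_range(1) in simp_all)
        then show ?thesis using True by simp
      next
        case False
        then show ?thesis using cutoff_range by simp
      qed
    qed
    also have "\<dots> \<le> (LINT x|lborel. cutoff R ((norm x)\<^sup>2) * U (\<tau>, x) powr r)
      + (t - \<tau>) * (r * m / (r + m - 1) * (24 / R\<^sup>2 * C powr (r + m - 2) * M))"
      by (rule cutoff_energy_le[OF r R0 \<tau> int mass])
    also have "(LINT x|lborel. cutoff R ((norm x)\<^sup>2) * U (\<tau>, x) powr r) \<le> (LINT x|lborel. U (\<tau>, x) powr r)"
    proof (rule integral_mono')
      show "integrable lborel (\<lambda>x. U (\<tau>, x) powr r)" using iUr[of \<tau>] \<tau> by simp
      show "cutoff R ((norm x)\<^sup>2) * U (\<tau>, x) powr r \<le> U (\<tau>, x) powr r" for x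
        by (rule mult_left_le_one_le) (use cutoff_range in simp_all)
    qed simp
    also have "(t - \<tau>) * (r * m / (r + m - 1) * (24 / R\<^sup>2 * C powr (r + m - 2) * M))
        = (t - \<tau>) * ?K * inverse (R\<^sup>2)"
      unfolding divide_inverse by (simp only: mult_ac)
    finally show ?thesis by simp
  qed
  have lim: "((\<lambda>R. (LINT x|lborel. U (\<tau>, x) powr r) + (t - \<tau>) * ?K * inverse (R\<^sup>2))
      \<longlongrightarrow> (LINT x|lborel. U (\<tau>, x) powr r) + (t - \<tau>) * ?K * 0) at_top"
    by (intro tendsto_intros tendsto_inverse_0_at_top filterlim_pow_at_top filterlim_ident) auto
  have ev: "\<forall>\<^sub>F R in at_top. \<kappa> powr r * measure lborel (ball x0 \<rho>) / 8
      \<le> (LINT x|lborel. U (\<tau>, x) powr r) + (t - \<tau>) * ?K * inverse (R\<^sup>2)"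
    using eventually_ge_at_top[of "2 * (norm x0 + \<rho>)"] by eventually_elim (rule step)
  show ?thesis using tendsto_lowerbound[OF lim ev trivial_limit_at_top_linorder] by simp
qed

end

text \<open>Mean value theorem; for \<open>a \<le> b\<close> the left side is not positive. Hence
  only \<open>a\<close> has to be bounded by \<open>B\<close>, which matters because
  \<open>b\<close> will be a value of the initial datum and \<open>B\<close> the bound on the
  solution.\<close>

lemma powr_diff_le:
  fixes a b B r :: real
  assumes "0 \<le> a" "a \<le> B" "0 \<le> b" "r \<ge> 1"
  shows "a powr r - b powr r \<le> r * B powr (r - 1) * \<bar>a - b\<bar>"
proof (cases "a \<le> b")
  case True
  have "a powr r \<le> b powr r" using True assms by (intro powr_mono2) auto
  moreover have "0 \<le> r * B powr (r - 1) * \<bar>a - b\<bar>" using assms by simp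
  ultimately show ?thesis by linarith
next
  case ab: False
  show ?thesis
  proof (cases "b = 0")
    case True
    have a: "a > 0" using ab True by simp
    have "a powr r = a powr (r - 1) * a powr 1" by (simp only: powr_add[symmetric]) simp
    also have "\<dots> \<le> B powr (r - 1) * a" using a assms by (simp add: powr_mono2)
    also have "\<dots> \<le> r * (B powr (r - 1) * a)" using a assms(4) mult_right_mono[of 1 r "B powr (r - 1) * a"] by simp
    finally show ?thesis using True a by (simp add: mult.assoc)
  next
    case False
    then have b: "b > 0" using assms(3) by simp
    have "((\<lambda>z. z powr r) has_real_derivative r * z powr (r - 1)) (at z)" if "b \<le> z" for z
      using has_real_derivative_powr[of z r] that b by simp
    then obtain z where z: "b < z" "z < a" "a powr r - b powr r = (a - b) * (r * z powr (r - 1))"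
      using MVT2[of b a "\<lambda>z. z powr r" "\<lambda>z. r * z powr (r - 1)"] ab by auto
    have "z powr (r - 1) \<le> B powr (r - 1)" using z b assms by (intro powr_mono2) auto
    then have "(a - b) * (r * z powr (r - 1)) \<le> (a - b) * (r * B powr (r - 1))"
      using ab assms(4) by (intro mult_left_mono) auto
    then show ?thesis using z(3) ab by (simp add: mult_ac)
  qed
qed

context positive_fast_diffusion
begin

text \<open>The starting time of the decay estimate tends to 0. Pointwise, \<open>U powr r\<close>
  is at most \<open>K powr (r - 1) * u0\<close> plus a multiple of the distance of \<open>U\<close>
  to \<open>u0\<close>, so convergence in \<open>L^1\<close> is enough.\<close>

lemma power_norm_le_initial:
  assumes r: "r \<ge> 2" and t: "t > 0"
    and int: "\<And>s. s > 0 \<Longrightarrow> integrable lborel (\<lambda>x. U (s, x))"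
    and mass: "\<And>s. 0 < s \<Longrightarrow> s \<le> t \<Longrightarrow> (LINT x|lborel. U (s, x)) \<le> M"
    and u0: "integrable lborel u0" "AE x in lborel. 0 \<le> u0 x" "AE x in lborel. u0 x \<le> K" and K: "K > 0"
    and lim: "((\<lambda>s. LINT x|lborel. \<bar>U (s, x) - u0 x\<bar>) \<longlongrightarrow> 0) (at_right 0)"
    and ball: "\<rho> > 0" "\<kappa> \<ge> 0" "\<And>x. x \<in> ball x0 \<rho> \<Longrightarrow> \<kappa> \<le> U (t, x)"
  shows "\<kappa> powr r * measure lborel (ball x0 \<rho>) / 8 \<le> K powr (r - 1) * (LINT x|lborel. u0 x)"
proof -
  have step: "\<kappa> powr r * measure lborel (ball x0 \<rho>) / 8
     \<le> K powr (r - 1) * (LINT x|lborel. u0 x) + r * C powr (r - 1) * (LINT x|lborel. \<bar>U (s, x) - u0 x\<bar>)"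
    if s: "0 < s" "s < t" for s
  proof -
    have "\<kappa> powr r * measure lborel (ball x0 \<rho>) / 8 \<le> (LINT x|lborel. U (s, x) powr r)"
      by (rule power_norm_decay[OF r s _ _ ball, of M]) (use int mass s in auto)
    also have "\<dots> \<le> (LINT x|lborel. K powr (r - 1) * u0 x + r * C powr (r - 1) * \<bar>U (s, x) - u0 x\<bar>)"
    proof (rule integral_mono_AE')
      show "integrable lborel (\<lambda>x. K powr (r - 1) * u0 x + r * C powr (r - 1) * \<bar>U (s, x) - u0 x\<bar>)"
        by (intro Bochner_Integration.integrable_add integrable_mult_right integrable_abs
            Bochner_Integration.integrable_diff int s u0)
      show "AE x in lborel. U (s, x) powr r \<le> K powr (r - 1) * u0 x + r * C powr (r - 1) * \<bar>U (s, x) - u0 x\<bar>"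
        using u0(2,3)
      proof eventually_elim
        case (elim x)
        have "U (s, x) powr r - u0 x powr r \<le> r * C powr (r - 1) * \<bar>U (s, x) - u0 x\<bar>"
          using nonneg bound s elim r by (intro powr_diff_le) auto
        moreover have "u0 x powr r = u0 x powr (r - 1) * u0 x powr 1" by (simp only: powr_add[symmetric]) simp
        moreover have "u0 x powr (r - 1) * u0 x powr 1 \<le> K powr (r - 1) * u0 x"
          using elim r by (simp add: mult_right_mono powr_mono2)
        ultimately show ?case by linarith
      qed
      show "AE x in lborel. 0 \<le> K powr (r - 1) * u0 x + r * C powr (r - 1) * \<bar>U (s, x) - u0 x\<bar>"
        using u0(2) by eventually_elim (use r in simp)
    qed
    also have "\<dots> = K powr (r - 1) * (LINT x|lborel. u0 x) + r * C powr (r - 1) * (LINT x|lborel. \<bar>U (s, x) - u0 x\<bar>)"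
      using int[OF s(1)] u0(1) by (subst Bochner_Integration.integral_add) auto
    finally show ?thesis .
  qed
  have lim': "((\<lambda>s. K powr (r - 1) * (LINT x|lborel. u0 x) + r * C powr (r - 1) * (LINT x|lborel. \<bar>U (s, x) - u0 x\<bar>))
      \<longlongrightarrow> K powr (r - 1) * (LINT x|lborel. u0 x) + r * C powr (r - 1) * 0) (at_right 0)"
    by (intro tendsto_intros lim)
  have ev: "\<forall>\<^sub>F s in at_right 0. \<kappa> powr r * measure lborel (ball x0 \<rho>) / 8
     \<le> K powr (r - 1) * (LINT x|lborel. u0 x) + r * C powr (r - 1) * (LINT x|lborel. \<bar>U (s, x) - u0 x\<bar>)"
    using eventually_at_right_real[OF t] by eventually_elim (use step in auto)
  show ?thesis using tendsto_lowerbound[OF lim' ev] by simp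
qed

text \<open>If \<open>U (t, x0) > K\<close>, then \<open>U\<close> exceeds some
  \<open>\<kappa> > K\<close> on a ball at time \<open>t\<close>, while the \<open>L^r\<close>
  estimate keeps \<open>(\<kappa> / K) powr r\<close> bounded as \<open>r\<close> grows.\<close>

lemma sup_bound:
  assumes t: "t > 0"
    and int: "\<And>s. s > 0 \<Longrightarrow> integrable lborel (\<lambda>x. U (s, x))"
    and mass: "\<And>s. 0 < s \<Longrightarrow> s \<le> t \<Longrightarrow> (LINT x|lborel. U (s, x)) \<le> M"
    and u0: "integrable lborel u0" "AE x in lborel. 0 \<le> u0 x" "AE x in lborel. u0 x \<le> K" and K: "K > 0"
    and lim: "((\<lambda>s. LINT x|lborel. \<bar>U (s, x) - u0 x\<bar>) \<longlongrightarrow> 0) (at_right 0)"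
  shows "U (t, x0) \<le> K"
proof (rule ccontr)
  assume "\<not> U (t, x0) \<le> K"
  define \<kappa> where "\<kappa> = (K + U (t, x0)) / 2"
  have \<kappa>: "K < \<kappa>" "\<kappa> < U (t, x0)" using \<open>\<not> U (t, x0) \<le> K\<close> by (auto simp: \<kappa>_def)
  have "open {x. \<kappa> < U (t, x)}"
    by (intro open_Collect_less continuous_intros slice_continuous sU t)
  then obtain \<rho> where \<rho>: "\<rho> > 0" "ball x0 \<rho> \<subseteq> {x. \<kappa> < U (t, x)}"
    using \<kappa>(2) openE by blast
  define V where "V = measure lborel (ball x0 \<rho>)"
  have V: "V > 0" unfolding V_def by (rule content_ball_pos[OF \<rho>(1)])
  define I where "I = (LINT x|lborel. u0 x)"
  have main: "(\<kappa> / K) powr r \<le> 8 * I / (K * V)" if r: "r \<ge> 2" for r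
  proof -
    have "\<kappa> powr r * V / 8 \<le> K powr (r - 1) * I"
      unfolding V_def I_def
      by (rule power_norm_le_initial[OF r t int mass u0 K lim \<rho>(1)]) (use \<kappa> K \<rho>(2) in auto)
    also have "K powr (r - 1) = K powr r / K" using K by (simp add: powr_diff)
    finally have "\<kappa> powr r \<le> K powr r * (8 * I / (K * V))" using K V by (simp add: field_simps)
    then show ?thesis using K \<kappa> by (simp add: powr_divide divide_le_eq mult.commute)
  qed
  have "\<kappa> / K > 1" using \<kappa> K by simp
  then obtain n where n: "8 * I / (K * V) < (\<kappa> / K) ^ n" using real_arch_pow by blast
  \<comment> \<open>The estimate \<open>main\<close> requires an exponent of at least 2.\<close>
  also have "\<dots> \<le> (\<kappa> / K) ^ (n + 2)" using \<open>\<kappa> / K > 1\<close> by (intro power_increasing) auto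
  also have "\<dots> = (\<kappa> / K) powr real (n + 2)" using \<kappa> K by (subst powr_realpow) auto
  also have "\<dots> \<le> 8 * I / (K * V)" by (rule main) simp
  finally show False by simp
qed

section \<open>Comparison with the spatially constant solution\<close>

text \<open>\<open>A s powr (- 1 / (q - 1))\<close> is the solution \<open>W\<close> of the ordinary
  differential equation with value \<open>K\<close> at time \<open>\<tau>\<close>. The term
  \<open>\<delta> |x|^2\<close> confines the contact to a ball, and its Laplacian is paid for by the
  growth in time. At a contact \<open>U > W t0 \<ge> W T\<close>, so the coefficient
  \<open>m U powr (m - 1)\<close>, singular at 0, is bounded there; this fixes the rate, and the
  added 1 gives the contradiction.\<close>

lemma ode_barrier:
  fixes K \<tau> T \<delta> :: real
  defines "A \<equiv> \<lambda>s. K powr (1 - q) + (q - 1) * (s - \<tau>)"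
  assumes K: "K > 0" "\<And>t x. t > 0 \<Longrightarrow> U (t, x) \<le> K" and \<tau>: "0 < \<tau>" "\<tau> < T" and \<delta>: "\<delta> > 0"
  shows "w (T, x) \<le> A T powr (- m / (q - 1))
    + \<delta> * (1 + (2 * real CARD('n) * m * (A T powr (- 1 / (q - 1))) powr (m - 1) + 1) * (T - \<tau>) + (norm x)\<^sup>2)"
proof (rule ccontr)
  assume neg: "\<not> ?thesis"
  define rate where "rate = 2 * real CARD('n) * m * (A T powr (- 1 / (q - 1))) powr (m - 1) + 1"
  have rate: "rate > 0" using m0 by (simp add: rate_def add_nonneg_pos)
  define W where "W s = A s powr (- 1 / (q - 1))" for s
  \<comment> \<open>The sign is reversed since contact from above is treated as contact of
    \<open>- w\<close> from below.\<close>
  define \<beta> where "\<beta> s r = - (A s powr (- m / (q - 1)) + \<delta> * (1 + rate * (s - \<tau>) + r))" for s r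
  define f where "f p = w p + \<beta> (fst p) ((norm (snd p))\<^sup>2)" for p :: "real \<times> (real^'n)"
  have A0: "A s > 0" if "s \<ge> \<tau>" for s using that K(1) q1 by (simp add: A_def add_pos_nonneg)
  have W0: "W s > 0" if "s \<ge> \<tau>" for s using A0[OF that] by (simp add: W_def)
  have WA: "W s powr m = A s powr (- m / (q - 1))" for s by (simp add: W_def powr_powr)
  define R where "R = sqrt (C powr m / \<delta>)"
  define X where "X = {\<tau>..T} \<times> cball (0::real^'n) R"
  have XH: "X \<subseteq> half_space" using \<tau> by (auto simp: X_def)
  have cf: "continuous_on X f"
    unfolding f_def \<beta>_def A_def
    by (intro continuous_intros continuous_w XH) (use A0 in \<open>auto simp: X_def A_def less_imp_neq[symmetric]\<close>)
  have inX: "(s, y) \<in> X" if "\<tau> \<le> s" "s \<le> T" "f (s, y) \<ge> 0" for s y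
  proof -
    have "w (s, y) \<le> C powr m"
      unfolding w_def using that \<tau> nonneg bound m0 by (intro powr_mono2) auto
    moreover have "0 \<le> A s powr (- m / (q - 1))" "0 \<le> rate * (s - \<tau>)" using rate that by auto
    moreover have "\<delta> * (1 + rate * (s - \<tau>) + (norm y)\<^sup>2) = \<delta> + \<delta> * (rate * (s - \<tau>)) + \<delta> * (norm y)\<^sup>2"
      by (simp add: algebra_simps)
    moreover have "0 \<le> \<delta> * (rate * (s - \<tau>))" using \<delta> rate that by simp
    moreover have "A s powr (- m / (q - 1)) + \<delta> * (1 + rate * (s - \<tau>) + (norm y)\<^sup>2) \<le> w (s, y)"
      using that(3) by (simp add: f_def \<beta>_def)
    ultimately have "\<delta> * (norm y)\<^sup>2 \<le> C powr m" using \<delta> by linarith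
    then have "(norm y)\<^sup>2 \<le> C powr m / \<delta>" using \<delta> by (simp add: field_simps)
    then have "norm y \<le> R" unfolding R_def by (rule real_le_rsqrt)
    then show ?thesis using that by (simp add: X_def)
  qed
  have fT: "f (T, x) > 0" using neg by (simp add: f_def \<beta>_def rate_def)
  then have "(T, x) \<in> X" using \<tau> by (intro inX) auto
  have "compact X" unfolding X_def by (intro compact_Times) auto
  then obtain p0 where p0: "p0 \<in> X" "\<And>p. p \<in> X \<Longrightarrow> f p \<le> f p0"
    using continuous_attains_sup[of X f] cf \<open>(T, x) \<in> X\<close> by blast
  obtain t0 x0 where p0_eq: "p0 = (t0, x0)" by (cases p0)
  have f0: "f (t0, x0) > 0" using p0(2)[OF \<open>(T, x) \<in> X\<close>] fT p0_eq by simp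
  have K0: "\<tau> \<le> t0" "t0 \<le> T" using p0(1) by (auto simp: X_def p0_eq)
  have t0: "t0 > 0" using K0 \<tau> by simp
  define r where "r = (norm x0)\<^sup>2"
  have gt: "w (t0, x0) > W t0 powr m"
  proof -
    have "0 < 1 + rate * (t0 - \<tau>) + r" using rate K0 by (simp add: r_def add_pos_nonneg)
    then have "0 < \<delta> * (1 + rate * (t0 - \<tau>) + r)" using \<delta> by simp
    then show ?thesis using f0 by (simp add: f_def \<beta>_def WA r_def)
  qed
  have UW: "U (t0, x0) > W t0"
  proof (rule ccontr)
    assume "\<not> ?thesis"
    then have "w (t0, x0) \<le> W t0 powr m" unfolding w_def using nonneg[OF t0] m0 by (intro powr_mono2) auto
    then show False using gt by simp
  qed
  have \<tau>t0: "\<tau> < t0"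
  proof (rule ccontr)
    assume "\<not> ?thesis"
    then have "t0 = \<tau>" using K0 by simp
    moreover have "(1 - q) * (- 1 / (q - 1)) = 1" using q1 by (simp add: field_simps)
    ultimately have "W t0 = K" using K(1) by (simp add: W_def A_def powr_powr)
    then show False using UW K(2)[OF t0, of x0] by simp
  qed
  have b1: "\<forall>\<^sub>F r' in nhds r. (\<beta> t0 has_real_derivative (\<lambda>r. - \<delta>) r') (at r')"
    unfolding \<beta>_def by (intro always_eventually allI) (auto intro!: derivative_eq_intros)
  have b2: "((\<lambda>r. - \<delta>) has_real_derivative 0) (at r)" by simp
  have bt: "((\<lambda>t. \<beta> t r) has_real_derivative (m * W t0 powr (m + q - 1) - \<delta> * rate)) (at t0)"
  proof -
    have dA: "(A has_real_derivative (q - 1)) (at t0)"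
      unfolding A_def by (auto intro!: derivative_eq_intros)
    have "((\<lambda>t. A t powr (- m / (q - 1))) has_real_derivative
        (- m / (q - 1)) * A t0 powr (- m / (q - 1) - 1) * (q - 1)) (at t0)"
      using DERIV_chain2[OF has_real_derivative_powr[OF A0[OF K0(1)], of "- m / (q - 1)"] dA] .
    moreover have "A t0 powr (- m / (q - 1) - 1) = W t0 powr (m + q - 1)"
    proof -
      have "- m / (q - 1) - 1 = - 1 / (q - 1) * (m + q - 1)" using q1 by (simp add: field_simps)
      then show ?thesis by (simp add: W_def powr_powr)
    qed
    moreover have "(- m / (q - 1)) * Z * (q - 1) = - m * Z" for Z using q1 by simp
    ultimately have P: "((\<lambda>t. A t powr (- m / (q - 1))) has_real_derivative - m * W t0 powr (m + q - 1)) (at t0)"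
      by simp
    have Q: "((\<lambda>t. \<delta> * (1 + rate * (t - \<tau>) + r)) has_real_derivative \<delta> * rate) (at t0)"
      by (auto intro!: derivative_eq_intros)
    from DERIV_minus[OF DERIV_add[OF P Q]] show ?thesis unfolding \<beta>_def by simp
  qed
  have smw: "smooth (\<lambda>p. - w p)" by (rule smooth_uminus[OF sw])
  have "\<forall>\<^sub>F p in nhds (t0, x0). p \<in> {\<tau><..} \<times> UNIV"
    using \<tau>t0 by (intro eventually_nhds_in_open open_Times) auto
  then have min: "\<forall>\<^sub>F p in nhds (t0, x0). fst p \<le> t0 \<longrightarrow>
      - w (t0, x0) - \<beta> t0 r \<le> - w p - \<beta> (fst p) ((norm (snd p - 0))\<^sup>2)"
  proof eventually_elim
    case (elim p)
    have "f p \<le> f (t0, x0)" if "fst p \<le> t0"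
    proof (cases "f p \<ge> 0")
      case True
      have "(fst p, snd p) \<in> X" by (rule inX) (use elim that K0 True in auto)
      then show ?thesis using p0(2)[of p] by (simp add: p0_eq)
    qed (use f0 in auto)
    then show ?case by (auto simp: f_def r_def)
  qed
  have rr: "(norm (x0 - 0))\<^sup>2 = r" by (simp add: r_def)
  note touch = touching_below[OF smw t0, of \<beta> _ x0 0, unfolded rr, OF b1 b2 bt min]
  have th: "(t0, x0) \<in> half_space" using t0 by simp
  have dw: "- dt w (t0, x0) \<le> m * W t0 powr (m + q - 1) - \<delta> * rate"
    using touch(1) dt_uminus[OF sw th] by simp
  have lw: "lap w (t0, x0) \<le> 2 * real CARD('n) * \<delta>"
    using touch(3) lap_uminus[OF sw th] by simp
  have Up: "U (t0, x0) > 0" by (rule pos[OF t0])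
  have "dt w (t0, x0) = m * U (t0, x0) powr (m - 1) * dt U (t0, x0)"
    unfolding w_def[abs_def] by (rule dt_powr[OF sU th Up])
  also have "\<dots> = m * U (t0, x0) powr (m - 1) * (lap w (t0, x0) - U (t0, x0) powr q)"
    using lap_w[OF t0, of x0] by simp
  also have "\<dots> \<le> m * U (t0, x0) powr (m - 1) * (2 * real CARD('n) * \<delta> - U (t0, x0) powr q)"
    using lw m0 by (intro mult_left_mono) auto
  also have "\<dots> = 2 * real CARD('n) * m * \<delta> * U (t0, x0) powr (m - 1) - m * U (t0, x0) powr (m + q - 1)"
  proof -
    have "U (t0, x0) powr (m - 1) * U (t0, x0) powr q = U (t0, x0) powr (m + q - 1)"
      by (simp add: powr_add[symmetric] algebra_simps)
    then show ?thesis by (simp add: algebra_simps)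
  qed
  also have "\<dots> \<le> 2 * real CARD('n) * m * \<delta> * W T powr (m - 1) - m * W t0 powr (m + q - 1)"
  proof (intro diff_mono mult_left_mono)
    have "A t0 \<le> A T" using K0 q1 by (simp add: A_def)
    then have "W T \<le> W t0"
      unfolding W_def using A0[OF K0(1)] q1 by (intro powr_mono2') auto
    then show "U (t0, x0) powr (m - 1) \<le> W T powr (m - 1)"
      using UW W0[of T] \<tau> m1 by (intro powr_mono2') auto
    show "W t0 powr (m + q - 1) \<le> U (t0, x0) powr (m + q - 1)"
      using UW W0[OF K0(1)] q1 m0 by (intro powr_mono2) auto
  qed (use m0 \<delta> in auto)
  finally have "\<delta> * rate \<le> \<delta> * (2 * real CARD('n) * m * W T powr (m - 1))" using dw by (simp add: mult_ac)
  then have "rate \<le> 2 * real CARD('n) * m * W T powr (m - 1)" using \<delta> by simp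
  then show False by (simp add: rate_def W_def)
qed

lemma absorption_bound:
  assumes K: "K > 0" "\<And>t x. t > 0 \<Longrightarrow> U (t, x) \<le> K" and T: "T > 0"
  shows "U (T, x) \<le> (K powr (1 - q) + (q - 1) * T) powr (- 1 / (q - 1))"
proof -
  let ?A = "\<lambda>\<tau>. K powr (1 - q) + (q - 1) * (T - \<tau>)"
  have step: "U (T, x) \<le> ?A \<tau> powr (- 1 / (q - 1))" if \<tau>: "0 < \<tau>" "\<tau> < T" for \<tau>
  proof -
    let ?D = "1 + (2 * real CARD('n) * m * (?A \<tau> powr (- 1 / (q - 1))) powr (m - 1) + 1) * (T - \<tau>) + (norm x)\<^sup>2"
    have D: "?D > 0" using \<tau> m0 by (simp add: add_pos_nonneg)
    have "w (T, x) \<le> ?A \<tau> powr (- m / (q - 1))"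
    proof (rule field_le_epsilon)
      fix e :: real assume "e > 0"
      then show "w (T, x) \<le> ?A \<tau> powr (- m / (q - 1)) + e"
        using ode_barrier[OF K \<tau>, of "e / ?D" x] D by simp
    qed
    then have "w (T, x) powr (1 / m) \<le> (?A \<tau> powr (- m / (q - 1))) powr (1 / m)"
      using m0 w_nonneg by (intro powr_mono2) auto
    then show ?thesis using U_eq[OF T, of x] m0 by (simp add: powr_powr)
  qed
  have lim: "((\<lambda>\<tau>. ?A \<tau> powr (- 1 / (q - 1))) \<longlongrightarrow> ?A 0 powr (- 1 / (q - 1))) (at_right 0)"
  proof (rule tendsto_powr)
    have "0 < K powr (1 - q) + (q - 1) * (T - 0)" using K(1) T q1 by (simp add: add_pos_pos)
    then show "K powr (1 - q) + (q - 1) * (T - 0) \<noteq> 0" by simp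
  qed (intro tendsto_intros)+
  have ev: "\<forall>\<^sub>F \<tau> in at_right 0. U (T, x) \<le> ?A \<tau> powr (- 1 / (q - 1))"
    using eventually_at_right_real[OF T] by eventually_elim (use step in auto)
  show ?thesis using tendsto_lowerbound[OF lim ev] by simp
qed

end

section \<open>The gradient estimate\<close>

lemma has_derivative_neg_inverse_square:
  fixes f :: "real \<Rightarrow> real"
  assumes f: "(f has_real_derivative d) (at r)" and r: "f r \<noteq> 0"
  shows "((\<lambda>r. - (Z / (f r)\<^sup>2)) has_real_derivative 2 * Z * d / (f r) ^ 3) (at r)"
proof -
  have "((\<lambda>r. (f r)\<^sup>2) has_real_derivative 2 * f r * d) (at r)"
    using DERIV_power[OF f, of 2] by (simp add: mult_ac)
  from DERIV_minus[OF DERIV_divide[OF DERIV_const this, of Z]] r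
  have "((\<lambda>r. - (Z / (f r)\<^sup>2)) has_real_derivative
      - ((0 * (f r)\<^sup>2 - Z * (2 * f r * d)) / ((f r)\<^sup>2 * (f r)\<^sup>2))) (at r)" by simp
  moreover have "- ((0 * Y\<^sup>2 - Z * (2 * Y * d)) / (Y\<^sup>2 * Y\<^sup>2)) = 2 * Z * d / Y ^ 3" if "Y \<noteq> 0" for Y
    using that by (simp add: field_simps power2_eq_square power3_eq_cube)
  ultimately show ?thesis using r by simp
qed

lemma has_derivative_inverse_cube:
  fixes f :: "real \<Rightarrow> real"
  assumes f: "(f has_real_derivative d) (at r)" and r: "f r \<noteq> 0" "1 + r > 0"
  shows "((\<lambda>r. c / ((1 + r) * (f r) ^ 3)) has_real_derivative
      - c / ((1 + r)\<^sup>2 * (f r) ^ 3) - 3 * c * d / ((1 + r) * (f r) ^ 4)) (at r)"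
proof -
  have "((\<lambda>r. (f r) ^ 3) has_real_derivative 3 * (f r)\<^sup>2 * d) (at r)"
    using DERIV_power[OF f, of 3] by (simp add: mult_ac)
  from DERIV_mult[OF DERIV_add[OF DERIV_const DERIV_ident] this, of 1]
  have "((\<lambda>r. (1 + r) * (f r) ^ 3) has_real_derivative (f r) ^ 3 + 3 * (f r)\<^sup>2 * d * (1 + r)) (at r)"
    by simp
  from DERIV_divide[OF DERIV_const this, of c] r
  have "((\<lambda>r. c / ((1 + r) * (f r) ^ 3)) has_real_derivative
      (0 * ((1 + r) * (f r) ^ 3) - c * ((f r) ^ 3 + 3 * (f r)\<^sup>2 * d * (1 + r)))
        / (((1 + r) * (f r) ^ 3) * ((1 + r) * (f r) ^ 3))) (at r)" by simp
  moreover have "(0 * (e * Y ^ 3) - c * (Y ^ 3 + 3 * Y\<^sup>2 * d * e)) / ((e * Y ^ 3) * (e * Y ^ 3))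
      = - c / (e\<^sup>2 * Y ^ 3) - 3 * c * d / (e * Y ^ 4)" if "Y \<noteq> 0" "e > 0" for Y e :: real
  proof -
    have "(0 * (e * Y ^ 3) - c * (Y ^ 3 + 3 * Y\<^sup>2 * d * e)) / ((e * Y ^ 3) * (e * Y ^ 3))
       = - (c * Y ^ 3) / ((e * Y ^ 3) * (e * Y ^ 3)) - 3 * c * d * (e * Y\<^sup>2) / ((e * Y ^ 3) * (e * Y ^ 3))"
    proof -
      have "(0 * a - c * (b + 3 * g * d * e)) / D = - (c * b) / D - 3 * c * d * (e * g) / D" for a b g D :: real
        by (simp add: diff_divide_distrib add_divide_distrib algebra_simps)
      then show ?thesis .
    qed
    also have "- (c * Y ^ 3) / ((e * Y ^ 3) * (e * Y ^ 3)) = - c / (e\<^sup>2 * Y ^ 3)"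
      using that by (simp add: power2_eq_square)
    also have "3 * c * d * (e * Y\<^sup>2) / ((e * Y ^ 3) * (e * Y ^ 3)) = 3 * c * d / (e * Y ^ 4)"
      using that by (simp add: power2_eq_square power3_eq_cube power4_eq_xxxx mult_ac)
    finally show ?thesis .
  qed
  ultimately show ?thesis using r by simp
qed

section \<open>The equation for \<open>v\<close> and the inequality for its squared gradient\<close>

context positive_fast_diffusion
begin

text \<open>\<open>v\<^sup>2 = U powr (m - 1)\<close> is, up to a constant, the pressure, which is
  quadratic in \<open>x\<close> for Barenblatt solutions.\<close>

definition v where "v p = U p powr ((m - 1) / 2)"

definition z where "z p = (\<Sum>j\<in>UNIV. (dx j v p)\<^sup>2)"

definition beta0 where "beta0 = (1 - m) / (2 * m * (m * real CARD('n) - real CARD('n) + 2))"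

text \<open>The coefficient in the equation for \<open>v\<close> of the term \<open>- v z\<close>;
  the chain rule produces it as \<open>m (b + 1)\<close> with
  \<open>b = 2 m / (1 - m)\<close>.\<close>

definition a where "a = m * (1 + m) / (1 - m)"

lemma sv: "smooth v"
  unfolding v_def[abs_def] by (rule smooth_U_powr)

lemma sz: "smooth z"
  unfolding z_def[abs_def] by (intro smooth_sum smooth_power2 smooth_dx sv) simp

lemma v_pos: "p \<in> half_space \<Longrightarrow> v p > 0"
  using pos'[of p] by (simp add: v_def)

lemma beta0_pos: "beta0 > 0"
proof -
  have "m * real CARD('n) - real CARD('n) + 2 > 0" using mc by (simp add: algebra_simps)
  then show ?thesis using m0 m1 by (simp add: beta0_def)
qed

lemma U_powr_v: "p \<in> half_space \<Longrightarrow> U p powr s = v p powr (- 2 / (1 - m) * s)"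
proof -
  assume p: "p \<in> half_space"
  have "(m - 1) / 2 * (- 2 / (1 - m) * s) = s" using m1 by (simp add: field_simps)
  then show ?thesis by (simp only: v_def powr_powr)
qed

lemma v_equation:
  assumes p: "p \<in> half_space"
  shows "dt v p = m * (v p)\<^sup>2 * lap v p - a * v p * z p
    + (1 - m) / 2 * v p powr ((3 - m - 2 * q) / (1 - m))"
proof -
  \<comment> \<open>\<open>U = v powr (- \<kappa>)\<close> and
    \<open>U powr m = v powr (- b)\<close>; the relation \<open>\<kappa> - b = 2\<close> is the
    origin of the factor \<open>v\<^sup>2\<close> in front of the Laplacian.\<close>
  define \<kappa> where "\<kappa> = 2 / (1 - m)"
  define b where "b = \<kappa> * m"
  have k0: "\<kappa> > 0" using m1 by (simp add: \<kappa>_def)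
  have V: "v p > 0" by (rule v_pos[OF p])
  have "dt U p = dt (\<lambda>p. v p powr (- \<kappa>)) p"
  proof (rule dt_cong[OF _ p])
    fix p :: "real \<times> (real^'n)" assume p: "p \<in> half_space"
    show "U p = v p powr (- \<kappa>)" using U_powr_v[OF p, of 1] pos'[OF p] by (simp add: \<kappa>_def)
  qed
  then have 1: "dt U p = - \<kappa> * v p powr (- \<kappa> - 1) * dt v p"
    using dt_powr[OF sv p V, of "- \<kappa>"] by simp
  have "lap (\<lambda>p. U p powr m) p = lap (\<lambda>p. v p powr (- b)) p"
  proof (rule lap_cong[OF _ p])
    fix p :: "real \<times> (real^'n)" assume p: "p \<in> half_space"
    show "U p powr m = v p powr (- b)" using U_powr_v[OF p, of m] by (simp add: \<kappa>_def b_def)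
  qed
  then have 2: "lap (\<lambda>p. U p powr m) p
     = - b * v p powr (- b - 1) * lap v p + b * (b + 1) * v p powr (- b - 2) * z p"
    using lap_powr[OF sv v_pos p, of "- b"] by (simp add: z_def algebra_simps)
  have 3: "U p powr q = v p powr (- \<kappa> * q)" using U_powr_v[OF p, of q] by (simp add: \<kappa>_def)
  have P: "v p powr (\<kappa> + 1) * v p powr s = v p powr (\<kappa> + 1 + s)" for s by (simp add: powr_add)
  have km: "\<kappa> * (1 - m) = 2"
    unfolding \<kappa>_def by (rule nonzero_eq_divide_eq[THEN iffD1, OF _ refl]) (use m1 in simp)
  then have "\<kappa> - b = 2" by (simp add: b_def algebra_simps)
  then have kb: "\<kappa> + 1 + (- b - 1) = 2" "\<kappa> + 1 + (- b - 2) = 1" "\<kappa> + 1 + (- \<kappa> - 1) = 0"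
    by auto
  have "(\<kappa> + 1 + - \<kappa> * q) * (1 - m) = \<kappa> * (1 - m) + (1 - m) - \<kappa> * (1 - m) * q"
    by (simp add: algebra_simps)
  then have "(\<kappa> + 1 + - \<kappa> * q) * (1 - m) = 3 - m - 2 * q" unfolding km by simp
  then have kb4: "\<kappa> + 1 + - \<kappa> * q = (3 - m - 2 * q) / (1 - m)"
    using m1 by (simp add: eq_divide_eq)
  have "v p powr (\<kappa> + 1) * dt U p = v p powr (\<kappa> + 1) * (lap (\<lambda>p. U p powr m) p - U p powr q)"
    using eqn[OF p] by simp
  then have "- \<kappa> * (v p powr (\<kappa> + 1) * v p powr (- \<kappa> - 1)) * dt v p
      = - b * (v p powr (\<kappa> + 1) * v p powr (- b - 1)) * lap v p
        + b * (b + 1) * (v p powr (\<kappa> + 1) * v p powr (- b - 2)) * z p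
        - v p powr (\<kappa> + 1) * v p powr (- \<kappa> * q)"
    unfolding 1 2 3 by (simp add: algebra_simps)
  then have "- \<kappa> * dt v p = - b * (v p)\<^sup>2 * lap v p + b * (b + 1) * v p * z p
      - v p powr ((3 - m - 2 * q) / (1 - m))"
    unfolding P kb kb4 using V by simp
  then have "dt v p = (b / \<kappa>) * (v p)\<^sup>2 * lap v p - (b / \<kappa>) * (b + 1) * v p * z p
      + (1 / \<kappa>) * v p powr ((3 - m - 2 * q) / (1 - m))"
    using k0 by (simp add: field_simps)
  moreover have "b / \<kappa> = m" "1 / \<kappa> = (1 - m) / 2" using k0 by (auto simp: b_def \<kappa>_def)
  moreover have "m * (b + 1) = a" using m1 by (simp add: a_def b_def \<kappa>_def field_simps)
  ultimately show ?thesis by simp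
qed

text \<open>Here \<open>B0\<close> arises: with \<open>a\<close> inserted, the coefficient
  \<open>2 m (N - 1) - 2 a\<close> of \<open>z\<^sup>2\<close> equals \<open>- 1 / B0\<close>, and
  it is negative by \<open>mc\<close>. The absorption contributes
  \<open>2 c e = 3 - m - 2 q\<close>, because \<open>c = (1 - m) / 2\<close>.\<close>

lemma z_inequality:
  assumes p: "p \<in> half_space"
  shows "dt z p \<le> m * (v p)\<^sup>2 * lap z p + 2 * (m - a) * v p * (\<Sum>j\<in>UNIV. dx j v p * dx j z p)
    - (z p)\<^sup>2 / beta0 + (3 - m - 2 * q) * U p powr (q - 1) * z p"
proof -
  let ?e = "(3 - m - 2 * q) / (1 - m)"
  have "dt z p \<le> m * (v p)\<^sup>2 * lap z p + 2 * (m - a) * v p * (\<Sum>j\<in>UNIV. dx j v p * dx j z p)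
      + (2 * m * (real CARD('n) - 1) - 2 * a) * (z p)\<^sup>2
      + 2 * ((1 - m) / 2) * ?e * v p powr (?e - 1) * z p"
    unfolding z_def[abs_def]
    by (rule gradient_square_inequality[OF sv v_pos m0 _ p]) (use v_equation in \<open>auto simp: z_def\<close>)
  moreover have "2 * ((1 - m) / 2) * ?e = 3 - m - 2 * q" using m1 by simp
  moreover have "v p powr (?e - 1) = U p powr (q - 1)"
  proof -
    have "(m - 1) / 2 * (?e - 1) = q - 1" using m1 by (simp add: field_simps)
    then show ?thesis by (simp only: v_def powr_powr)
  qed
  moreover have "(2 * m * (real CARD('n) - 1) - 2 * a) * (z p)\<^sup>2 = - ((z p)\<^sup>2 / beta0)"
  proof -
    define N where "N = real CARD('n)"
    have D: "m * N - N + 2 > 0" using mc by (simp add: N_def algebra_simps)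
    have "2 * m * (N - 1) - 2 * a = - (2 * m * (m * N - N + 2) / (1 - m))"
      using m1 by (simp add: a_def field_simps)
    also have "2 * m * (m * N - N + 2) / (1 - m) = 1 / beta0" by (simp add: beta0_def N_def)
    finally show ?thesis by (simp add: N_def)
  qed
  ultimately show ?thesis by simp
qed

text \<open>
  The barrier \<open>Z / \<zeta>\<^sup>2\<close> blows up at a finite radius. Since \<open>v\<^sup>2\<close> grows at most quadratically, the
  logarithmic profile \<open>\<zeta> = 1 - \<delta> ln (1 + r)\<close> makes all error terms at a contact point
  of order \<open>\<delta> z\<^sup>2\<close>.
\<close>
lemma gradient_barrier:
  fixes x1 :: "real^'n"
  assumes \<tau>: "0 < \<tau>" "\<tau> < T" and kap: "kap > 0" and A: "A \<ge> 0"
    and bdA: "\<And>p. p \<in> half_space \<Longrightarrow> (3 - m - 2 * q) * U p powr (q - 1) \<le> A"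
    and \<Lambda>: "\<Lambda> > 0"
    and growth: "\<And>t x. \<tau> \<le> t \<Longrightarrow> t \<le> T \<Longrightarrow> (v (t, x))\<^sup>2 \<le> \<Lambda> * (1 + (norm (x - x1))\<^sup>2)"
  shows "z (T, x1) \<le> (1 + kap) * (A * beta0 + beta0 / (T - \<tau>))"
proof (rule ccontr)
  assume neg: "\<not> ?thesis"
  define N where "N = real CARD('n)"
  define Z where "Z s = (1 + kap) * (A * beta0 + beta0 / (s - \<tau>))" for s
  define Zm where "Zm = beta0 / (T - \<tau>)"
  \<comment> \<open>The two fractions bound the localization errors, estimated in \<open>t1\<close>
    and \<open>t2\<close>, in units of \<open>\<delta> * z0\<^sup>2\<close>; \<open>Zm\<close> is a
    lower bound for \<open>Z\<close> up to time \<open>T\<close>.\<close>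
  define D where "D = m * \<Lambda> * (4 * N + 24) / Zm + 8 * \<bar>m - a\<bar> * sqrt \<Lambda> / sqrt Zm + 1"
  \<comment> \<open>Keeps the errors below the share \<open>kap / (1 + kap)\<close> of the good term
    \<open>z0\<^sup>2 / beta0\<close>; the factor \<open>1 + kap\<close> in \<open>Z\<close> is
    there to make do with the remaining share \<open>1 / (1 + kap)\<close>.\<close>
  define \<delta> where "\<delta> = min 1 (kap / (1 + kap) / beta0 / (2 * D))"
  define \<zeta> where "\<zeta> r = 1 - \<delta> * ln (1 + r)" for r :: real
  define R where "R = sqrt (exp (1 / \<delta>) - 1)"
  define X where "X = {\<tau>..T} \<times> cball x1 R"
  \<comment> \<open>\<open>g\<close> is \<open>- (t - \<tau>) \<zeta>\<^sup>2 f\<close> multiplied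
    out. Unlike \<open>f\<close> it is continuous also where the barrier is infinite, namely at
    \<open>t = \<tau>\<close> and \<open>|x - x1| = R\<close>. So \<open>E\<close> is compact, and
    as \<open>g\<close> is positive at those points \<open>E\<close> avoids them.\<close>
  define g where "g p = (1 + kap) * (A * beta0 * (fst p - \<tau>) + beta0)
      - (fst p - \<tau>) * (\<zeta> ((norm (snd p - x1))\<^sup>2))\<^sup>2 * z p" for p
  define E where "E = {p \<in> X. g p \<le> 0}"
  define f where "f p = z p - Z (fst p) / (\<zeta> ((norm (snd p - x1))\<^sup>2))\<^sup>2" for p
  have B: "beta0 > 0" by (rule beta0_pos)
  have Zm: "Zm > 0" using B \<tau> by (simp add: Zm_def)
  have N: "N \<ge> 0" by (simp add: N_def)
  have D: "D > 0" using m0 \<Lambda> N Zm by (simp add: D_def add_nonneg_pos)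
  have \<delta>: "\<delta> > 0" "\<delta> \<le> 1" using kap B D by (auto simp: \<delta>_def)
  have \<delta>D: "D * \<delta> < kap / (1 + kap) / beta0"
  proof -
    have "D * \<delta> \<le> D * (kap / (1 + kap) / beta0 / (2 * D))" using D by (intro mult_left_mono) (auto simp: \<delta>_def)
    also have "\<dots> = (kap / (1 + kap) / beta0) / 2" using D by simp
    also have "\<dots> < kap / (1 + kap) / beta0"
    proof -
      have half: "c / 2 < c" if "c > 0" for c :: real using that by simp
      show ?thesis by (rule half) (use kap B in simp)
    qed
    finally show ?thesis .
  qed
  have Zpos: "Z s \<ge> Zm" "Z s > 0" if "\<tau> < s" "s \<le> T" for s
  proof -
    have "beta0 / (T - \<tau>) \<le> beta0 / (s - \<tau>)" using that B by (intro divide_left_mono) auto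
    moreover have "0 \<le> A * beta0" using A B by simp
    ultimately have "Zm \<le> A * beta0 + beta0 / (s - \<tau>)" unfolding Zm_def by linarith
    also have "\<dots> \<le> Z s"
    proof -
      have "0 \<le> A * beta0 + beta0 / (s - \<tau>)" using A B that by simp
      then show ?thesis unfolding Z_def using kap
          mult_right_mono[of 1 "1 + kap" "A * beta0 + beta0 / (s - \<tau>)"] by simp
    qed
    finally show "Z s \<ge> Zm" .
    then show "Z s > 0" using Zm by simp
  qed
  have XH: "X \<subseteq> half_space" using \<tau> by (auto simp: X_def)
  have r1: "1 + (norm y)\<^sup>2 > 0" for y :: "real^'n" by (simp add: add_pos_nonneg)
  have c\<zeta>: "continuous_on S (\<lambda>p. \<zeta> ((norm (snd p - x1))\<^sup>2))" for S :: "(real \<times> (real^'n)) set"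
    unfolding \<zeta>_def using r1 by (intro continuous_intros) (auto simp: less_imp_neq[symmetric])
  have cz: "continuous_on S z" if "S \<subseteq> half_space" for S
    using smooth_on_continuous[OF sz] that continuous_on_subset by blast
  have \<zeta>R: "norm (y - x1) < R" if "\<zeta> ((norm (y - x1))\<^sup>2) > 0" for y
  proof -
    have "ln (1 + (norm (y - x1))\<^sup>2) < 1 / \<delta>" using that \<delta>(1) by (simp add: \<zeta>_def field_simps)
    then have "1 + (norm (y - x1))\<^sup>2 < exp (1 / \<delta>)" using r1[of "y - x1"] by (metis exp_less_cancel_iff exp_ln)
    then have "(norm (y - x1))\<^sup>2 < exp (1 / \<delta>) - 1" by simp
    then show ?thesis unfolding R_def by (rule real_less_rsqrt)
  qed
  have \<zeta>X: "\<zeta> ((norm (y - x1))\<^sup>2) \<ge> 0" if "norm (y - x1) \<le> R" for y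
  proof -
    have e1: "exp (1 / \<delta>) - 1 \<ge> 0" using \<delta> by simp
    have "(norm (y - x1))\<^sup>2 \<le> R\<^sup>2" using that by (intro power_mono) auto
    then have "1 + (norm (y - x1))\<^sup>2 \<le> exp (1 / \<delta>)" using e1 by (simp add: R_def)
    then have "ln (1 + (norm (y - x1))\<^sup>2) \<le> ln (exp (1 / \<delta>))" using r1 by (subst ln_le_cancel_iff) auto
    then show ?thesis using \<delta>(1) by (simp add: \<zeta>_def field_simps)
  qed
  have onE: "\<tau> < s \<and> s \<le> T \<and> \<zeta> ((norm (y - x1))\<^sup>2) > 0" if "(s, y) \<in> E" for s y
  proof -
    have s: "\<tau> \<le> s" "s \<le> T" "norm (y - x1) \<le> R" and le: "g (s, y) \<le> 0"
      using that by (auto simp: E_def X_def dist_norm norm_minus_commute)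
    have "0 < (1 + kap) * (A * beta0 * (s - \<tau>) + beta0)"
      using kap A B s by (intro mult_pos_pos add_nonneg_pos) auto
    then have "0 < (s - \<tau>) * (\<zeta> ((norm (y - x1))\<^sup>2))\<^sup>2 * z (s, y)" using le by (simp add: g_def)
    then have "s - \<tau> \<noteq> 0" "\<zeta> ((norm (y - x1))\<^sup>2) \<noteq> 0" by auto
    then show ?thesis using s \<zeta>X[of y] by (simp add: order_less_le)
  qed
  have gf: "g (s, y) = - (s - \<tau>) * (\<zeta> ((norm (y - x1))\<^sup>2))\<^sup>2 * f (s, y)"
    if "\<tau> < s" "\<zeta> ((norm (y - x1))\<^sup>2) > 0" for s y
    using that by (simp add: g_def f_def Z_def field_simps)
  have "compact X" unfolding X_def by (intro compact_Times) auto
  then have "compact E" unfolding E_def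
    by (intro compact_sublevel) (auto simp: g_def intro!: continuous_intros c\<zeta> cz XH)
  moreover have T1: "f (T, x1) > 0" using neg by (simp add: f_def \<zeta>_def Z_def)
  have "g (T, x1) \<le> 0" using gf[of T x1] \<tau> T1 by (simp add: \<zeta>_def mult_nonpos_nonneg)
  then have TE: "(T, x1) \<in> E" using \<tau> \<zeta>R[of x1] by (simp add: E_def X_def \<zeta>_def)
  moreover have "continuous_on E f"
  proof -
    have "E \<subseteq> half_space" using XH by (auto simp: E_def)
    moreover have "\<zeta> ((norm (snd p - x1))\<^sup>2) \<noteq> 0" "fst p - \<tau> \<noteq> 0" if "p \<in> E" for p
      using onE[of "fst p" "snd p"] that by auto
    ultimately show ?thesis unfolding f_def Z_def by (intro continuous_intros c\<zeta> cz) auto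
  qed
  ultimately obtain p0 where p0: "p0 \<in> E" "\<And>p. p \<in> E \<Longrightarrow> f p \<le> f p0"
    using continuous_attains_sup[of E f] by blast
  obtain t0 x0 where p0_eq: "p0 = (t0, x0)" by (cases p0)
  have f0: "f (t0, x0) > 0" using p0(2)[OF TE] T1 p0_eq by simp
  define r where "r = (norm (x0 - x1))\<^sup>2"
  have K0: "\<tau> < t0" "t0 \<le> T" and \<zeta>0: "\<zeta> r > 0" using onE[of t0 x0] p0(1) by (auto simp: p0_eq r_def)
  have t0: "t0 > 0" using K0 \<tau> by simp
  have r0: "r \<ge> 0" by (simp add: r_def)
  have \<zeta>1: "\<zeta> r \<le> 1" using \<delta> r0 by (simp add: \<zeta>_def)
  define \<beta> where "\<beta> s r = - (Z s / (\<zeta> r)\<^sup>2)" for s r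
  define \<beta>1 where "\<beta>1 r = - (2 * Z t0 * \<delta>) / ((1 + r) * (\<zeta> r) ^ 3)" for r
  have \<zeta>d: "(\<zeta> has_real_derivative - \<delta> / (1 + r)) (at r)" if "1 + r > 0" for r
    unfolding \<zeta>_def using that by (auto intro!: derivative_eq_intros)
  have b1: "\<forall>\<^sub>F r in nhds r. (\<beta> t0 has_real_derivative \<beta>1 r) (at r)"
  proof -
    have c1: "continuous_on {- 1<..} \<zeta>"
    proof (intro continuous_at_imp_continuous_on ballI)
      fix r :: real assume "r \<in> {- 1<..}"
      then have "1 + r > 0" by simp
      then show "isCont \<zeta> r" by (rule DERIV_isCont[OF \<zeta>d])
    qed
    have "open ({- 1<..} \<inter> \<zeta> -` {0<..})"
      by (rule continuous_open_preimage[OF c1]) auto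
    then have "\<forall>\<^sub>F r in nhds r. r \<in> {- 1<..} \<inter> \<zeta> -` {0<..}"
      using \<zeta>0 r0 by (intro eventually_nhds_in_open) auto
    then show ?thesis
    proof eventually_elim
      case (elim r)
      then have r: "1 + r > 0" "\<zeta> r > 0" by auto
      have "(\<beta> t0 has_real_derivative 2 * Z t0 * (- \<delta> / (1 + r)) / (\<zeta> r) ^ 3) (at r)"
        unfolding \<beta>_def using r by (intro has_derivative_neg_inverse_square \<zeta>d) auto
      then show ?case by (simp add: \<beta>1_def)
    qed
  qed
  define \<beta>2 where "\<beta>2 = 2 * Z t0 * \<delta> / ((1 + r)\<^sup>2 * (\<zeta> r) ^ 3) - 6 * Z t0 * \<delta>\<^sup>2 / ((1 + r)\<^sup>2 * (\<zeta> r) ^ 4)"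
  have b2: "(\<beta>1 has_real_derivative \<beta>2) (at r)"
  proof -
    have r: "1 + r > 0" using r0 by simp
    have "(\<beta>1 has_real_derivative - (- (2 * Z t0 * \<delta>)) / ((1 + r)\<^sup>2 * (\<zeta> r) ^ 3)
        - 3 * (- (2 * Z t0 * \<delta>)) * (- \<delta> / (1 + r)) / ((1 + r) * (\<zeta> r) ^ 4)) (at r)"
      unfolding \<beta>1_def using \<zeta>0 r by (intro has_derivative_inverse_cube \<zeta>d) auto
    then show ?thesis by (simp add: \<beta>2_def power2_eq_square mult_ac)
  qed
  define s where "s = t0 - \<tau>"
  have s0: "s > 0" using K0 by (simp add: s_def)
  have bt: "((\<lambda>t. \<beta> t r) has_real_derivative ((1 + kap) * beta0 / (s\<^sup>2 * (\<zeta> r)\<^sup>2))) (at t0)"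
  proof -
    have "((\<lambda>t. beta0 / (t - \<tau>)) has_real_derivative - (beta0 / s\<^sup>2)) (at t0)"
      using s0 by (auto intro!: derivative_eq_intros simp: s_def power2_eq_square)
    then have "(Z has_real_derivative (1 + kap) * (0 + - (beta0 / s\<^sup>2))) (at t0)"
      unfolding Z_def by (intro DERIV_cmult DERIV_add DERIV_const)
    from DERIV_minus[OF DERIV_cdivide[OF this, of "(\<zeta> r)\<^sup>2"]]
    show ?thesis unfolding \<beta>_def by simp
  qed
  have smz: "smooth (\<lambda>p. - z p)" by (rule smooth_uminus[OF sz])
  have "open ({\<tau><..} \<times> UNIV \<inter> (\<lambda>p. \<zeta> ((norm (snd p - x1))\<^sup>2)) -` {0<..})"
    by (intro continuous_open_preimage c\<zeta> open_Times) auto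
  then have "\<forall>\<^sub>F p in nhds (t0, x0). p \<in> {\<tau><..} \<times> UNIV \<inter> (\<lambda>p. \<zeta> ((norm (snd p - x1))\<^sup>2)) -` {0<..}"
    using K0 \<zeta>0 by (intro eventually_nhds_in_open) (auto simp: r_def)
  then have min: "\<forall>\<^sub>F p in nhds (t0, x0). fst p \<le> t0 \<longrightarrow>
      - z (t0, x0) - \<beta> t0 r \<le> - z p - \<beta> (fst p) ((norm (snd p - x1))\<^sup>2)"
  proof eventually_elim
    case (elim p)
    have "f p \<le> f (t0, x0)" if le: "fst p \<le> t0"
    proof (cases "p \<in> E")
      case True
      then show ?thesis using p0(2) by (simp add: p0_eq)
    next
      case False
      have "p \<in> X"
        using elim le K0 \<zeta>R[of "snd p"] by (cases p) (auto simp: X_def dist_norm norm_minus_commute)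
      then have "g p > 0" using False by (simp add: E_def)
      then have "f p < 0"
        using gf[of "fst p" "snd p"] elim by (auto simp: mult_less_0_iff zero_less_mult_iff)
      then show ?thesis using f0 by simp
    qed
    then show ?case by (auto simp: f_def \<beta>_def r_def)
  qed
  note touch = touching_below[OF smz t0, of \<beta> _ x0 x1, folded r_def, OF b1 b2 bt min]
  have th: "(t0, x0) \<in> half_space" using t0 by simp
  define z0 where "z0 = z (t0, x0)"
  define v0 where "v0 = v (t0, x0)"
  define Z0 where "Z0 = Z t0"
  have Z0: "Z0 > 0" "Z0 \<ge> Zm" using Zpos[OF K0] by (auto simp: Z0_def)
  have zZ: "z0 \<ge> Z0 / (\<zeta> r)\<^sup>2" using f0 by (simp add: f_def z0_def Z0_def r_def)
  have z0: "z0 > 0" using zZ Z0 \<zeta>0 by (smt (verit) divide_pos_pos zero_less_power)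
  have v0: "v0 > 0" unfolding v0_def by (rule v_pos[OF th])
  have v2: "v0\<^sup>2 \<le> \<Lambda> * (1 + r)" unfolding v0_def r_def using growth K0 by simp
  have dtz: "dt z (t0, x0) \<ge> - ((1 + kap) * beta0 / (s\<^sup>2 * (\<zeta> r)\<^sup>2))"
    using touch(1) dt_uminus[OF sz th] by simp
  have lapz: "lap z (t0, x0) \<le> (4 * N + 24) * \<delta> * Z0 / ((1 + r) * (\<zeta> r) ^ 4)"
  proof -
    have "lap z (t0, x0) \<le> - (2 * N * \<beta>1 r + 4 * r * \<beta>2)"
      using touch(3) lap_uminus[OF sz th] by (simp add: N_def)
    also have "\<dots> = 4 * N * (\<delta> * Z0 / ((1 + r) * (\<zeta> r) ^ 3)) - 8 * r * (Z0 * \<delta> / ((1 + r)\<^sup>2 * (\<zeta> r) ^ 3))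
        + 24 * \<delta> * (r * (\<delta> * Z0 / ((1 + r)\<^sup>2 * (\<zeta> r) ^ 4)))"
      by (simp add: \<beta>1_def \<beta>2_def Z0_def power2_eq_square algebra_simps)
    also have "\<dots> \<le> 4 * N * (\<delta> * Z0 / ((1 + r) * (\<zeta> r) ^ 4)) - 0 + 24 * 1 * (\<delta> * Z0 / ((1 + r) * (\<zeta> r) ^ 4))"
    proof (intro add_mono diff_mono mult_left_mono)
      have "(\<zeta> r) ^ 4 \<le> (\<zeta> r) ^ 3" using \<zeta>0 \<zeta>1 by (intro power_decreasing) auto
      then show "\<delta> * Z0 / ((1 + r) * (\<zeta> r) ^ 3) \<le> \<delta> * Z0 / ((1 + r) * (\<zeta> r) ^ 4)"
        using \<zeta>0 r0 \<delta> Z0 by (intro divide_left_mono mult_left_mono mult_pos_pos) auto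
      have "24 * \<delta> * (r * (\<delta> * Z0 / ((1 + r)\<^sup>2 * (\<zeta> r) ^ 4)))
         = 24 * (\<delta> * (r / (1 + r))) * (\<delta> * Z0 / ((1 + r) * (\<zeta> r) ^ 4))"
        by (simp add: power2_eq_square mult_ac)
      also have "\<dots> \<le> 24 * 1 * (\<delta> * Z0 / ((1 + r) * (\<zeta> r) ^ 4))"
        using \<delta> r0 Z0 \<zeta>0 by (intro mult_right_mono mult_left_mono mult_le_one) (auto simp: divide_le_eq)
      finally show "24 * \<delta> * (r * (\<delta> * Z0 / ((1 + r)\<^sup>2 * (\<zeta> r) ^ 4))) \<le> 24 * 1 * (\<delta> * Z0 / ((1 + r) * (\<zeta> r) ^ 4))" .
    qed (use N r0 Z0 \<delta> \<zeta>0 in auto)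
    also have "\<dots> = (4 * N + 24) * \<delta> * Z0 / ((1 + r) * (\<zeta> r) ^ 4)"
      by (simp add: distrib_right add_divide_distrib)
    finally show ?thesis .
  qed
  define Y where "Y = sqrt Z0"
  define y where "y = sqrt z0"
  have Yy: "Y > 0" "y > 0" "Y\<^sup>2 = Z0" "y\<^sup>2 = z0" using Z0 z0 by (auto simp: Y_def y_def)
  have Yz: "Y / \<zeta> r \<le> y"
  proof (rule power2_le_imp_le)
    show "(Y / \<zeta> r)\<^sup>2 \<le> y\<^sup>2" using zZ by (simp add: Yy power_divide)
  qed (use Yy in simp)
  \<comment> \<open>The growth bound on \<open>v\<close> cancels \<open>1 / (1 + r)\<close>, and
    \<open>Z0 / (\<zeta> r)^4\<close> is the square of \<open>Z0 / (\<zeta> r)^2\<close> divided by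
    \<open>Z0\<close>, hence at most \<open>z0\<^sup>2 / Zm\<close>.\<close>
  have t1: "m * v0\<^sup>2 * lap z (t0, x0) \<le> (m * \<Lambda> * (4 * N + 24) / Zm) * \<delta> * z0\<^sup>2"
  proof -
    have "m * v0\<^sup>2 * lap z (t0, x0) \<le> m * v0\<^sup>2 * ((4 * N + 24) * \<delta> * Z0 / ((1 + r) * (\<zeta> r) ^ 4))"
      using lapz m0 by (intro mult_left_mono) auto
    also have "\<dots> \<le> m * (\<Lambda> * (1 + r)) * ((4 * N + 24) * \<delta> * Z0 / ((1 + r) * (\<zeta> r) ^ 4))"
      using v2 m0 N \<delta> Z0 r0 by (intro mult_right_mono mult_left_mono) auto
    also have "\<dots> = m * \<Lambda> * (4 * N + 24) * \<delta> * ((Z0 / (\<zeta> r)\<^sup>2)\<^sup>2 / Z0)"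
    proof -
      have "m * (\<Lambda> * e) * (n * d * Q / (e * c ^ 4)) = m * \<Lambda> * n * d * ((Q / c\<^sup>2)\<^sup>2 / Q)"
        if "e > 0" "Q > 0" "c > 0" for e n d Q c
        using that by (simp add: field_simps power2_eq_square power4_eq_xxxx)
      then show ?thesis using r0 Z0 \<zeta>0 by simp
    qed
    also have "\<dots> \<le> m * \<Lambda> * (4 * N + 24) * \<delta> * (z0\<^sup>2 / Zm)"
      using zZ Z0 Zm \<zeta>0 m0 \<Lambda> N \<delta> by (intro mult_left_mono frac_le power_mono) auto
    finally show ?thesis by (simp add: mult_ac)
  qed
  \<comment> \<open>At the contact the gradient of \<open>z\<close> is radial, so Cauchy-Schwarz
    leaves the square root \<open>y\<close> of \<open>z0\<close>. Again \<open>1 + r\<close>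
    cancels, and the powers of \<open>\<zeta> r\<close> are absorbed by
    \<open>Y / \<zeta> r \<le> y\<close>.\<close>
  have t2: "2 * (m - a) * v0 * (\<Sum>j\<in>UNIV. dx j v (t0, x0) * dx j z (t0, x0))
      \<le> (8 * \<bar>m - a\<bar> * sqrt \<Lambda> / sqrt Zm) * \<delta> * z0\<^sup>2"
  proof -
    define G where "G = 4 * Z0 * \<delta> / ((1 + r) * (\<zeta> r) ^ 3)"
    define S where "S = (\<Sum>j\<in>UNIV. dx j v (t0, x0) * (x0 - x1) $ j)"
    have G0: "G \<ge> 0" using Z0 \<delta> r0 \<zeta>0 by (simp add: G_def)
    have dz: "dx j z (t0, x0) = G * (x0 - x1) $ j" for j
      using touch(2)[of j] dx_uminus[OF sz th, of j] by (simp add: \<beta>1_def G_def Z0_def mult_ac)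
    have sum: "(\<Sum>j\<in>UNIV. dx j v (t0, x0) * dx j z (t0, x0)) = G * S"
      by (simp add: dz S_def sum_distrib_left mult_ac)
    have "S\<^sup>2 \<le> z0 * r"
      unfolding S_def z0_def z_def r_def norm_sq_sum by (rule Cauchy_Schwarz_ineq_sum)
    then have "(v0 * S)\<^sup>2 \<le> \<Lambda> * (1 + r) * (z0 * r)"
      unfolding power_mult_distrib using v2 z0 r0 \<Lambda> by (intro mult_mono) auto
    also have "\<dots> \<le> \<Lambda> * (1 + r) * (z0 * (1 + r))"
      using \<Lambda> r0 z0 by (intro mult_left_mono) auto
    also have "\<dots> = (sqrt \<Lambda> * (1 + r) * y)\<^sup>2"
      unfolding power_mult_distrib Yy(4) using \<Lambda> by (simp add: power2_eq_square[of "1 + r"] mult_ac)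
    finally have "\<bar>v0 * S\<bar>\<^sup>2 \<le> (sqrt \<Lambda> * (1 + r) * y)\<^sup>2" by simp
    then have "\<bar>v0 * S\<bar> \<le> sqrt \<Lambda> * (1 + r) * y"
      by (rule power2_le_imp_le) (use \<Lambda> r0 Yy in simp)
    have "2 * (m - a) * v0 * (G * S) = (m - a) * (2 * G) * (v0 * S)" by (simp only: mult_ac)
    also have "\<dots> \<le> \<bar>(m - a) * (2 * G) * (v0 * S)\<bar>" by (rule abs_ge_self)
    also have "\<dots> = \<bar>m - a\<bar> * \<bar>2 * G\<bar> * \<bar>v0 * S\<bar>" by (simp only: abs_mult)
    also have "\<bar>2 * G\<bar> = 2 * G" using G0 by simp
    also have "\<bar>m - a\<bar> * (2 * G) * \<bar>v0 * S\<bar> = 2 * \<bar>m - a\<bar> * G * \<bar>v0 * S\<bar>" by (simp only: mult_ac)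
    also have "\<dots> \<le> 2 * \<bar>m - a\<bar> * G * (sqrt \<Lambda> * (1 + r) * y)"
      using \<open>\<bar>v0 * S\<bar> \<le> _\<close> G0 by (intro mult_left_mono) auto
    also have "\<dots> = 8 * \<bar>m - a\<bar> * sqrt \<Lambda> * \<delta> * (y * ((Y / \<zeta> r) ^ 3 / Y))"
    proof -
      have "2 * M * (4 * Y\<^sup>2 * \<delta> / (e * c ^ 3)) * (l * e * y) = 8 * M * l * \<delta> * (y * ((Y / c) ^ 3 / Y))"
        if "e > 0" "c > 0" for M e c l
        using that Yy(1) by (simp add: field_simps power2_eq_square power3_eq_cube)
      then show ?thesis unfolding G_def Yy(3)[symmetric] using r0 \<zeta>0 by simp
    qed
    also have "\<dots> \<le> 8 * \<bar>m - a\<bar> * sqrt \<Lambda> * \<delta> * (y * (y ^ 3 / sqrt Zm))"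
    proof (intro mult_left_mono frac_le power_mono)
      show "sqrt Zm \<le> Y" using Z0 by (simp add: Y_def)
    qed (use Yz Yy Zm \<Lambda> \<delta> \<zeta>0 in auto)
    also have "y * (y ^ 3 / sqrt Zm) = z0\<^sup>2 / sqrt Zm"
      by (simp add: Yy(4)[symmetric] power2_eq_square power3_eq_cube)
    finally show ?thesis unfolding sum by (simp add: mult_ac)
  qed
  have "dt z (t0, x0) \<le> m * v0\<^sup>2 * lap z (t0, x0)
      + 2 * (m - a) * v0 * (\<Sum>j\<in>UNIV. dx j v (t0, x0) * dx j z (t0, x0))
      - z0\<^sup>2 / beta0 + (3 - m - 2 * q) * U (t0, x0) powr (q - 1) * z0"
    unfolding v0_def z0_def by (rule z_inequality[OF th])
  moreover have "(3 - m - 2 * q) * U (t0, x0) powr (q - 1) * z0 \<le> A * z0"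
    using bdA[OF th] z0 by (intro mult_right_mono) auto
  moreover have "(m * \<Lambda> * (4 * N + 24) / Zm) * \<delta> * z0\<^sup>2 + (8 * \<bar>m - a\<bar> * sqrt \<Lambda> / sqrt Zm) * \<delta> * z0\<^sup>2
      = (D * \<delta>) * z0\<^sup>2 - \<delta> * z0\<^sup>2"
    by (simp add: D_def algebra_simps)
  moreover have "0 \<le> \<delta> * z0\<^sup>2" using \<delta> by simp
  moreover have "(D * \<delta>) * z0\<^sup>2 < (kap / (1 + kap) / beta0) * z0\<^sup>2"
    using \<delta>D z0 by (intro mult_strict_right_mono) auto
  ultimately have "z0\<^sup>2 / beta0 - (kap / (1 + kap) / beta0) * z0\<^sup>2 < A * z0 + (1 + kap) * beta0 / (s\<^sup>2 * (\<zeta> r)\<^sup>2)"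
    using t1 t2 dtz by linarith
  moreover have "z0\<^sup>2 / beta0 - (kap / (1 + kap) / beta0) * z0\<^sup>2 = z0 * (z0 / (beta0 * (1 + kap)))"
  proof -
    have e1: "1 - kap / (1 + kap) = 1 / (1 + kap)" using kap by (simp add: field_simps)
    have e2: "z0\<^sup>2 / beta0 - c / beta0 * z0\<^sup>2 = z0\<^sup>2 / beta0 * (1 - c)" for c
      by (simp add: left_diff_distrib diff_divide_distrib mult.commute)
    show ?thesis unfolding e2 e1 by (simp add: power2_eq_square)
  qed
  \<comment> \<open>The two summands of \<open>Z0 / (beta0 * (1 + kap)) = A + 1 / s\<close> pay for
    \<open>A * z0\<close> and for the time derivative of the barrier.\<close>
  moreover have "z0 * (z0 / (beta0 * (1 + kap))) \<ge> A * z0 + (1 + kap) * beta0 / (s\<^sup>2 * (\<zeta> r)\<^sup>2)"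
  proof -
    have \<zeta>2: "0 < (\<zeta> r)\<^sup>2" "(\<zeta> r)\<^sup>2 \<le> 1" using \<zeta>0 \<zeta>1 by (auto simp: power_le_one)
    have Zs: "Z0 = (beta0 * (1 + kap)) * (A + 1 / s)" unfolding Z0_def Z_def s_def divide_inverse by (simp only: algebra_simps mult_1)
    have "z0 / (beta0 * (1 + kap)) \<ge> (Z0 / (\<zeta> r)\<^sup>2) / (beta0 * (1 + kap))"
      using zZ B kap by (intro divide_right_mono) auto
    then have "z0 / (beta0 * (1 + kap)) \<ge> (A + 1 / s) / (\<zeta> r)\<^sup>2" unfolding Zs using B kap by simp
    then have "z0 * (z0 / (beta0 * (1 + kap))) \<ge> z0 * ((A + 1 / s) / (\<zeta> r)\<^sup>2)"
      using z0 by (intro mult_left_mono) auto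
    moreover have "z0 * ((A + 1 / s) / (\<zeta> r)\<^sup>2) = z0 * (A / (\<zeta> r)\<^sup>2) + z0 * (1 / (s * (\<zeta> r)\<^sup>2))"
      using s0 \<zeta>2 by (simp add: field_simps)
    moreover have "A \<le> A / (\<zeta> r)\<^sup>2" using A \<zeta>2 by (simp add: le_divide_eq mult_left_le)
    then have "A * z0 \<le> z0 * (A / (\<zeta> r)\<^sup>2)"
      using z0 by (subst mult.commute) (intro mult_left_mono, auto)
    moreover have "Z0 \<le> Z0 / (\<zeta> r)\<^sup>2" using Z0 \<zeta>2 by (simp add: le_divide_eq mult_left_le)
    then have "(1 + kap) * beta0 / s \<le> z0"
    proof -
      have "(1 + kap) * beta0 / s = (beta0 * (1 + kap)) * (1 / s)" by (simp add: mult.commute)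
      also have "\<dots> \<le> Z0" unfolding Zs using A B kap by (intro mult_left_mono) auto
      finally show ?thesis using \<open>Z0 \<le> Z0 / (\<zeta> r)\<^sup>2\<close> zZ by linarith
    qed
    then have "((1 + kap) * beta0 / s) * (1 / (s * (\<zeta> r)\<^sup>2)) \<le> z0 * (1 / (s * (\<zeta> r)\<^sup>2))"
      using s0 \<zeta>2 by (intro mult_right_mono) auto
    moreover have "((1 + kap) * beta0 / s) * (1 / (s * (\<zeta> r)\<^sup>2)) = (1 + kap) * beta0 / (s\<^sup>2 * (\<zeta> r)\<^sup>2)"
      by (simp add: power2_eq_square)
    ultimately show ?thesis by linarith
  qed
  ultimately show False by linarith
qed

text \<open>The conclusion of \<open>gradient_barrier\<close> does not involve
  \<open>\<Lambda>\<close>, so it does no harm that the growth constant of \<open>v\<close> may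
  explode as \<open>\<tau>\<close> tends to 0. The limit in \<open>kap\<close> is taken before that
  in \<open>\<tau>\<close>.\<close>

lemma gradient_bound:
  assumes K: "K > 0" "\<And>t x. t > 0 \<Longrightarrow> U (t, x) \<le> K" and T: "T > 0"
  shows "z (T, x) \<le> max (3 - m - 2 * q) 0 * K powr (q - 1) * beta0 + beta0 / T"
proof -
  define A where "A = max (3 - m - 2 * q) 0 * K powr (q - 1)"
  have A: "A \<ge> 0" by (simp add: A_def)
  have bdA: "(3 - m - 2 * q) * U p powr (q - 1) \<le> A" if p: "p \<in> half_space" for p
  proof -
    have "U p \<le> K" using K(2) p by (cases p) auto
    then have "U p powr (q - 1) \<le> K powr (q - 1)" using pos'[OF p] q1 by (intro powr_mono2) auto
    then have "max (3 - m - 2 * q) 0 * U p powr (q - 1) \<le> A" unfolding A_def by (intro mult_left_mono) auto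
    moreover have "(3 - m - 2 * q) * U p powr (q - 1) \<le> max (3 - m - 2 * q) 0 * U p powr (q - 1)"
      by (intro mult_right_mono) auto
    ultimately show ?thesis by linarith
  qed
  have step: "z (T, x) \<le> A * beta0 + beta0 / (T - \<tau>)" if \<tau>: "0 < \<tau>" "\<tau> < T" for \<tau>
  proof -
    obtain b where b: "b > 0"
      "\<And>t y. \<tau> \<le> t \<Longrightarrow> t \<le> T \<Longrightarrow> (b * (1 + (norm (y - x))\<^sup>2)) powr (- k) \<le> w (t, y)"
      using growth_bound[OF \<tau>(1) pos[OF \<tau>(1), of x], of T] by blast
    have growth: "(v (t, y))\<^sup>2 \<le> b * (1 + (norm (y - x))\<^sup>2)" if t: "\<tau> \<le> t" "t \<le> T" for t y
    proof -
      have pb: "b * (1 + (norm (y - x))\<^sup>2) > 0" using b(1) by (simp add: add_pos_nonneg)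
      have t0: "t > 0" using t \<tau> by simp
      have "w (t, y) powr (- 1 / k) \<le> ((b * (1 + (norm (y - x))\<^sup>2)) powr (- k)) powr (- 1 / k)"
        using b(2)[OF t, of y] pb k_facts(1) by (intro powr_mono2') auto
      also have "\<dots> = b * (1 + (norm (y - x))\<^sup>2)" using pb k_facts(1) by (simp add: powr_powr)
      finally have "w (t, y) powr (- 1 / k) \<le> b * (1 + (norm (y - x))\<^sup>2)" .
      moreover have "(v (t, y))\<^sup>2 = w (t, y) powr (- 1 / k)"
      proof -
        have "(v (t, y))\<^sup>2 = v (t, y) powr 2" using v_pos[of "(t, y)"] t0 by simp
        also have "\<dots> = U (t, y) powr ((m - 1) / 2 * 2)" by (simp only: v_def powr_powr)
        also have "(m - 1) / 2 * 2 = m - 1" by simp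
        also have "m - 1 = m * (- 1 / k)" using m0 m1 by (simp add: k_def)
        finally show ?thesis by (simp only: w_def powr_powr)
      qed
      ultimately show ?thesis by simp
    qed
    define S where "S = A * beta0 + beta0 / (T - \<tau>)"
    have S: "S > 0" using A beta0_pos \<tau> by (simp add: S_def add_nonneg_pos)
    have "z (T, x) \<le> S"
    proof (rule field_le_epsilon)
      fix e :: real assume e: "e > 0"
      have "z (T, x) \<le> (1 + e / S) * S"
        unfolding S_def by (rule gradient_barrier[OF \<tau> _ A bdA b(1) growth]) (use e S in \<open>simp_all add: S_def\<close>)
      then show "z (T, x) \<le> S + e" using S by (simp add: distrib_right)
    qed
    then show ?thesis by (simp add: S_def)
  qed
  have lim: "((\<lambda>\<tau>. A * beta0 + beta0 / (T - \<tau>)) \<longlongrightarrow> A * beta0 + beta0 / (T - 0)) (at_right 0)"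
    using T by (intro tendsto_intros) auto
  have ev: "\<forall>\<^sub>F \<tau> in at_right 0. z (T, x) \<le> A * beta0 + beta0 / (T - \<tau>)"
    using eventually_at_right_real[OF T] by eventually_elim (use step in auto)
  show ?thesis using tendsto_lowerbound[OF lim ev] by (simp add: A_def)
qed

end

section \<open>The initial trace\<close>

text \<open>Continuity in \<open>L^1\<close> makes the mass a continuous function on a compact time
  interval, so its boundedness is independent of the equation.\<close>

lemma L1_continuous_imp_mass_bounded:
  fixes u :: "real \<Rightarrow> 'a::euclidean_space \<Rightarrow> real"
  assumes int: "\<And>t. t \<ge> 0 \<Longrightarrow> integrable lborel (u t)"
    and lim: "\<And>t. t \<ge> 0 \<Longrightarrow> ((\<lambda>s. LINT x|lborel. \<bar>u s x - u t x\<bar>) \<longlongrightarrow> 0) (at t within {0..})"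
  obtains M where "\<And>s. 0 \<le> s \<Longrightarrow> s \<le> T \<Longrightarrow> (LINT x|lborel. u s x) \<le> M"
proof -
  have "continuous_on {0..} (\<lambda>s. LINT x|lborel. u s x)"
    unfolding continuous_on_def
  proof
    fix t :: real assume "t \<in> {0..}"
    then have t: "t \<ge> 0" by simp
    show "((\<lambda>s. LINT x|lborel. u s x) \<longlongrightarrow> (LINT x|lborel. u t x)) (at t within {0..})"
    proof (rule LIM_zero_cancel, rule tendsto_rabs_zero_cancel, rule tendsto_sandwich[OF _ _ tendsto_const lim[OF t]])
      have "\<bar>(LINT x|lborel. u s x) - (LINT x|lborel. u t x)\<bar> \<le> (LINT x|lborel. \<bar>u s x - u t x\<bar>)"
        if "s \<ge> 0" for s
      proof -
        have "(LINT x|lborel. u s x) - (LINT x|lborel. u t x) = (LINT x|lborel. u s x - u t x)"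
          using int[OF that] int[OF t] by simp
        then show ?thesis using integral_abs_bound[of lborel "\<lambda>x. u s x - u t x"] by simp
      qed
      then show "\<forall>\<^sub>F s in at t within {0..}. \<bar>(LINT x|lborel. u s x) - (LINT x|lborel. u t x)\<bar>
          \<le> (LINT x|lborel. \<bar>u s x - u t x\<bar>)"
        by (auto simp: eventually_at_filter)
    qed simp
  qed
  then have "compact ((\<lambda>s. LINT x|lborel. u s x) ` {0..T})"
    by (intro compact_continuous_image) (auto intro: continuous_on_subset)
  then have "bounded ((\<lambda>s. LINT x|lborel. u s x) ` {0..T})" by (rule compact_imp_bounded)
  then obtain M where M: "\<forall>s\<in>{0..T}. \<bar>LINT x|lborel. u s x\<bar> \<le> M"
    unfolding bounded_iff by auto
  show ?thesis
  proof (rule that)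
    fix s :: real assume "0 \<le> s" "s \<le> T"
    then have "\<bar>LINT x|lborel. u s x\<bar> \<le> M" using M by simp
    then show "(LINT x|lborel. u s x) \<le> M" by linarith
  qed
qed

text \<open>\<open>Linf_norm\<close> passes through \<open>real_of_ereal\<close>, which sends
  infinite values to 0. The essential supremum must therefore be located between 0 and \<infinity>
  before it can be identified with the norm.\<close>

lemma Linf_norm_bound:
  fixes f :: "real^'n::finite \<Rightarrow> real"
  assumes fin: "esssup lborel (\<lambda>x. ereal \<bar>f x\<bar>) < \<infinity>"
    and meas: "f \<in> borel_measurable lborel" and nz: "\<not> (AE x in lborel. f x = 0)"
  shows "AE x in lborel. \<bar>f x\<bar> \<le> Linf_norm f" and "Linf_norm f > 0"
proof -
  define S where "S = esssup lborel (\<lambda>x. ereal \<bar>f x\<bar>)"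
  have ae: "AE x in lborel. ereal \<bar>f x\<bar> \<le> S" unfolding S_def by (rule esssup_AE)
  have "S \<ge> 0"
  proof (rule ccontr)
    assume neg: "\<not> S \<ge> 0"
    from ae have "AE x in lborel. f x = 0"
    proof eventually_elim
      case (elim x)
      then show ?case using neg order_trans[of 0 "ereal \<bar>f x\<bar>" S] by auto
    qed
    with nz show False by simp
  qed
  then have S: "S = ereal (Linf_norm f)"
    using fin unfolding S_def[symmetric] Linf_norm_def by (cases S) auto
  from ae show ae': "AE x in lborel. \<bar>f x\<bar> \<le> Linf_norm f" unfolding S by simp
  have "Linf_norm f \<noteq> 0"
  proof
    assume "Linf_norm f = 0"
    with ae' have "AE x in lborel. f x = 0" by simp
    with nz show False by simp
  qed
  moreover have "Linf_norm f \<ge> 0" using \<open>S \<ge> 0\<close> S by simp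
  ultimately show "Linf_norm f > 0" by simp
qed

theorem theorem2p2:
  fixes m q :: real and u0 :: "real^'n::finite \<Rightarrow> real" and u :: "real \<Rightarrow> real^'n \<Rightarrow> real"
  defines "N \<equiv> real CARD('n)"
  defines "B0 \<equiv> (1 - m) / (2 * m * (m * N - N + 2))"
  assumes m_lo: "max (N - 2) 0 / N < m" and m_hi: "m < 1" and q: "q > 1"
    and u0_meas: "u0 \<in> borel_measurable lborel"
    and u0_L1: "integrable lborel u0"
    and u0_Linf: "esssup lborel (\<lambda>x. ereal \<bar>u0 x\<bar>) < \<infinity>"
    and u0_nonneg: "AE x in lborel. u0 x \<ge> 0"
    and u0_nonzero: "\<not> (AE x in lborel. u0 x = 0)"
    and sol: "is_solution m q u0 u"
  shows "\<forall>t>0. \<forall>x.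
     norm (grad (\<lambda>y. u t y powr ((m - 1) / 2)) x)
        \<le> sqrt (max (3 - m - 2 * q) 0 * B0) * Linf_norm u0 powr ((q - 1) / 2) + sqrt (B0 / t)
     \<and> 0 < u t x
     \<and> u t x \<le> (Linf_norm u0 powr (1 - q) + (q - 1) * t) powr (- 1 / (q - 1))"
proof (intro allI impI)
  fix t :: real and x :: "real^'n"
  assume t: "t > 0"
  define U where "U p = u (fst p) (snd p)" for p
  define K where "K = Linf_norm u0"
  note s1 = sol[unfolded is_solution_def]
  note s2 = conjunct2[OF s1]
  note s3 = conjunct2[OF s2]
  note s4 = conjunct2[OF s3]
  note s5 = conjunct2[OF s4]
  note s6 = conjunct2[OF s5]
  note s7 = conjunct2[OF s6]
  have u_0: "u 0 = u0" by (rule ext) (rule conjunct1[OF s1, rule_format])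
  note nonneg = conjunct1[OF s2, rule_format] and int = conjunct1[OF s6, rule_format]
    and L1 = conjunct1[OF s7, rule_format] and eqn = conjunct2[OF s7, rule_format]
  obtain C where C: "\<forall>t>0. \<forall>x. \<bar>u t x\<bar> \<le> C" using conjunct1[OF s3] ..
  have sU: "smooth U" using conjunct1[OF s4] unfolding half_space_def U_def[abs_def] .
  have sW: "smooth (\<lambda>p. U p powr m)" using conjunct1[OF s5] unfolding half_space_def U_def .
  have N: "N > 0" by (simp add: N_def)
  have m0: "m > 0" by (rule le_less_trans[OF _ m_lo]) (use N in simp)
  have "max (N - 2) 0 < m * N" using m_lo N by (simp add: divide_less_eq)
  then have mc: "N * (1 - m) < 2" by (simp add: algebra_simps)
  \<comment> \<open>The maximum with 1 provides the positive bound that the locale demands.\<close>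
  interpret fast_diffusion_absorption m q "max C 1" U
  proof
    show "0 < m" "m < 1" "q > 1" "max C 1 > 0" "real CARD('n) * (1 - m) < 2"
      using m0 m_hi q mc by (auto simp: N_def)
    show "U (t, x) \<ge> 0" "U (t, x) \<le> max C 1" if "t > 0" for t x
      using nonneg[OF that, of x] C[rule_format, OF that, of x] by (auto simp: U_def)
    show "smooth U" "smooth (\<lambda>p. U p powr m)" by fact+
    show "dt U p = lap (\<lambda>p. U p powr m) p - U p powr q" if "p \<in> half_space" for p
    proof -
      obtain s y where p: "p = (s, y)" by (cases p)
      then have s: "s > 0" using that by simp
      have "dt U (s, y) = frechet_derivative (\<lambda>s. u s y) (at s) 1"
        using frechet_time[OF sU s, of y] by (simp add: U_def)
      moreover have "lap (\<lambda>p. U p powr m) (s, y) = laplacian (\<lambda>z. u s z powr m) y"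
        using laplacian_slice[OF sW s, of y] by (simp add: U_def)
      ultimately show ?thesis using eqn[OF s, of y] by (simp add: p U_def)
    qed
  qed
  have lim0: "((\<lambda>s. LINT x|lborel. \<bar>u s x - u0 x\<bar>) \<longlongrightarrow> 0) (at_right 0)"
  proof -
    have "{0<..} \<subseteq> {0::real..}" by auto
    from tendsto_mono[OF at_le[OF this] L1[OF order_refl]] show ?thesis unfolding u_0 .
  qed
  \<comment> \<open>If \<open>u\<close> vanished identically at all positive times before
    \<open>t\<close>, its \<open>L^1\<close> limit at time 0 would be 0, although \<open>u0\<close>
    is not. So \<open>u\<close> is positive at some earlier point, and the lower barriers spread
    this to every later point.\<close>
  have pos: "U (t, x) > 0" if t: "t > 0" for t x
  proof -
    have "\<exists>s y. 0 < s \<and> s < t \<and> U (s, y) > 0"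
    proof (rule ccontr)
      assume none: "\<not> ?thesis"
      have "\<forall>\<^sub>F s in at_right 0. (LINT x|lborel. \<bar>u s x - u0 x\<bar>) = (LINT x|lborel. \<bar>u0 x\<bar>)"
        using eventually_at_right_real[OF t]
      proof eventually_elim
        case (elim s)
        then have "u s y = 0" for y using none nonneg[of s y] by (auto simp: U_def order_less_le)
        then show ?case by simp
      qed
      then have "((\<lambda>s. LINT x|lborel. \<bar>u0 x\<bar>) \<longlongrightarrow> 0) (at_right (0::real))"
        by (rule tendsto_cong[THEN iffD1, OF _ lim0])
      then have "(LINT x|lborel. \<bar>u0 x\<bar>) = 0" by (simp add: tendsto_const_iff)
      then have "AE x in lborel. \<bar>u0 x\<bar> = 0"
        using integral_nonneg_eq_0_iff_AE[of lborel "\<lambda>x. \<bar>u0 x\<bar>"] u0_L1 by simp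
      then show False using u0_nonzero by simp
    qed
    then obtain s y where "0 < s" "s < t" "U (s, y) > 0" by blast
    then show ?thesis using positive_after[of s y t x] by simp
  qed
  interpret positive_fast_diffusion m q "max C 1" U
    by unfold_locales (rule pos)
  have K: "AE x in lborel. \<bar>u0 x\<bar> \<le> K" "K > 0"
    using Linf_norm_bound[OF u0_Linf u0_meas u0_nonzero] by (auto simp: K_def)
  have UK: "U (s, y) \<le> K" if s: "s > 0" for s y
  proof -
    obtain M where M: "\<And>s'. 0 \<le> s' \<Longrightarrow> s' \<le> s \<Longrightarrow> (LINT x|lborel. u s' x) \<le> M"
      using L1_continuous_imp_mass_bounded[OF int L1] by blast
    show ?thesis
    proof (rule sup_bound[OF s, of M u0])
      show "AE x in lborel. u0 x \<le> K" using K(1) by eventually_elim simp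
    qed (use int M u0_L1 u0_nonneg K(2) lim0 in \<open>auto simp: U_def\<close>)
  qed
  have "u t x \<le> (K powr (1 - q) + (q - 1) * t) powr (- 1 / (q - 1))"
    using absorption_bound[OF K(2) UK t, of x] by (simp add: U_def)
  moreover have "0 < u t x" using pos[OF t, of x] by (simp add: U_def)
  moreover have "norm (grad (\<lambda>y. u t y powr ((m - 1) / 2)) x)
        \<le> sqrt (max (3 - m - 2 * q) 0 * B0) * K powr ((q - 1) / 2) + sqrt (B0 / t)"
  proof -
    have B0_eq: "B0 = beta0" by (simp add: B0_def N_def beta0_def)
    have "pdiff i (\<lambda>y. u t y powr ((m - 1) / 2)) x = dx i v (t, x)" for i
      using pdiff_slice[OF sv t, of i x] by (simp add: v_def U_def)
    then have "(norm (grad (\<lambda>y. u t y powr ((m - 1) / 2)) x))\<^sup>2 = z (t, x)"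
      by (simp add: grad_def norm_sq_sum z_def)
    then have "norm (grad (\<lambda>y. u t y powr ((m - 1) / 2)) x) = sqrt (z (t, x))"
      by (metis norm_ge_zero real_sqrt_unique)
    also have "\<dots> \<le> sqrt (max (3 - m - 2 * q) 0 * K powr (q - 1) * B0 + B0 / t)"
      using gradient_bound[OF K(2) UK t, of x] B0_eq by simp
    also have "\<dots> \<le> sqrt (max (3 - m - 2 * q) 0 * K powr (q - 1) * B0) + sqrt (B0 / t)"
      using beta0_pos t B0_eq by (intro sqrt_add_le_add_sqrt) auto
    also have "sqrt (max (3 - m - 2 * q) 0 * K powr (q - 1) * B0)
        = sqrt (max (3 - m - 2 * q) 0 * B0) * sqrt (K powr (q - 1))"
      by (simp add: real_sqrt_mult mult_ac)
    also have "sqrt (K powr (q - 1)) = K powr ((q - 1) / 2)"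
      using K(2) by (simp add: powr_half_sqrt[symmetric] powr_powr)
    finally show ?thesis .
  qed
  ultimately show "norm (grad (\<lambda>y. u t y powr ((m - 1) / 2)) x)
        \<le> sqrt (max (3 - m - 2 * q) 0 * B0) * Linf_norm u0 powr ((q - 1) / 2) + sqrt (B0 / t)
     \<and> 0 < u t x
     \<and> u t x \<le> (Linf_norm u0 powr (1 - q) + (q - 1) * t) powr (- 1 / (q - 1))"
    by (simp add: K_def)
qed

end
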